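(* There is a bijection $\phi$ from the set of all two-stack sortable permutations (of all lengths $n\ge 1$) to the set of all fighting fish with the following property. Let $\pi$ be a two-stack sortable permutation of length $n$, with $i$ ascents and $j$ descents, and suppose that $\mathcal{S}(\pi)$ has $k$ left-to-right maxima and that there are $\ell$ elements $a$ such that $a$ precedes $a-1$ in $\mathcal{S}(\pi)$. Then $\phi(\pi)$ is a fighting fish with $n+1$ lower free edges, of which $i+1$ are left lower free edges and $j+1$ are right lower free edges, whose fin has length $k+1$, and which has $\ell+1$ tails.
   Context: Stack-sorting operator: for a finite sequence $A$ of distinct integers, define $\mathcal{S}(\epsilon)=\epsilon$ for the empty sequence, and if $A$ is non-empty with largest element $m$, write $A=A_L\cdot(m)\cdot A_R$ (concatenation, $A_L$ the part before $m$, $A_R$ the part after) and set $\mathcal{S}(A)=\mathcal{S}(A_L)\cdot\mathcal{S}(A_R)\cdot(m)$. A permutation $\sigma\in\mathfrak{S}_n$ ($n\ge1$), viewed as the sequence $(\sigma(1),\dots,\sigma(n))$, is two-stack sortable if $\mathcal{S}(\mathcal{S}(\sigma))$ is the identity permutation; the empty permutation is not counted as two-stack sortable. An ascent (resp. descent) of $\sigma$ is an index $i$ with $\sigma(i)<\sigma(i+1)$ (resp. $\sigma(i)>\sigma(i+1)$). A left-to-right maximum of a sequence $(b_1,\dots,b_n)$ is an index $i$ with $b_i>b_j$ for all $j<i$. Fighting fish: a cell is a unit square rotated by 45 degrees, so it has an upper-left, lower-left, upper-right and lower-right edge, and a left and a right vertex. Cells are glued along edges; an edge is free if it belongs to only one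 cell. A fighting fish is any object obtained by starting from a single cell (the head) and repeatedly adding a new cell in one of three ways: (a) glue the new cell's lower-left edge to a free upper-right edge of an existing cell; (b) glue the new cell's upper-left edge to a free lower-right edge of an existing cell; (c) if a cell $a$ has cells $b$ and $c$ glued to its upper-right and lower-right edges respectively, and $b$ has a free lower-right edge and $c$ has a free upper-right edge, glue the new cell simultaneously to both (its upper-left edge to the lower-right edge of $b$, its lower-left edge to the upper-right edge of $c$). Fighting fish are considered as glued surfaces up to isomorphism (cells may overlap when drawn in the plane). A lower free edge is a free edge that is the lower-left or lower-right edge of its cell; it is called left in the first case and right in the second. A tail is the right vertex of a cell both of whose right edges are free. The nose is the left vertex of the head. The fin is the path from the nose to the first tail met when following the free edges (the boundary) counter-clockwise; its length (fin-length) is its number of edges. *)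

theory Defs
  imports Main
begin

text \<open>A permutation of length n is represented as the list (sigma 1, ..., sigma n)
  of the numbers 1..n.  The stack-sorting operator is defined on arbitrary lists
  (it is intended for lists of distinct elements): for a non-empty list with
  largest element m, written A_L m A_R, S(A) = S(A_L) S(A_R) m.\<close>

lemma takeWhile_len_less_aux: "m \<in> set A \<Longrightarrow> length (takeWhile (\<lambda>x. x \<noteq> m) A) < length A"
  by (induction A) auto

function stack_sort :: "nat list \<Rightarrow> nat list" where
  "stack_sort [] = []"
| "stack_sort (a # as) =
     (let A = a # as; m = Max (set A) in
        stack_sort (takeWhile (\<lambda>x. x \<noteq> m) A) @
        stack_sort (tl (dropWhile (\<lambda>x. x \<noteq> m) A)) @ [m])"
  by pat_completeness auto
termination
proof (relation "measure length")
  fix a :: nat and as A m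
  assume h: "A = a # as" "m = Max (set A)"
  have mem: "m \<in> set A" using h by (metis List.finite_set Max_in empty_iff list.set_intros(1))
  have "length (takeWhile (\<lambda>x. x \<noteq> m) A) < length A"
    using mem by (rule takeWhile_len_less_aux)
  then show "(takeWhile (\<lambda>x. x \<noteq> m) A, a # as) \<in> measure length" using h by simp
  have "length (tl (dropWhile (\<lambda>x. x \<noteq> m) A)) < length A"
    proof -
    have "length (dropWhile (\<lambda>x. x \<noteq> m) A) \<le> length A" by (rule length_dropWhile_le)
    moreover have "dropWhile (\<lambda>x. x \<noteq> m) A \<noteq> []" using mem by simp
    ultimately show ?thesis by (cases "dropWhile (\<lambda>x. x \<noteq> m) A") auto
  qed
  then show "(tl (dropWhile (\<lambda>x. x \<noteq> m) A), a # as) \<in> measure length" using h by simp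
qed auto

definition is_perm :: "nat list \<Rightarrow> bool" where
  "is_perm \<sigma> \<longleftrightarrow> distinct \<sigma> \<and> set \<sigma> = {1..length \<sigma>}"

definition two_stack_sortable :: "nat list \<Rightarrow> bool" where
  "two_stack_sortable \<sigma> \<longleftrightarrow> \<sigma> \<noteq> [] \<and> is_perm \<sigma> \<and>
     stack_sort (stack_sort \<sigma>) = [1..<length \<sigma> + 1]"

definition ascents :: "nat list \<Rightarrow> nat" where
  "ascents \<sigma> = card {i. Suc i < length \<sigma> \<and> \<sigma> ! i < \<sigma> ! Suc i}"

definition descents :: "nat list \<Rightarrow> nat" where
  "descents \<sigma> = card {i. Suc i < length \<sigma> \<and> \<sigma> ! i > \<sigma> ! Suc i}"

definition ltr_maxima :: "nat list \<Rightarrow> nat" where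
  "ltr_maxima b = card {i. i < length b \<and> (\<forall>j<i. b ! j < b ! i)}"

definition precedes_pred_count :: "nat list \<Rightarrow> nat" where
  "precedes_pred_count b =
     card {a. \<exists>i j. i < j \<and> j < length b \<and> b ! i = a \<and> b ! j + 1 = a}"

text \<open>A (labelled) fish structure: (n, ur, lr).  The cells are 0..n-1, cell 0 is the head.
  ur x = Some y means that the lower-left edge of cell y is glued to the upper-right
  edge of cell x; lr x = Some y means that the upper-left edge of cell y is glued to
  the lower-right edge of cell x.  (All gluings produced by the construction are of
  these two kinds.)\<close>

type_synonym fish = "nat \<times> (nat \<Rightarrow> nat option) \<times> (nat \<Rightarrow> nat option)"

definition ncells :: "fish \<Rightarrow> nat" where "ncells F = fst F"
definition ur :: "fish \<Rightarrow> nat \<Rightarrow> nat option" where "ur F = fst (snd F)"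
definition lr :: "fish \<Rightarrow> nat \<Rightarrow> nat option" where "lr F = snd (snd F)"

inductive fighting_fish :: "fish \<Rightarrow> bool" where
  head: "fighting_fish (1, \<lambda>_. None, \<lambda>_. None)"
| add_a: "fighting_fish (n, u, l) \<Longrightarrow> x < n \<Longrightarrow> u x = None \<Longrightarrow>
          fighting_fish (Suc n, u(x := Some n), l)"
| add_b: "fighting_fish (n, u, l) \<Longrightarrow> x < n \<Longrightarrow> l x = None \<Longrightarrow>
          fighting_fish (Suc n, u, l(x := Some n))"
| add_c: "fighting_fish (n, u, l) \<Longrightarrow> a < n \<Longrightarrow> u a = Some b \<Longrightarrow> l a = Some c \<Longrightarrow>
          l b = None \<Longrightarrow> u c = None \<Longrightarrow>
          fighting_fish (Suc n, u(c := Some n), l(b := Some n))"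

definition fish_iso :: "fish \<Rightarrow> fish \<Rightarrow> bool" where
  "fish_iso F G \<longleftrightarrow> ncells F = ncells G \<and>
     (\<exists>f. bij_betw f {..<ncells F} {..<ncells G} \<and> f 0 = 0 \<and>
        (\<forall>x<ncells F. ur G (f x) = map_option f (ur F x) \<and>
                       lr G (f x) = map_option f (lr F x)))"

datatype side = LL | LR | UR | UL     (* lower-left, lower-right, upper-right, upper-left edge *)
datatype corner = CL | CB | CR | CT   (* left, bottom, right, top vertex of a cell *)

definition glued :: "fish \<Rightarrow> nat \<times> side \<Rightarrow> nat \<times> side \<Rightarrow> bool" where
  "glued F e e' \<longleftrightarrow>
     (\<exists>x y. x < ncells F \<and> ur F x = Some y \<and> e = (x, UR) \<and> e' = (y, LL)) \<or>
     (\<exists>x y. x < ncells F \<and> lr F x = Some y \<and> e = (x, LR) \<and> e' = (y, UL))"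

definition free_edge :: "fish \<Rightarrow> nat \<times> side \<Rightarrow> bool" where
  "free_edge F e \<longleftrightarrow> fst e < ncells F \<and> \<not> (\<exists>e'. glued F e e' \<or> glued F e' e)"

definition lower_free_edges :: "fish \<Rightarrow> (nat \<times> side) set" where
  "lower_free_edges F = {e. free_edge F e \<and> snd e \<in> {LL, LR}}"

definition left_lower_free_edges :: "fish \<Rightarrow> (nat \<times> side) set" where
  "left_lower_free_edges F = {e. free_edge F e \<and> snd e = LL}"

definition right_lower_free_edges :: "fish \<Rightarrow> (nat \<times> side) set" where
  "right_lower_free_edges F = {e. free_edge F e \<and> snd e = LR}"

text \<open>Vertices: corners of cells identified along glued edges.  Every cell is oriented
  counter-clockwise L -> B -> R -> T -> L, so gluing reverses orientation:
  the upper-right edge (R -> T) of x glued to the lower-left edge (L -> B) of y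
  identifies R of x with B of y and T of x with L of y; the lower-right edge (B -> R)
  of x glued to the upper-left edge (T -> L) of y identifies B of x with L of y and
  R of x with T of y.\<close>

definition corner_ident :: "fish \<Rightarrow> nat \<times> corner \<Rightarrow> nat \<times> corner \<Rightarrow> bool" where
  "corner_ident F p q \<longleftrightarrow>
     (\<exists>x y. x < ncells F \<and> ur F x = Some y \<and>
        ((p = (x, CR) \<and> q = (y, CB)) \<or> (p = (x, CT) \<and> q = (y, CL)))) \<or>
     (\<exists>x y. x < ncells F \<and> lr F x = Some y \<and>
        ((p = (x, CB) \<and> q = (y, CL)) \<or> (p = (x, CR) \<and> q = (y, CT))))"

definition same_vertex :: "fish \<Rightarrow> nat \<times> corner \<Rightarrow> nat \<times> corner \<Rightarrow> bool" where
  "same_vertex F = (\<lambda>p q. corner_ident F p q \<or> corner_ident F q p)\<^sup>*\<^sup>*"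

definition vertex_of :: "fish \<Rightarrow> nat \<times> corner \<Rightarrow> (nat \<times> corner) set" where
  "vertex_of F p = {q. same_vertex F p q}"

fun edge_start :: "nat \<times> side \<Rightarrow> nat \<times> corner" where
  "edge_start (x, LL) = (x, CL)"
| "edge_start (x, LR) = (x, CB)"
| "edge_start (x, UR) = (x, CR)"
| "edge_start (x, UL) = (x, CT)"

fun edge_end :: "nat \<times> side \<Rightarrow> nat \<times> corner" where
  "edge_end (x, LL) = (x, CB)"
| "edge_end (x, LR) = (x, CR)"
| "edge_end (x, UR) = (x, CT)"
| "edge_end (x, UL) = (x, CL)"

definition tails :: "fish \<Rightarrow> (nat \<times> corner) set set" where
  "tails F = {vertex_of F (x, CR) | x. x < ncells F \<and>
                 free_edge F (x, UR) \<and> free_edge F (x, LR)}"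

definition nose :: "fish \<Rightarrow> (nat \<times> corner) set" where
  "nose F = vertex_of F (0, CL)"

text \<open>A boundary path from the nose to a tail, following free edges in counter-clockwise
  direction (each free edge is traversed in the orientation of its cell).  The fin is the
  shortest such path, i.e. the one stopping at the first tail met.\<close>
definition nose_to_tail_path :: "fish \<Rightarrow> (nat \<times> side) list \<Rightarrow> bool" where
  "nose_to_tail_path F es \<longleftrightarrow> es \<noteq> [] \<and>
     (\<forall>e\<in>set es. free_edge F e) \<and>
     vertex_of F (edge_start (hd es)) = nose F \<and>
     (\<forall>i. Suc i < length es \<longrightarrow>
        vertex_of F (edge_end (es ! i)) = vertex_of F (edge_start (es ! Suc i))) \<and>
     vertex_of F (edge_end (last es)) \<in> tails F"

definition fin_length :: "fish \<Rightarrow> nat" where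
  "fin_length F = (LEAST m. \<exists>es. nose_to_tail_path F es \<and> length es = m)"

end

(* Read counter-clockwise from the nose, the free edges of a fighting fish spell a word over the four
   sides. These words form the language generated from LL LR UR UL by the rewritings UR -> LR UR UL,
   LR -> LL LR UR and UR LR -> LR UR, one for each way of adding a cell, and a fish is determined up
   to isomorphism by its word: tails are the factors LR UR, and one may remove the same tail cell
   from two fish with the same word. All statistics are read off the word.

   Every word factors uniquely as p y q UL where p q and y UL are words (or degenerate
   ones) and p is a nonempty part of the fin of p q: this is the wasp-waist decomposition.
   On the other side, a permutation A n B is two-stack sortable iff stack_sort A and stack_sort B
   avoid 231, at most the maximum of A exceeds some element of B, and it splits stack_sort B into smaller
   elements followed by larger ones; by avoidance of 231 the split is determined by the number of
   left-to-right maxima in its first part. Both recursions are coded by the same labelled binary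
   trees, compatibly with the statistics. *)

theory Submission
  imports Defs
begin

section \<open>Boundary words of fighting fish\<close>

text \<open>The two recursions have the same number of choices: a fin of length k + 1 has k + 1
  nonempty initial parts, and k left-to-right maxima of \<open>stack_sort B\<close> leave k + 1
  places for the maximum of A. When the second fish or A is missing, one choice remains on both
  sides. The fin length and the number of maxima also grow by the same rule. The delicate point is
  uniqueness of the factorization. A fish may overlap itself in the plane, so y cannot be located by
  positions. Instead, the word is read as a lattice path: y is a first excursion to the right of a
  vertical line, ending one unit above its start, and the boundary of a fish does not come back in
  this way to a later vertex of its fin. For fish, tails and the fin are defined through classes of
  corners, so explicit representatives of the vertices are carried along the construction. Cell
  labels are arbitrary there, because the tail cell to be removed need not be the cell added
  last.\<close>

inductive fish_word :: "side list \<Rightarrow> bool" where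
  cell: "fish_word [LL, LR, UR, UL]"
| up: "fish_word (us @ [UR] @ vs) \<Longrightarrow> fish_word (us @ [LR, UR, UL] @ vs)"
| down: "fish_word (us @ [LR] @ vs) \<Longrightarrow> fish_word (us @ [LL, LR, UR] @ vs)"
| both: "fish_word (us @ [UR, LR] @ vs) \<Longrightarrow> fish_word (us @ [LR, UR] @ vs)"

section \<open>Factors forbidden in boundary words\<close>

fun is_lower :: "side \<Rightarrow> bool" where
  "is_lower LL = True" | "is_lower LR = True" | "is_lower UR = False" | "is_lower UL = False"

text \<open>The forbidden factors are \<open>LL UR\<close>, \<open>LL UL\<close> and
  \<open>LR UL\<close>: the boundary passes from a lower to an upper edge only at a tail, as
  \<open>LR UR\<close>. This locates the end of the fin and excludes the degenerate words.\<close>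

fun may_follow :: "side \<Rightarrow> side \<Rightarrow> bool" where
  "may_follow LL UR = False" | "may_follow LL UL = False" | "may_follow LR UL = False" | "may_follow _ _ = True"

lemma may_follow_simps[simp]: "may_follow UR s" "may_follow UL s" "may_follow s LL" "may_follow s LR"
  by (cases s; simp)+

lemma word_hd_last: "fish_word w \<Longrightarrow> w \<noteq> [] \<and> hd w = LL \<and> last w = UL"
proof (induction rule: fish_word.induct)
  case (up us vs) then show ?case by (cases us; cases vs rule: rev_cases) auto
next
  case (down us vs) then show ?case by (cases us; cases vs rule: rev_cases) auto
next
  case (both us vs) then show ?case by (cases us; cases vs rule: rev_cases) auto
qed auto

text \<open>Every rewriting inserts a factor that starts with a lower edge and ends with an upper
  one, and nothing is forbidden before the former or after the latter.\<close>

lemma word_succ: "fish_word w \<Longrightarrow> successively may_follow w"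
proof (induction rule: fish_word.induct)
  case (up us vs)
  then show ?case by (auto simp: successively_append_iff successively_Cons split: if_splits)
next
  case (down us vs)
  then show ?case using word_hd_last[OF down.hyps]
    by (cases vs) (auto simp: successively_append_iff successively_Cons)
next
  case (both us vs)
  then show ?case using word_hd_last[OF both.hyps]
    by (cases vs) (auto simp: successively_append_iff successively_Cons)
qed auto

lemma word_no: "fish_word w \<Longrightarrow> w = us @ [a, b] @ vs \<Longrightarrow> may_follow a b"
  using word_succ[of w] by (auto simp: successively_append_iff)

section \<open>Gluing operations on boundary words\<close>

lemma split1: "xs @ [c] @ ys = as @ bs \<Longrightarrow>
   (\<exists>d. as = xs @ [c] @ d \<and> ys = d @ bs) \<or> (\<exists>d. xs = as @ d \<and> bs = d @ [c] @ ys)"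
  by (auto simp: append_eq_append_conv2 Cons_eq_append_conv)

text \<open>The construction of the fish \<open>y @ [UL]\<close> is replayed at an edge
  \<open>LR\<close> of another fish. Its first cell is added by \<open>down\<close>; its final
  \<open>UL\<close>, the edge along which it is glued, is never rewritten.\<close>

lemma word_subst_LR:
  assumes "fish_word w" "w = y @ [UL]" "fish_word (us @ [LR] @ vs)"
  shows "fish_word (us @ y @ vs)"
  using assms
proof (induction arbitrary: y rule: fish_word.induct)
  case cell
  then have "y = [LL, LR, UR]" by (simp add: append_eq_Cons_conv)
  then show ?case using down cell by simp
next
  case (up a b)
  obtain b' where b: "b = b' @ [UL]" using word_hd_last[OF up.hyps] by (cases b rule: rev_cases) auto
  have "fish_word (us @ (a @ [UR] @ b') @ vs)" using up b by (metis append.assoc)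
  then have "fish_word ((us @ a) @ [LR, UR, UL] @ (b' @ vs))" using fish_word.up[of "us @ a" "b' @ vs"] by simp
  then show ?case using up.prems b by auto
next
  case (down a b)
  obtain b' where b: "b = b' @ [UL]" using word_hd_last[OF down.hyps] by (cases b rule: rev_cases) auto
  have "fish_word (us @ (a @ [LR] @ b') @ vs)" using down b by (metis append.assoc)
  then have "fish_word ((us @ a) @ [LL, LR, UR] @ (b' @ vs))" using fish_word.down[of "us @ a" "b' @ vs"] by simp
  then show ?case using down.prems b by auto
next
  case (both a b)
  obtain b' where b: "b = b' @ [UL]" using word_hd_last[OF both.hyps] by (cases b rule: rev_cases) auto
  have "fish_word (us @ (a @ [UR, LR] @ b') @ vs)" using both b by (metis append.assoc)
  then have "fish_word ((us @ a) @ [LR, UR] @ (b' @ vs))" using fish_word.both[of "us @ a" "b' @ vs"] by simp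
  then show ?case using both.prems b by auto
qed

text \<open>A new head is glued to the lower left edge of the old one. The construction is replayed
  from two cells instead of one, which is possible because the leading \<open>LL\<close> is never
  rewritten.\<close>

lemma word_prefix_cell:
  assumes "fish_word w" "w = LL # x"
  shows "fish_word (LL # LR # x @ [UL])"
  using assms
proof (induction arbitrary: x rule: fish_word.induct)
  case cell
  have "fish_word [LL, LR, LR, UR, UL, UL]" using up[of "[LL, LR]" "[UL]"] fish_word.cell by simp
  then show ?case using cell by auto
next
  case (up a b)
  obtain a' where a: "a = LL # a'" using word_hd_last[OF up.hyps] by (cases a) auto
  have "fish_word (LL # LR # (a' @ [UR] @ b) @ [UL])" using up a by simp
  then show ?case using fish_word.up[of "LL # LR # a'" "b @ [UL]"] up.prems a by auto
next
  case (down a b)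
  obtain a' where a: "a = LL # a'" using word_hd_last[OF down.hyps] by (cases a) auto
  have "fish_word (LL # LR # (a' @ [LR] @ b) @ [UL])" using down a by simp
  then show ?case using fish_word.down[of "LL # LR # a'" "b @ [UL]"] down.prems a by auto
next
  case (both a b)
  obtain a' where a: "a = LL # a'" using word_hd_last[OF both.hyps] by (cases a) auto
  have "fish_word (LL # LR # (a' @ [UR, LR] @ b) @ [UL])" using both a by simp
  then show ?case using fish_word.both[of "LL # LR # a'" "b @ [UL]"] both.prems a by auto
qed

text \<open>The factor \<open>LR LL\<close> is a notch in the lower boundary, and the swap fills it
  with a cell glued along both of its upper edges. This is not one of the three ways of adding a
  cell, so the order of construction has to be changed.\<close>

lemma word_swap:
  assumes "fish_word w" "w = us @ [LR, LL] @ vs"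
  shows "fish_word (us @ [LL, LR] @ vs)"
  using assms
proof (induction arbitrary: us vs rule: fish_word.induct)
  case cell
  then show ?case by (auto simp: Cons_eq_append_conv)
next
  case (up a b)
  from up.prems consider d where "us = a @ [LR, UR, UL] @ d" "b = d @ [LR, LL] @ vs"
    | d where "a = us @ [LR, LL] @ d" "vs = d @ [LR, UR, UL] @ b"
    by (auto simp: append_eq_append_conv2 Cons_eq_append_conv append_eq_Cons_conv)
  then show ?case
  proof cases
    case 1 then show ?thesis using up.IH[of "a @ [UR] @ d" vs] fish_word.up[of a "d @ [LL, LR] @ vs"] by simp
  next
    case 2 then show ?thesis using up.IH[of us "d @ [UR] @ b"] fish_word.up[of "us @ [LL, LR] @ d" b] by simp
  qed
next
  case (down a b)
  from down.prems consider d where "us = a @ [LL, LR, UR] @ d" "b = d @ [LR, LL] @ vs"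
    | d where "a = us @ [LR, LL] @ d" "vs = d @ [LL, LR, UR] @ b"
    | "a = us @ [LR]" "vs = [LR, UR] @ b"
    by (auto simp: append_eq_append_conv2 Cons_eq_append_conv append_eq_Cons_conv)
  then show ?case
  proof cases
    case 1 then show ?thesis using down.IH[of "a @ [LR] @ d" vs] fish_word.down[of a "d @ [LL, LR] @ vs"] by simp
  next
    case 2 then show ?thesis using down.IH[of us "d @ [LR] @ b"] fish_word.down[of "us @ [LL, LR] @ d" b] by simp
  next
    case 3
    \<comment> \<open>The notch was created by \<open>down\<close> acting on the second of two edges
      \<open>LR LR\<close>. Acting on the first one instead, and then applying \<open>both\<close>,
      yields the filled word.\<close>
    have "fish_word (us @ [LR] @ [LR] @ b)" using down.hyps 3 by simp
    then have "fish_word ((us @ [LL, LR]) @ [UR, LR] @ b)" using fish_word.down[of us "[LR] @ b"] by simp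
    then show ?thesis using fish_word.both[of "us @ [LL, LR]" b] 3 by simp
  qed
next
  case (both a b)
  from both.prems consider d where "us = a @ [LR, UR] @ d" "b = d @ [LR, LL] @ vs"
    | d where "a = us @ [LR, LL] @ d" "vs = d @ [LR, UR] @ b"
    by (auto simp: append_eq_append_conv2 Cons_eq_append_conv append_eq_Cons_conv)
  then show ?case
  proof cases
    case 1 then show ?thesis using both.IH[of "a @ [UR, LR] @ d" vs] fish_word.both[of a "d @ [LL, LR] @ vs"] by simp
  next
    case 2 then show ?thesis using both.IH[of us "d @ [UR, LR] @ b"] fish_word.both[of "us @ [LL, LR] @ d" b] by simp
  qed
qed

text \<open>Sliding \<open>LR\<close> past \<open>LL\<close> fills a notch and sliding it past
  \<open>LR\<close> changes nothing; altogether a row of cells is glued under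
  \<open>p\<close>.\<close>

lemma word_move:
  assumes "fish_word (us @ [LR] @ p @ vs)" "\<forall>s\<in>set p. is_lower s"
  shows "fish_word (us @ p @ [LR] @ vs)"
  using assms
proof (induction p arbitrary: us)
  case (Cons s p)
  have "s = LL \<or> s = LR" using Cons.prems(2) by (cases s) auto
  then have "fish_word (us @ [s, LR] @ p @ vs)"
    using Cons.prems(1) word_swap[of _ us "p @ vs"] by auto
  then show ?case using Cons.IH[of "us @ [s]"] Cons.prems(2) by simp
qed simp

text \<open>The strip starts with a new head below the old one, whose free edge \<open>LR\<close> is
  then slid along the rest of \<open>p\<close>.\<close>

lemma word_strip:
  assumes "fish_word (p @ q)" "\<forall>s\<in>set p. is_lower s" "p \<noteq> []"
  shows "fish_word (p @ [LR] @ q @ [UL])"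
proof -
  obtain p' where p: "p = LL # p'" using word_hd_last[OF assms(1)] assms(3) by (cases p) auto
  have "fish_word (LL # LR # (p' @ q) @ [UL])" using word_prefix_cell[OF assms(1), of "p' @ q"] p by simp
  then show ?thesis using word_move[of "[LL]" p' "q @ [UL]"] p assms(2) by simp
qed

text \<open>The word \<open>p @ y @ q @ [UL]\<close> is obtained from the fish \<open>p @ q\<close> by gluing a strip of cells under
  the part \<open>p\<close> of its fin, and then the fish \<open>y @ [UL]\<close> by its upper left nose edge to the lower
  right edge ending the strip. The degenerate words \<open>[LL, UR]\<close> and \<open>[LR, UL]\<close> stand for a missing
  first or second fish.\<close>

definition splitting :: "side list \<Rightarrow> side list \<Rightarrow> side list \<Rightarrow> bool" where
  "splitting p y q \<longleftrightarrow> p \<noteq> [] \<and> (\<forall>s\<in>set p. is_lower s) \<and> (fish_word (p @ q) \<or> p = [LL] \<and> q = [UR]) \<and>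
     (y = [LR] \<and> (\<exists>q'. q = UR # q') \<or> fish_word (y @ [UL]))"

section \<open>Existence of the wasp-waist decomposition\<close>

lemma splitting_fw: "splitting p y q \<Longrightarrow> fish_word (p @ y @ q @ [UL])"
proof -
  assume d: "splitting p y q"
  have "fish_word (p @ [LR] @ q @ [UL])"
    using d word_strip fish_word.cell unfolding splitting_def by auto
  then show ?thesis using d word_subst_LR unfolding splitting_def by blast
qed

text \<open>The upper right edge of the head is free here, so everything else hangs from its lower
  right edge. Removing the head leaves the fish \<open>z @ [UL]\<close>, or nothing for a single
  cell.\<close>

lemma word_last_UR:
  assumes "fish_word w" "w = y @ [UR, UL]"
  shows "\<exists>z. y = LL # z \<and> (z = [LR] \<or> fish_word (z @ [UL]))"
  using assms
proof (induction arbitrary: y rule: fish_word.induct)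
  case cell
  then show ?case by (auto simp: append_eq_Cons_conv)
next
  case (up a b)
  obtain b' where b: "b = b' @ [UL]" using word_hd_last[OF up.hyps] by (cases b rule: rev_cases) auto
  then obtain b'' where b': "b' = b'' @ [UR]" using up.prems by (cases b' rule: rev_cases) auto
  then obtain z where z: "a @ [UR] @ b'' = LL # z" "z = [LR] \<or> fish_word (z @ [UL])"
    using up.IH[of "a @ [UR] @ b''"] b by auto
  then obtain a' where a: "a = LL # a'" by (cases a) auto
  then have "fish_word (a' @ [UR] @ (b'' @ [UL]))" using z by (auto simp: append_eq_Cons_conv)
  then have "fish_word ((a' @ [LR, UR, UL] @ b'') @ [UL])" using fish_word.up[of a' "b'' @ [UL]"] by simp
  then show ?case using up.prems b b' a by auto
next
  case (down a b)
  obtain b' where b: "b = b' @ [UL]" using word_hd_last[OF down.hyps] by (cases b rule: rev_cases) auto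
  have "b' \<noteq> []" using word_no[OF down.hyps, of a LR UL "[]"] b by auto
  then obtain b'' where b': "b' = b'' @ [UR]" using down.prems b by (cases b' rule: rev_cases) auto
  then obtain z where z: "a @ [LR] @ b'' = LL # z" "z = [LR] \<or> fish_word (z @ [UL])"
    using down.IH[of "a @ [LR] @ b''"] b by auto
  then obtain a' where a: "a = LL # a'" by (cases a) auto
  have "fish_word ((a' @ [LL, LR, UR] @ b'') @ [UL])"
  proof (cases "z = [LR]")
    case True
    then have "a' = []" "b'' = []" using z a by (auto simp: append_eq_Cons_conv)
    then show ?thesis using fish_word.cell by simp
  next
    case False
    then show ?thesis using fish_word.down[of a' "b'' @ [UL]"] z a by auto
  qed
  then show ?case using down.prems b b' a by auto
next
  case (both a b)
  obtain b' where b: "b = b' @ [UL]" using word_hd_last[OF both.hyps] by (cases b rule: rev_cases) auto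
  have "b' \<noteq> []" using word_no[OF both.hyps, of "a @ [UR]" LR UL "[]"] b by auto
  then obtain b'' where b': "b' = b'' @ [UR]" using both.prems b by (cases b' rule: rev_cases) auto
  then obtain z where z: "a @ [UR, LR] @ b'' = LL # z" "z = [LR] \<or> fish_word (z @ [UL])"
    using both.IH[of "a @ [UR, LR] @ b''"] b by auto
  then obtain a' where a: "a = LL # a'" by (cases a) auto
  then have "fish_word (a' @ [UR, LR] @ (b'' @ [UL]))" using z by (auto simp: append_eq_Cons_conv)
  then have "fish_word ((a' @ [LR, UR] @ b'') @ [UL])" using fish_word.both[of a' "b'' @ [UL]"] by simp
  then show ?case using both.prems b b' a by auto
qed

text \<open>A rewriting usually takes place inside \<open>p @ q\<close> or inside
  \<open>y @ [UL]\<close>; only the seams need care. A missing second fish requires \<open>q\<close>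
  to begin with \<open>UR\<close>, and when a rewriting destroys this, the seam is moved further
  along the fin.\<close>

lemma word_dec: "fish_word w \<Longrightarrow> \<exists>p y q. w = p @ y @ q @ [UL] \<and> splitting p y q"
proof (induction rule: fish_word.induct)
  case cell
  have "[LL, LR, UR, UL] = [LL] @ [LR] @ [UR] @ [UL] \<and> splitting [LL] [LR] [UR]" by (simp add: splitting_def)
  then show ?case by metis
next
  case (up a b)
  then obtain p y q where e: "a @ [UR] @ b = p @ y @ q @ [UL]" and d: "splitting p y q" by blast
  have np: "UR \<notin> set p" using d unfolding splitting_def by auto
  have "(\<exists>z. a = p @ z \<and> y @ q @ [UL] = z @ [UR] @ b)" using split1[OF e] np by auto
  then obtain z where z: "a = p @ z" "z @ [UR] @ b = y @ (q @ [UL])" by auto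
  from split1[OF z(2)] show ?case
  proof (elim disjE exE conjE)
    fix d' assume y: "y = z @ [UR] @ d'" and b: "b = d' @ q @ [UL]"
    have "fish_word ((z @ [LR, UR, UL] @ d') @ [UL])"
      using d y fish_word.up[of z "d' @ [UL]"] unfolding splitting_def by (auto simp: append_eq_Cons_conv Cons_eq_append_conv)
    then have "splitting p (z @ [LR, UR, UL] @ d') q" using d unfolding splitting_def by auto
    moreover have "a @ [LR, UR, UL] @ b = p @ (z @ [LR, UR, UL] @ d') @ q @ [UL]" using z(1) b by simp
    ultimately show ?thesis by blast
  next
    fix d' assume zz: "z = y @ d'" and "q @ [UL] = d' @ [UR] @ b"
    then obtain b' where q: "q = d' @ [UR] @ b'" "b = b' @ [UL]"
      by (cases b rule: rev_cases) auto
    have "fish_word (p @ d' @ [LR, UR, UL] @ b') \<or> p = [LL] \<and> d' = [] \<and> b' = []"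
      using d q fish_word.up[of "p @ d'" b'] unfolding splitting_def by (auto simp: append_eq_Cons_conv Cons_eq_append_conv)
    then have f: "fish_word (p @ d' @ [LR, UR, UL] @ b')" using fish_word.cell by auto
    show ?thesis
    proof (cases "y = [LR] \<and> d' = []")
      case True
      \<comment> \<open>The rewritten \<open>UR\<close> was the first edge of \<open>q\<close>,
        which would now begin with \<open>LR\<close>; this new edge is handed over to
        \<open>p\<close>.\<close>
      then have "splitting (p @ [LR]) [LR] (UR # UL # b')" using f d unfolding splitting_def by auto
      moreover have "a @ [LR, UR, UL] @ b = (p @ [LR]) @ [LR] @ (UR # UL # b') @ [UL]"
        using True z zz q by simp
      ultimately show ?thesis by blast
    next
      case False
      then have "splitting p y (d' @ [LR, UR, UL] @ b')" using f d q unfolding splitting_def by (auto simp: append_eq_Cons_conv Cons_eq_append_conv)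
      moreover have "a @ [LR, UR, UL] @ b = p @ y @ (d' @ [LR, UR, UL] @ b') @ [UL]"
        using z zz q by simp
      ultimately show ?thesis by blast
    qed
  qed
next
  case (down a b)
  then obtain p y q where e: "a @ [LR] @ b = p @ y @ q @ [UL]" and d: "splitting p y q" by blast
  from split1[OF e] show ?case
  proof (elim disjE exE conjE)
    fix p2 assume p: "p = a @ [LR] @ p2" and b: "b = p2 @ y @ q @ [UL]"
    \<comment> \<open>The new cell cuts the fin: it becomes the whole second fish, while the rest of
      \<open>p\<close>, the old \<open>y\<close> and \<open>q\<close> pass to the first one. To see
      that the latter is a fish, the rewritten \<open>LR\<close> is slid to the end of
      \<open>p2\<close> and \<open>y\<close> is grafted there.\<close>
    have f: "fish_word (a @ [LR] @ p2 @ q)" using d p unfolding splitting_def by (auto simp: append_eq_Cons_conv Cons_eq_append_conv)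
    then have a0: "a \<noteq> []" using word_hd_last by fastforce
    have "fish_word ((a @ p2) @ [LR] @ q)" using word_move[OF f] d p unfolding splitting_def by auto
    then have "fish_word ((a @ p2) @ y @ q)" using word_subst_LR d unfolding splitting_def by blast
    then have "splitting a [LL, LR, UR] (p2 @ y @ q)" using a0 d p fish_word.cell unfolding splitting_def by auto
    moreover have "a @ [LL, LR, UR] @ b = a @ [LL, LR, UR] @ (p2 @ y @ q) @ [UL]" using b by simp
    ultimately show ?thesis by blast
  next
    fix z assume a: "a = p @ z" and "y @ q @ [UL] = z @ [LR] @ b"
    then have "z @ [LR] @ b = y @ (q @ [UL])" by simp
    from split1[OF this] show ?thesis
    proof (elim disjE exE conjE)
      fix d' assume y: "y = z @ [LR] @ d'" and b: "b = d' @ q @ [UL]"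
      have "fish_word ((z @ [LL, LR, UR] @ d') @ [UL])"
        using d y fish_word.down[of z "d' @ [UL]"] fish_word.cell unfolding splitting_def by (auto simp: append_eq_Cons_conv Cons_eq_append_conv)
      then have "splitting p (z @ [LL, LR, UR] @ d') q" using d unfolding splitting_def by auto
      moreover have "a @ [LL, LR, UR] @ b = p @ (z @ [LL, LR, UR] @ d') @ q @ [UL]" using a b by simp
      ultimately show ?thesis by blast
    next
      fix d' assume z: "z = y @ d'" and "q @ [UL] = d' @ [LR] @ b"
      then obtain b' where q: "q = d' @ [LR] @ b'" "b = b' @ [UL]"
        by (cases b rule: rev_cases) auto
      have "fish_word (p @ d' @ [LL, LR, UR] @ b')"
        using d q fish_word.down[of "p @ d'" b'] unfolding splitting_def by (auto simp: append_eq_Cons_conv Cons_eq_append_conv)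
      then have "splitting p y (d' @ [LL, LR, UR] @ b')" using d q unfolding splitting_def by (auto simp: append_eq_Cons_conv Cons_eq_append_conv)
      moreover have "a @ [LL, LR, UR] @ b = p @ y @ (d' @ [LL, LR, UR] @ b') @ [UL]"
        using a z q by simp
      ultimately show ?thesis by blast
    qed
  qed
next
  case (both a b)
  then obtain p y q where "a @ [UR, LR] @ b = p @ y @ q @ [UL]" and d: "splitting p y q" by blast
  then have e: "a @ [UR] @ (LR # b) = p @ (y @ q @ [UL])" by simp
  have np: "UR \<notin> set p" using d unfolding splitting_def by auto
  obtain z where z: "a = p @ z" "z @ [UR] @ (LR # b) = y @ (q @ [UL])" using split1[OF e] np by auto
  from split1[OF z(2)] show ?case
  proof (elim disjE exE conjE)
    fix d' assume y: "y = z @ [UR] @ d'" and b: "LR # b = d' @ q @ [UL]"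
    have fy: "fish_word (z @ [UR] @ d' @ [UL])" using d y unfolding splitting_def by (auto simp: append_eq_Cons_conv Cons_eq_append_conv)
    show ?thesis
    proof (cases d')
      case Nil
      \<comment> \<open>The pair straddles the seam, with \<open>UR\<close> ending \<open>y\<close>
        and \<open>LR\<close> beginning \<open>q\<close>. The head of the second fish joins the
        strip: its \<open>LL\<close> goes to \<open>p\<close>, and only what hung below it,
        \<open>z'\<close>, can remain a second fish.\<close>
      then obtain z' where z': "z = LL # z'" "z' = [LR] \<or> fish_word (z' @ [UL])"
        using word_last_UR[of "z @ [UR] @ d' @ [UL]" z] fy by auto
      obtain q' where q: "q = LR # q'" using b Nil by (cases q) auto
      have "fish_word (p @ [LR] @ q')" using d q unfolding splitting_def by auto
      then have f: "fish_word (p @ [LL, LR, UR] @ q')" by (rule fish_word.down)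
      show ?thesis
      proof (cases "z' = [LR]")
        case True
        have "splitting (p @ [LL, LR]) [LR] (UR # q')" using f d unfolding splitting_def by auto
        moreover have "a @ [LR, UR] @ b = (p @ [LL, LR]) @ [LR] @ (UR # q') @ [UL]"
          using z z' True q b Nil by simp
        ultimately show ?thesis by blast
      next
        case False
        have "splitting (p @ [LL]) z' (LR # UR # q')" using False z' f d unfolding splitting_def by auto
        moreover have "a @ [LR, UR] @ b = (p @ [LL]) @ z' @ (LR # UR # q') @ [UL]"
          using z z' q b Nil by simp
        ultimately show ?thesis by blast
      qed
    next
      case (Cons s d2)
      then have d2: "d' = LR # d2" "b = d2 @ q @ [UL]" using b by auto
      have "fish_word ((z @ [LR, UR] @ d2) @ [UL])" using fy d2 fish_word.both[of z "d2 @ [UL]"] by simp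
      then have "splitting p (z @ [LR, UR] @ d2) q" using d unfolding splitting_def by auto
      moreover have "a @ [LR, UR] @ b = p @ (z @ [LR, UR] @ d2) @ q @ [UL]" using z(1) d2 by simp
      ultimately show ?thesis by blast
    qed
  next
    fix d' assume zz: "z = y @ d'" and "q @ [UL] = d' @ [UR] @ (LR # b)"
    then obtain b' where q: "q = d' @ [UR, LR] @ b'" "b = b' @ [UL]"
      by (cases b rule: rev_cases) auto
    have f: "fish_word (p @ d' @ [LR, UR] @ b')"
      using d q fish_word.both[of "p @ d'" b'] unfolding splitting_def by (auto simp: append_eq_Cons_conv Cons_eq_append_conv)
    show ?thesis
    proof (cases "y = [LR] \<and> d' = []")
      case True
      then have "splitting (p @ [LR]) [LR] (UR # b')" using f d unfolding splitting_def by auto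
      moreover have "a @ [LR, UR] @ b = (p @ [LR]) @ [LR] @ (UR # b') @ [UL]"
        using True z zz q by simp
      ultimately show ?thesis by blast
    next
      case False
      then have "splitting p y (d' @ [LR, UR] @ b')" using f d q unfolding splitting_def by (auto simp: append_eq_Cons_conv Cons_eq_append_conv)
      moreover have "a @ [LR, UR] @ b = p @ y @ (d' @ [LR, UR] @ b') @ [UL]"
        using z zz q by simp
      ultimately show ?thesis by blast
    qed
  qed
qed

fun adj :: "('a \<Rightarrow> 'a \<Rightarrow> bool) \<Rightarrow> 'a list \<Rightarrow> nat" where
  "adj P (x # y # xs) = (if P x y then 1 else 0) + adj P (y # xs)"
| "adj P _ = 0"

lemma adj_append: "adj P (xs @ ys) = adj P xs + adj P ys +
    (if xs \<noteq> [] \<and> ys \<noteq> [] \<and> P (last xs) (hd ys) then 1 else 0)"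
proof (induction xs)
  case (Cons x xs)
  then show ?case by (cases xs; cases ys) auto
qed simp

section \<open>Lattice paths and uniqueness of the decomposition\<close>

text \<open>Words are read as lattice paths: \<open>LL\<close>, \<open>LR\<close>, \<open>UR\<close>, \<open>UL\<close> are the unit steps
  east, north, west, south.\<close>

fun dx :: "side \<Rightarrow> int" where "dx LL = 1" | "dx UR = -1" | "dx _ = 0"
fun dy :: "side \<Rightarrow> int" where "dy LR = 1" | "dy UL = -1" | "dy _ = 0"

definition xd :: "side list \<Rightarrow> int" where "xd w = sum_list (map dx w)"
definition yd :: "side list \<Rightarrow> int" where "yd w = sum_list (map dy w)"

lemma xd_simps[simp]: "xd [] = 0" "xd (s # w) = dx s + xd w" "xd (v @ w) = xd v + xd w" "xd (replicate a UL) = 0"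
  by (auto simp: xd_def sum_list_replicate)
lemma yd_simps[simp]: "yd [] = 0" "yd (s # w) = dy s + yd w" "yd (v @ w) = yd v + yd w" "yd (replicate a UL) = - int a"
  by (auto simp: yd_def sum_list_replicate)

text \<open>The starting point itself is not tested, so that \<open>h = 0\<close> describes a path
  leaving its initial vertical line to the right and not returning to it.\<close>

fun stays_right :: "int \<Rightarrow> side list \<Rightarrow> bool" where
  "stays_right h [] = True"
| "stays_right h (s # w) = (h + dx s > 0 \<and> stays_right (h + dx s) w)"

lemma stays_right_append[simp]: "stays_right h (v @ w) = (stays_right h v \<and> stays_right (h + xd v) w)"
  by (induction v arbitrary: h) (auto simp: algebra_simps)

lemma stays_right_mono: "stays_right h w \<Longrightarrow> h \<le> h' \<Longrightarrow> stays_right h' w"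
  by (induction w arbitrary: h h') force+

lemma stays_right_xd: "stays_right h w \<Longrightarrow> w \<noteq> [] \<Longrightarrow> h + xd w > 0"
proof (induction w arbitrary: h)
  case (Cons s w)
  then show ?case by (cases "w = []") (force simp: algebra_simps)+
qed simp

lemma stays_right_UL[simp]: "stays_right h (replicate a UL) = (a = 0 \<or> h > 0)"
  by (induction a) auto

lemma stays_right_low: "\<forall>s\<in>set p. is_lower s \<Longrightarrow> h > 0 \<Longrightarrow> stays_right h p \<and> xd p \<ge> 0"
proof (induction p arbitrary: h)
  case (Cons s p)
  show ?case
  proof (cases s)
    case LL then show ?thesis using Cons.prems Cons.IH[of "h+1"] by auto
  next
    case LR then show ?thesis using Cons.prems Cons.IH[of h] by auto
  qed (use Cons.prems in auto)
qed simp

lemma rep_split: "replicate a UL @ q = d @ s # r \<Longrightarrow> s \<noteq> UL \<Longrightarrow>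
   \<exists>d2. d = replicate a UL @ d2 \<and> q = d2 @ s # r"
proof (induction a arbitrary: d)
  case (Suc a) then show ?case by (cases d) auto
qed simp

text \<open>All rewritings keep the displacement of the factor that they replace. Hence the path
  comes back to the vertical line of the nose only with its last \<open>UR\<close>, and then
  descends to the nose; the descent gets longer only when that \<open>UR\<close> is
  rewritten.\<close>

lemma word_shape: "fish_word w \<Longrightarrow> \<exists>t a. w = t @ [UR] @ replicate a UL \<and> stays_right 0 t \<and> xd t = 1 \<and> yd t = int a"
proof (induction rule: fish_word.induct)
  case cell
  show ?case by (intro exI[of _ "[LL, LR]"] exI[of _ 1]) simp
next
  case (up us vs)
  then obtain t a where e: "us @ [UR] @ vs = t @ ([UR] @ replicate a UL)"
    and t: "stays_right 0 t" "xd t = 1" "yd t = int a" by auto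
  from split1[OF e] show ?case
  proof (elim disjE exE conjE)
    fix d assume "t = us @ [UR] @ d" "vs = d @ [UR] @ replicate a UL"
    then show ?thesis using t by (intro exI[of _ "us @ [LR, UR, UL] @ d"] exI[of _ a]) auto
  next
    fix d assume d: "us = t @ d" "[UR] @ replicate a UL = d @ [UR] @ vs"
    have "d = []"
    proof (cases d)
      case (Cons s d')
      then have "replicate a UL = d' @ [UR] @ vs" using d(2) by simp
      then have "UR \<in> set (replicate a UL)" by simp
      then show ?thesis by simp
    qed simp
    then show ?thesis using t d by (intro exI[of _ "t @ [LR]"] exI[of _ "Suc a"]) auto
  qed
next
  case (down us vs)
  then obtain t a where e: "us @ [LR] @ vs = t @ ([UR] @ replicate a UL)"
    and t: "stays_right 0 t" "xd t = 1" "yd t = int a" by auto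
  from split1[OF e] show ?case
  proof (elim disjE exE conjE)
    fix d assume "t = us @ [LR] @ d" "vs = d @ [UR] @ replicate a UL"
    then show ?thesis using t by (intro exI[of _ "us @ [LL, LR, UR] @ d"] exI[of _ a]) auto
  next
    fix d assume "[UR] @ replicate a UL = d @ [LR] @ vs"
    then have "LR \<in> set ([UR] @ replicate a UL)" by simp
    then show ?thesis by simp
  qed
next
  case (both us vs)
  then obtain t a where "us @ [UR, LR] @ vs = t @ ([UR] @ replicate a UL)"
    and t: "stays_right 0 t" "xd t = 1" "yd t = int a" by auto
  then have e: "(us @ [UR]) @ [LR] @ vs = t @ ([UR] @ replicate a UL)" by simp
  from split1[OF e] show ?case
  proof (elim disjE exE conjE)
    fix d assume "t = (us @ [UR]) @ [LR] @ d" "vs = d @ [UR] @ replicate a UL"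
    then show ?thesis using t by (intro exI[of _ "us @ [LR, UR] @ d"] exI[of _ a]) auto
  next
    fix d assume "[UR] @ replicate a UL = d @ [LR] @ vs"
    then have "LR \<in> set ([UR] @ replicate a UL)" by simp
    then show ?thesis by simp
  qed
qed

text \<open>The path issued from a later vertex of the fin does not return to that vertex.\<close>

lemma word_no_return:
  assumes "fish_word w" "w = p @ t @ [UR] @ replicate a UL @ q" "p \<noteq> []" "\<forall>s\<in>set p. is_lower s"
    "stays_right 0 t" "xd t = 1"
  shows "yd t > int a"
  using assms
proof (induction arbitrary: p t a q rule: fish_word.induct)
  case cell
  then obtain x t' where t: "t = x # t'" by (cases t) auto
  then have "x = LL" using cell by (cases x) auto
  then show ?case using cell t by (auto simp: Cons_eq_append_conv append_eq_Cons_conv)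
next
  case (up us vs)
  have t0: "t \<noteq> []" using up.prems by auto
  have e: "us @ [LR] @ (UR # UL # vs) = p @ (t @ [UR] @ replicate a UL @ q)" using up.prems by simp
  have "\<not> (\<exists>d. p = us @ [LR] @ d \<and> UR # UL # vs = d @ t @ [UR] @ replicate a UL @ q)"
    using up.prems t0 by (auto simp: Cons_eq_append_conv)
  then obtain z where z: "us = p @ z" "z @ [LR] @ (UR # UL # vs) = t @ ([UR] @ replicate a UL @ q)"
    using split1[OF e] by auto
  from split1[OF z(2)] show ?case
  proof (elim disjE exE conjE)
    fix d assume d: "t = z @ [LR] @ d" "UR # UL # vs = d @ [UR] @ replicate a UL @ q"
    show ?thesis
    proof (cases d)
      case Nil
      then have r: "UL # vs = replicate a UL @ q" using d by simp
      show ?thesis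
      proof (cases a)
        case 0
        then show ?thesis using up.IH[of p z 0 vs] z d Nil up.prems by auto
      next
        case (Suc a')
        \<comment> \<open>One \<open>UL\<close> of the descent comes from the new cell: before the
          rewriting, both the height of the excursion and the length of the descent were smaller by
          one.\<close>
        then show ?thesis using up.IH[of p z a' q] z d r Nil up.prems by auto
      qed
    next
      case (Cons s d1)
      then obtain d2 where d2: "d = UR # UL # d2" "vs = d2 @ [UR] @ replicate a UL @ q"
        using d by (cases d1) auto
      then show ?thesis using up.IH[of p "z @ [UR] @ d2" a q] z d up.prems by auto
    qed
  next
    fix d assume d: "z = t @ d" "[UR] @ replicate a UL @ q = d @ [LR] @ UR # UL # vs"
    then obtain d1 where d1: "d = UR # d1" "replicate a UL @ q = d1 @ LR # UR # UL # vs" by (cases d) auto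
    then obtain d2 where "d1 = replicate a UL @ d2" using rep_split by blast
    then show ?thesis using up.IH[of p t a "d2 @ [UR] @ vs"] z d d1 up.prems by auto
  qed
next
  case (down us vs)
  have t0: "t \<noteq> []" using down.prems by auto
  have e: "us @ [LL] @ (LR # UR # vs) = p @ (t @ [UR] @ replicate a UL @ q)" using down.prems by simp
  have "\<not> (\<exists>d. p = us @ [LL] @ d \<and> LR # UR # vs = d @ t @ [UR] @ replicate a UL @ q)"
    using down.prems t0 by (auto simp: Cons_eq_append_conv)
  then obtain z where z: "us = p @ z" "z @ [LL] @ (LR # UR # vs) = t @ ([UR] @ replicate a UL @ q)"
    using split1[OF e] by auto
  from split1[OF z(2)] show ?case
  proof (elim disjE exE conjE)
    fix d assume d: "t = z @ [LL] @ d" "LR # UR # vs = d @ [UR] @ replicate a UL @ q"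
    then obtain d1 where d1: "d = LR # d1" "UR # vs = d1 @ [UR] @ replicate a UL @ q" by (cases d) auto
    show ?thesis
    proof (cases d1)
      case Nil
      then have r: "vs = replicate a UL @ q" using d1 by simp
      \<comment> \<open>The inserted \<open>LL LR UR\<close> is the whole excursion, of height 1. A
        \<open>UL\<close> after it would have followed the rewritten \<open>LR\<close>, a forbidden
        factor, so there is no descent.\<close>
      have z0: "z = []" using stays_right_xd[of 0 z] d d1 Nil down.prems by auto
      have "a = 0"
      proof (cases a)
        case (Suc a')
        then show ?thesis using word_no[OF down.hyps, of us LR UL "replicate a' UL @ q"] r by simp
      qed simp
      then show ?thesis using d d1 Nil z0 by simp
    next
      case (Cons s d2)
      then have d2: "d1 = UR # d2" "vs = d2 @ [UR] @ replicate a UL @ q" using d1 by auto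
      then show ?thesis using down.IH[of p "z @ [LR] @ d2" a q] z d d1 down.prems by auto
    qed
  next
    fix d assume d: "z = t @ d" "[UR] @ replicate a UL @ q = d @ [LL] @ LR # UR # vs"
    then obtain d1 where d1: "d = UR # d1" "replicate a UL @ q = d1 @ LL # LR # UR # vs" by (cases d) auto
    then obtain d2 where "d1 = replicate a UL @ d2" using rep_split by blast
    then show ?thesis using down.IH[of p t a "d2 @ [LR] @ vs"] z d d1 down.prems by auto
  qed
next
  case (both us vs)
  have t0: "t \<noteq> []" using both.prems by auto
  have e: "us @ [LR] @ (UR # vs) = p @ (t @ [UR] @ replicate a UL @ q)" using both.prems by simp
  have "\<not> (\<exists>d. p = us @ [LR] @ d \<and> UR # vs = d @ t @ [UR] @ replicate a UL @ q)"
    using both.prems t0 by (auto simp: Cons_eq_append_conv)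
  then obtain z where z: "us = p @ z" "z @ [LR] @ (UR # vs) = t @ ([UR] @ replicate a UL @ q)"
    using split1[OF e] by auto
  from split1[OF z(2)] show ?case
  proof (elim disjE exE conjE)
    fix d assume d: "t = z @ [LR] @ d" "UR # vs = d @ [UR] @ replicate a UL @ q"
    show ?thesis
    proof (cases d)
      case Nil
      then have r: "vs = replicate a UL @ q" using d by simp
      have "a = 0"
      proof (cases a)
        case (Suc a')
        then show ?thesis using word_no[OF both.hyps, of "us @ [UR]" LR UL "replicate a' UL @ q"] r by simp
      qed simp
      then show ?thesis using both.IH[of p z 0 "LR # vs"] z d Nil both.prems by auto
    next
      case (Cons s d2)
      then have d2: "d = UR # d2" "vs = d2 @ [UR] @ replicate a UL @ q" using d by auto
      then show ?thesis using both.IH[of p "z @ [UR, LR] @ d2" a q] z d both.prems by auto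
    qed
  next
    fix d assume d: "z = t @ d" "[UR] @ replicate a UL @ q = d @ [LR] @ UR # vs"
    then obtain d1 where d1: "d = UR # d1" "replicate a UL @ q = d1 @ LR # UR # vs" by (cases d) auto
    then obtain d2 where "d1 = replicate a UL @ d2" using rep_split by blast
    then show ?thesis using both.IH[of p t a "d2 @ [UR, LR] @ vs"] z d d1 both.prems by auto
  qed
qed

text \<open>The path \<open>t @ [UR]\<close> is back on the starting line, so a path that stays
  right of this line must stop before that \<open>UR\<close>. Thus the first excursion of a word is
  canonical.\<close>

lemma stays_right_prefix:
  assumes "t @ [UR] @ r = u @ v" "stays_right 0 u" "xd t = 1"
  shows "\<exists>z. t = u @ z \<and> v = z @ [UR] @ r"
  using split1[OF assms(1)] assms(2,3) by auto

lemma word_shape2: "fish_word (y @ [UL]) \<Longrightarrow> \<exists>t b. y = t @ [UR] @ replicate b UL \<and> stays_right 0 t \<and> xd t = 1 \<and> yd t = int b + 1"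
proof -
  assume "fish_word (y @ [UL])"
  then obtain t a where t: "y @ [UL] = t @ [UR] @ replicate a UL" "stays_right 0 t" "xd t = 1" "yd t = int a"
    using word_shape by blast
  then obtain b where b: "a = Suc b" by (cases a) auto
  then have "y @ [UL] = (t @ [UR] @ replicate b UL) @ [UL]"
    using t(1) by (simp add: replicate_append_same)
  then have "y = t @ [UR] @ replicate b UL" by blast
  then show ?thesis using t b by (intro exI[of _ t] exI[of _ b]) simp
qed

text \<open>Seen from outside, \<open>y\<close> behaves like the single step \<open>LR\<close> that
  it replaces.\<close>

lemma splitting_yD: "splitting p y q \<Longrightarrow> xd y = 0 \<and> yd y = 1 \<and> (h > 0 \<longrightarrow> stays_right h y)"
proof -
  assume "splitting p y q"
  then consider "y = [LR]" | "fish_word (y @ [UL])" unfolding splitting_def by blast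
  then show ?thesis
  proof cases
    case 2
    then obtain t b where "y = t @ [UR] @ replicate b UL" "stays_right 0 t" "xd t = 1" "yd t = int b + 1"
      using word_shape2 by blast
    then show ?thesis using stays_right_mono[of 0 t h] by auto
  qed simp
qed

text \<open>If a second cut lay further along the fin, the excursion of \<open>y\<close> would
  contain all of \<open>e @ y'\<close>. Removing \<open>y'\<close> lowers what follows by one unit,
  so the boundary \<open>p @ e @ q'\<close> would come back exactly to the end of \<open>p\<close>,
  against \<open>word_no_return\<close>.\<close>

lemma splitting_unique_aux:
  assumes d: "splitting p y q" and d': "splitting (p @ e) y' q'" and eq: "y @ q = e @ y' @ q'"
  shows "e = []"
proof (rule ccontr)
  assume e: "e \<noteq> []"
  have is_lower: "\<forall>s\<in>set e. is_lower s" and p: "p \<noteq> []" "\<forall>s\<in>set p. is_lower s"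
    using d d' unfolding splitting_def by auto
  have y': "y' = [LR] \<or> (\<exists>z. y' = LL # z)"
    using d' word_hd_last[of "y' @ [UL]"] unfolding splitting_def by (cases y') auto
  consider q2 where "y = [LR]" "q = UR # q2" | "fish_word (y @ [UL])" using d unfolding splitting_def by blast
  then show False
  proof cases
    case 1
    then show False using eq e is_lower y' by (cases e) (auto simp: Cons_eq_append_conv)
  next
    case 2
    then obtain t b where y: "y = t @ [UR] @ replicate b UL" "stays_right 0 t" "xd t = 1" "yd t = int b + 1"
      using word_shape2 by blast
    obtain e' where e': "e = LL # e'"
    proof -
      obtain s e' where s: "e = s # e'" using e by (cases e) auto
      have "y \<noteq> []" using y by simp
      then obtain y1 where "y = LL # y1" using word_hd_last[OF 2] by (metis hd_append2 list.collapse)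
      then show ?thesis using s eq that by auto
    qed
    have "stays_right 1 e' \<and> xd e' \<ge> 0" using stays_right_low[of e' 1] is_lower e' by auto
    then have pe: "stays_right 0 e" "xd e > 0" using e' by auto
    have py: "xd y' = 0" "yd y' = 1" "stays_right (xd e) y'" using splitting_yD[OF d'] pe by auto
    have "t @ [UR] @ (replicate b UL @ q) = (e @ y') @ q'" using eq y by simp
    then obtain z where z: "t = (e @ y') @ z" "q' = z @ [UR] @ replicate b UL @ q"
      using stays_right_prefix[of t "replicate b UL @ q" "e @ y'" q'] pe py y by auto
    have "fish_word ((p @ e) @ q')" using d' p e unfolding splitting_def by (cases p) auto
    then have "yd (e @ z) > int b"
      using word_no_return[of "(p @ e) @ q'" p "e @ z" b q] z p y py by auto
    then show False using y z py by simp
  qed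
qed

text \<open>Once the cut is known, \<open>y\<close> consists of the first excursion, its closing
  \<open>UR\<close>, and a descent whose length is determined by the height of the
  excursion.\<close>

lemma splitting_unique:
  assumes d: "splitting p y q" and d': "splitting p' y' q'" and eq: "p @ y @ q = p' @ y' @ q'"
  shows "p = p' \<and> y = y' \<and> q = q'"
proof -
  from eq consider e where "p' = p @ e" "y @ q = e @ y' @ q'" | e where "p = p' @ e" "y' @ q' = e @ y @ q"
    using append_eq_append_conv2[of p "y @ q" p' "y' @ q'"] by metis
  then have p: "p = p' \<and> y @ q = y' @ q'"
    using splitting_unique_aux d d' by cases fastforce+
  have "y = y'"
  proof -
    have hd: "y = [LR] \<or> (\<exists>z. y = LL # z) \<and> fish_word (y @ [UL])" if "splitting p y q" for p y q
      using that word_hd_last[of "y @ [UL]"] unfolding splitting_def by (cases y) auto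
    show ?thesis
    proof (cases "y = [LR]")
      case True
      then show ?thesis using p hd[OF d'] by auto
    next
      case False
      then have f: "fish_word (y @ [UL])" "fish_word (y' @ [UL])" using hd[OF d] hd[OF d'] p by auto
      obtain t b where y: "y = t @ [UR] @ replicate b UL" "stays_right 0 t" "xd t = 1" "yd t = int b + 1"
        using word_shape2[OF f(1)] by blast
      obtain t' b' where y': "y' = t' @ [UR] @ replicate b' UL" "stays_right 0 t'" "xd t' = 1" "yd t' = int b' + 1"
        using word_shape2[OF f(2)] by blast
      have e: "t @ [UR] @ (replicate b UL @ q) = t' @ [UR] @ (replicate b' UL @ q')" using p y y' by simp
      have "\<exists>z. t = t' @ z" "\<exists>z. t' = t @ z"
        using stays_right_prefix[OF e] stays_right_prefix[OF e[symmetric]] y y' by auto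
      then have "t = t'" by auto
      then show ?thesis using y y' by simp
    qed
  qed
  then show ?thesis using p by simp
qed

section \<open>Trees as codes of boundary words\<close>

text \<open>Common code of both families. \<open>Node l r j\<close> encodes the permutation \<open>A @ n # B\<close> with \<open>A\<close>, \<open>B\<close>
  coded by \<open>l\<close>, \<open>r\<close>, where \<open>j\<close> left-to-right maxima of \<open>stack_sort B\<close> are smaller than the maximum
  of \<open>A\<close>; it also encodes the fish word \<open>p @ y @ q @ [UL]\<close> where \<open>p\<close> omits the last \<open>j\<close> edges of
  the fin of the fish coded by \<open>r\<close>.\<close>

datatype tree = Leaf | Node tree tree nat

text \<open>For words this is the fin length minus one, for permutations the number of left-to-right
  maxima after one sorting pass. Validity gives \<open>j \<le> ltr_t r\<close>, so the subtraction
  is not truncated.\<close>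

fun ltr_t :: "tree \<Rightarrow> nat" where
  "ltr_t Leaf = 0"
| "ltr_t (Node l r j) = ltr_t l + ltr_t r + 1 - j"

text \<open>With \<open>l = Leaf\<close> there is no maximum of \<open>A\<close> to exceed anything,
  and a missing second fish must sit at the very end of the fin; both force
  \<open>j = 0\<close>.\<close>

fun valid :: "tree \<Rightarrow> bool" where
  "valid Leaf = True"
| "valid (Node l r j) = (valid l \<and> valid r \<and> j \<le> ltr_t r \<and> (l = Leaf \<longrightarrow> j = 0))"

fun tree_word :: "tree \<Rightarrow> side list" where
  "tree_word Leaf = []"
| "tree_word (Node l r j) =
    (let R = (if r = Leaf then [LL, UR] else tree_word r);
         y = (if l = Leaf then [LR] else butlast (tree_word l));
         m = Suc (ltr_t r) - j
     in take m R @ y @ drop m R @ [UL])"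

definition fin :: "side list \<Rightarrow> nat" where "fin w = length (takeWhile is_lower w)"

lemma take_fin: "m \<le> fin w \<Longrightarrow> length (take m w) = m \<and> (\<forall>s\<in>set (take m w). is_lower s)"
proof -
  assume m: "m \<le> fin w"
  have "take m w = take m (takeWhile is_lower w)"
    using m unfolding fin_def by (metis takeWhile_eq_take take_take min.absorb1)
  then show ?thesis using m unfolding fin_def
    by (metis length_take min.absorb2 in_set_takeD set_takeWhileD)
qed

text \<open>The first upper edge follows a lower one, and the only such pair allowed is
  \<open>LR UR\<close>: the fin ends at a tail.\<close>

lemma word_first_UR:
  assumes "fish_word w"
  shows "\<exists>u q. w = u @ [LR] @ UR # q \<and> fin w = Suc (length u) \<and> (\<forall>s\<in>set u. is_lower s)"
proof -
  define u where "u = takeWhile is_lower w"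
  have "dropWhile is_lower w \<noteq> []" using word_hd_last[OF assms] by (metis dropWhile_eq_Nil_conv last_in_set is_lower.simps(4))
  then obtain s q where s: "dropWhile is_lower w = s # q" "\<not> is_lower s"
    by (metis hd_dropWhile list.exhaust list.sel(1))
  have w: "w = u @ s # q" unfolding u_def using s(1) by (metis takeWhile_dropWhile_id)
  have "u \<noteq> []" using word_hd_last[OF assms] s w by (cases u) auto
  then obtain u' x where u: "u = u' @ [x]" by (cases u rule: rev_cases) auto
  have x: "is_lower x" "\<forall>s\<in>set u'. is_lower s" using u unfolding u_def by (metis in_set_conv_decomp set_takeWhileD, metis UnI1 set_append set_takeWhileD)
  have "may_follow x s" using word_no[OF assms, of u' x s q] w u by simp
  then have "x = LR \<and> s = UR" using x s by (cases x; cases s) auto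
  then show ?thesis using w u x unfolding fin_def u_def by (metis append.assoc append_Cons append_Nil length_append_singleton)
qed

text \<open>The facts about the subtrees are hypotheses because this serves inside the induction
  that proves them; \<open>tree_word_dec'\<close> is the form available afterwards.\<close>

lemma tree_word_dec:
  assumes "valid (Node l r j)"
    and R: "R = (if r = Leaf then [LL, UR] else tree_word r)"
    and y: "y = (if l = Leaf then [LR] else butlast (tree_word l))"
    and m: "m = Suc (ltr_t r) - j"
    and l: "l \<noteq> Leaf \<Longrightarrow> fish_word (tree_word l) \<and> fin (tree_word l) = Suc (ltr_t l)"
    and r: "r \<noteq> Leaf \<Longrightarrow> fish_word (tree_word r) \<and> fin (tree_word r) = Suc (ltr_t r)"
  shows "splitting (take m R) y (drop m R)" "length (take m R) = m" "fin R = Suc (ltr_t r)"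
    "fin (y @ z) = (if l = Leaf \<and> z \<noteq> [] \<and> \<not> is_lower (hd z) then 1 else if l = Leaf then fin (y @ z) else Suc (ltr_t l))"
proof -
  show fR: "fin R = Suc (ltr_t r)" using r R unfolding fin_def by auto
  have mR: "m \<le> fin R" "m > 0" using fR m assms(1) by auto
  show len: "length (take m R) = m" using take_fin[OF mR(1)] by simp
  have lw: "\<forall>s\<in>set (take m R). is_lower s" using take_fin[OF mR(1)] by simp
  have nn: "take m R \<noteq> []" using len mR(2) by auto
  have A: "fish_word (take m R @ drop m R) \<or> take m R = [LL] \<and> drop m R = [UR]"
    using r R fR mR assms(1) m by auto
  have B: "y = [LR] \<and> (\<exists>q'. drop m R = UR # q') \<or> fish_word (y @ [UL])"
  proof (cases "l = Leaf")
    case True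
    then have mm: "m = fin R" using m assms(1) fR by simp
    have "\<exists>q'. drop m R = UR # q'"
    proof (cases "r = Leaf")
      case True then show ?thesis using mm R by (auto simp: fin_def)
    next
      case False
      then obtain u q where "R = u @ [LR] @ UR # q" "fin R = Suc (length u)"
        using word_first_UR r R by metis
      then show ?thesis using mm by auto
    qed
    then show ?thesis using y True by simp
  next
    case False
    then have "y @ [UL] = tree_word l" using y l word_hd_last by (metis append_butlast_last_id)
    then show ?thesis using l False by simp
  qed
  show "splitting (take m R) y (drop m R)" unfolding splitting_def using nn lw A B by blast
  show "fin (y @ z) = (if l = Leaf \<and> z \<noteq> [] \<and> \<not> is_lower (hd z) then 1 else if l = Leaf then fin (y @ z) else Suc (ltr_t l))"
  proof (cases "l = Leaf")
    case True
    then show ?thesis using y by (cases z) (auto simp: fin_def)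
  next
    case False
    have yl: "y @ [UL] = tree_word l" using y l False word_hd_last by (metis append_butlast_last_id)
    then have "UR \<in> set y" using word_shape2[of y] l False by auto
    then have "takeWhile is_lower (y @ z) = takeWhile is_lower y" "takeWhile is_lower (y @ [UL]) = takeWhile is_lower y"
      by (auto intro: takeWhile_append1)
    then show ?thesis using l False yl unfolding fin_def by simp
  qed
qed

lemma tree_word_Node_eq:
  "R = (if r = Leaf then [LL, UR] else tree_word r) \<Longrightarrow> y = (if l = Leaf then [LR] else butlast (tree_word l)) \<Longrightarrow>
   m = Suc (ltr_t r) - j \<Longrightarrow> tree_word (Node l r j) = take m R @ y @ drop m R @ [UL]"
  by (simp add: Let_def)

text \<open>The fin of the new fish is \<open>p\<close> followed by the fin of the second fish. If
  that fish is missing, the edge \<open>LR\<close> standing for it is followed by the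
  \<open>UR\<close> beginning \<open>q\<close> and counts one.\<close>

lemma tree_word_fw: "valid T \<Longrightarrow> T \<noteq> Leaf \<Longrightarrow> fish_word (tree_word T) \<and> fin (tree_word T) = Suc (ltr_t T)"
proof (induction T)
  case (Node l r j)
  define R y m where d: "R = (if r = Leaf then [LL, UR] else tree_word r)"
    "y = (if l = Leaf then [LR] else butlast (tree_word l))" "m = Suc (ltr_t r) - j"
  have v: "valid l" "valid r" "j \<le> ltr_t r" "l = Leaf \<Longrightarrow> j = 0" using Node.prems by auto
  have *: "splitting (take m R) y (drop m R)" "length (take m R) = m" "fin R = Suc (ltr_t r)"
    using tree_word_dec(1,2,3)[OF Node.prems(1) d] Node.IH v by blast+
  have **: "fin (y @ z) = (if l = Leaf \<and> z \<noteq> [] \<and> \<not> is_lower (hd z) then 1 else if l = Leaf then fin (y @ z) else Suc (ltr_t l))" for z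
    using tree_word_dec(4)[OF Node.prems(1) d, of z] Node.IH v by blast
  note w = tree_word_Node_eq[OF d]
  have f: "fish_word (tree_word (Node l r j))" using splitting_fw[OF *(1)] w by simp
  have "fin (tree_word (Node l r j)) = m + fin (y @ drop m R @ [UL])"
    using w *(1,2) unfolding fin_def splitting_def by simp
  also have "fin (y @ drop m R @ [UL]) = Suc (ltr_t l)"
  proof (cases "l = Leaf")
    case True
    have "\<not> fish_word [LR, UL]" using word_hd_last by fastforce
    then have "\<exists>q'. drop m R = UR # q'" using *(1) True d(2) unfolding splitting_def by auto
    then show ?thesis using **[of "drop m R @ [UL]"] True by auto
  qed (use ** in auto)
  also have "m + Suc (ltr_t l) = Suc (ltr_t (Node l r j))" using d(3) v by auto
  finally show ?case using f by simp
qed simp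

lemma tree_word_dec': 
  assumes "valid (Node l r j)"
    and R: "R = (if r = Leaf then [LL, UR] else tree_word r)"
    and y: "y = (if l = Leaf then [LR] else butlast (tree_word l))"
    and m: "m = Suc (ltr_t r) - j"
  shows "splitting (take m R) y (drop m R) \<and> length (take m R) = m \<and> fin R = Suc (ltr_t r)"
  using tree_word_dec[OF assms] tree_word_fw assms(1) by auto

lemma tree_word_inj: "valid T \<Longrightarrow> valid T' \<Longrightarrow> tree_word T = tree_word T' \<Longrightarrow> T = T'"
proof (induction T arbitrary: T')
  case Leaf
  then show ?case using tree_word_fw[of T'] word_hd_last by fastforce
next
  case (Node l r j)
  have "T' \<noteq> Leaf" using tree_word_fw[of "Node l r j"] Node.prems word_hd_last by fastforce
  then obtain l' r' j' where T': "T' = Node l' r' j'" by (cases T') auto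
  have v: "valid l" "valid r" "j \<le> ltr_t r" "valid l'" "valid r'" "j' \<le> ltr_t r'" using Node.prems T' by auto
  define R y m where d: "R = (if r = Leaf then [LL, UR] else tree_word r)"
    "y = (if l = Leaf then [LR] else butlast (tree_word l))" "m = Suc (ltr_t r) - j"
  define R' y' m' where d': "R' = (if r' = Leaf then [LL, UR] else tree_word r')"
    "y' = (if l' = Leaf then [LR] else butlast (tree_word l'))" "m' = Suc (ltr_t r') - j'"
  note D = tree_word_dec'[OF Node.prems(1) d]
  note D' = tree_word_dec'[OF Node.prems(2)[unfolded T'] d']
  have "take m R @ y @ drop m R = take m' R' @ y' @ drop m' R'"
    using Node.prems(3) tree_word_Node_eq[OF d] tree_word_Node_eq[OF d'] T' by simp
  then have E: "take m R = take m' R'" "y = y'" "drop m R = drop m' R'"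
    using splitting_unique[of "take m R" y "drop m R"] D D' by blast+
  have m: "m = m'" using E(1) D D' by metis
  have RR: "R = R'" using E by (metis append_take_drop_id)
  \<comment> \<open>This tells a missing subtree from an actual one.\<close>
  have nf: "\<not> fish_word [LL, UR]" "\<not> fish_word [LR, UL]" using word_hd_last by fastforce+
  have r: "r = r'"
  proof (cases "r = Leaf")
    case True then show ?thesis using RR d(1) d'(1) nf tree_word_fw[OF v(5)] by (auto split: if_splits)
  next
    case False
    then have "r' \<noteq> Leaf" using RR d(1) d'(1) nf tree_word_fw[OF v(2)] by (auto split: if_splits)
    then show ?thesis using False RR d(1) d'(1) Node.IH(2)[OF v(2,5)] by simp
  qed
  have bl: "tree_word t = butlast (tree_word t) @ [UL]" if "t \<noteq> Leaf" "valid t" for t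
    using tree_word_fw[OF that(2,1)] word_hd_last by (metis append_butlast_last_id)
  have l: "l = l'"
  proof (cases "l = Leaf")
    case True
    have "l' = Leaf"
    proof (rule ccontr)
      assume "l' \<noteq> Leaf"
      then have "butlast (tree_word l') = [LR]" "fish_word (tree_word l')" "tree_word l' = butlast (tree_word l') @ [UL]"
        using True E(2) d(2) d'(2) tree_word_fw[OF v(4)] bl[OF _ v(4)] by auto
      then show False using nf(2) by (metis append_Cons append_Nil)
    qed
    then show ?thesis using True by simp
  next
    case False
    have "l' \<noteq> Leaf"
    proof
      assume "l' = Leaf"
      then have "butlast (tree_word l) = [LR]" "fish_word (tree_word l)" "tree_word l = butlast (tree_word l) @ [UL]"
        using False E(2) d(2) d'(2) tree_word_fw[OF v(1)] bl[OF _ v(1)] by auto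
      then show False using nf(2) by (metis append_Cons append_Nil)
    qed
    then have "tree_word l = tree_word l'" using False E(2) d(2) d'(2) bl[OF _ v(1)] bl[OF _ v(4)] by simp
    then show ?thesis using Node.IH(1)[OF v(1,4)] by simp
  qed
  have "j = j'" using m d(3) d'(3) r v by simp
  then show ?case using T' l r by simp
qed

lemma tree_word_surj: "fish_word w \<Longrightarrow> \<exists>T. valid T \<and> T \<noteq> Leaf \<and> tree_word T = w"
proof (induction w rule: length_induct)
  case (1 w)
  obtain p y q where w: "w = p @ y @ q @ [UL]" and d: "splitting p y q" using word_dec 1 by blast
  have y0: "y \<noteq> []" "p \<noteq> []" using d word_hd_last[of "[UL]"] unfolding splitting_def by auto
  obtain r where r: "valid r" "p @ q = (if r = Leaf then [LL, UR] else tree_word r)"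
  proof (cases "fish_word (p @ q)")
    case True
    moreover have "length (p @ q) < length w" using w y0 by simp
    ultimately obtain r where "valid r" "r \<noteq> Leaf" "tree_word r = p @ q" using 1(1) by blast
    then show ?thesis using that[of r] by simp
  next
    case False then show ?thesis using d that[of Leaf] unfolding splitting_def by auto
  qed
  have fr: "fin (p @ q) = Suc (ltr_t r)" using tree_word_fw[OF r(1)] r(2) by (auto simp: fin_def)
  have "takeWhile is_lower (p @ q) = p @ takeWhile is_lower q" using d unfolding splitting_def by simp
  then have fp: "Suc (ltr_t r) = length p + fin q" using fr unfolding fin_def by simp
  obtain l where l: "valid l" "y = (if l = Leaf then [LR] else butlast (tree_word l))" "l = Leaf \<Longrightarrow> \<exists>q'. q = UR # q'"
  proof (cases "fish_word (y @ [UL])")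
    case True
    moreover have "length (y @ [UL]) < length w" using w y0 by (cases p) auto
    ultimately obtain l where "valid l" "l \<noteq> Leaf" "tree_word l = y @ [UL]" using 1(1) by blast
    then show ?thesis using that[of l] by simp
  next
    case False then show ?thesis using d that[of Leaf] unfolding splitting_def by auto
  qed
  define j where "j = Suc (ltr_t r) - length p"
  have j: "j \<le> ltr_t r" "Suc (ltr_t r) - j = length p" using fp y0(2) unfolding j_def by (cases p; auto)+
  have "valid (Node l r j)"
    using l r j fp unfolding j_def by (auto simp: fin_def)
  moreover have "tree_word (Node l r j) = w"
    using tree_word_Node_eq[OF r(2) l(2) j(2)[symmetric]] w by simp
  ultimately show ?case by blast
qed

fun asc_t :: "tree \<Rightarrow> nat" where
  "asc_t Leaf = 0" | "asc_t (Node l r j) = asc_t l + asc_t r + (if l = Leaf then 0 else 1)"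
fun des_t :: "tree \<Rightarrow> nat" where
  "des_t Leaf = 0" | "des_t (Node l r j) = des_t l + des_t r + (if r = Leaf then 0 else 1)"
fun inv_t :: "tree \<Rightarrow> nat" where
  "inv_t Leaf = 0" | "inv_t (Node l r j) = inv_t l + inv_t r + (if j = 0 then 0 else 1)"

definition tail_step :: "side \<Rightarrow> side \<Rightarrow> bool" where "tail_step a b \<longleftrightarrow> a = LR \<and> b = UR"

text \<open>A cut inside the fin leaves all tails of both fish, whence the extra one for
  \<open>j > 0\<close>. A cut at the end of the fin of an actual fish separates its first
  \<open>LR UR\<close> and so destroys one tail. The conditional terms of \<open>asc_t\<close> and
  \<open>des_t\<close> arise because \<open>[LL, UR]\<close> has one \<open>LL\<close> but no
  \<open>LR\<close>, and \<open>[LR]\<close> the converse.\<close>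

lemma tree_word_stats: "valid T \<Longrightarrow> T \<noteq> Leaf \<Longrightarrow> count_list (tree_word T) LL = asc_t T + 1 \<and>
   count_list (tree_word T) LR = des_t T + 1 \<and> adj tail_step (tree_word T) = inv_t T + 1"
proof (induction T)
  case (Node l r j)
  have v: "valid l" "valid r" "j \<le> ltr_t r" "l = Leaf \<Longrightarrow> j = 0" using Node.prems by auto
  define R y m where d: "R = (if r = Leaf then [LL, UR] else tree_word r)"
    "y = (if l = Leaf then [LR] else butlast (tree_word l))" "m = Suc (ltr_t r) - j"
  note D = tree_word_dec'[OF Node.prems(1) d]
  define p q where pq: "p = take m R" "q = drop m R"
  have R: "R = p @ q" using pq by simp
  have dd: "splitting p y q" "length p = m" "fin R = Suc (ltr_t r)" using D pq by auto
  have w: "tree_word (Node l r j) = p @ y @ q @ [UL]" using tree_word_Node_eq[OF d] pq by simp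
  have bl: "l \<noteq> Leaf \<Longrightarrow> tree_word l = y @ [UL]"
    using tree_word_fw[OF v(1)] word_hd_last d(2) by (metis append_butlast_last_id)
  have cR: "count_list R LL = asc_t r + 1" "count_list R LR = des_t r + (if r = Leaf then 0 else 1)"
    using Node.IH(2)[OF v(2)] d(1) by auto
  have cy: "count_list y LL = asc_t l + (if l = Leaf then 0 else 1)" "count_list y LR = des_t l + 1"
  proof -
    have "count_list y LL = asc_t l + (if l = Leaf then 0 else 1) \<and> count_list y LR = des_t l + 1"
    proof (cases "l = Leaf")
      case True then show ?thesis using d(2) by simp
    next
      case False then show ?thesis using Node.IH(1)[OF v(1)] bl by simp
    qed
    then show "count_list y LL = asc_t l + (if l = Leaf then 0 else 1)" "count_list y LR = des_t l + 1" by auto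
  qed
  have c: "count_list R s = count_list p s + count_list q s" for s using R by simp
  have q0: "q \<noteq> []" using R d(1) dd(1) word_hd_last[of p] unfolding splitting_def
    by (metis append_Nil2 last_in_set is_lower.simps(4) list.distinct(1))
  have p0: "p \<noteq> []" "is_lower (last p)" using dd(1) unfolding splitting_def by auto
  have fr: "length p + fin q = Suc (ltr_t r)" using dd R unfolding splitting_def fin_def by simp
  \<comment> \<open>The edge after the cut belongs to the fin of \<open>p @ q\<close> exactly when
    \<open>p\<close> omits some edge of it.\<close>
  have hq: "is_lower (hd q) \<longleftrightarrow> j > 0" using fr q0 dd(2) d(3) v(3) by (cases q) (auto simp: fin_def split: if_splits)
  have aR: "adj tail_step R = inv_t r + (if r = Leaf then 0 else 1)"
  proof (cases "r = Leaf")
    case True then show ?thesis using d(1) by (simp add: tail_step_def)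
  next
    case False then show ?thesis using Node.IH(2)[OF v(2)] d(1) by simp
  qed
  have A: "adj tail_step (p @ y @ q @ [UL]) = inv_t (Node l r j) + 1"
  proof (cases "l = Leaf")
    case True
    then have j: "j = 0" and y: "y = [LR]" using v d(2) by auto
    have "\<not> fish_word [LR, UL]" using word_hd_last by fastforce
    then obtain q' where q: "q = UR # q'" using dd(1) y unfolding splitting_def by auto
    have "tail_step (last p) UR \<longleftrightarrow> r \<noteq> Leaf"
    proof (cases "r = Leaf")
      case True
      then have "p = [LL]" using R d(1) p0 q by (auto simp: Cons_eq_append_conv)
      then show ?thesis using True by (simp add: tail_step_def)
    next
      case False
      then have "may_follow (last p) UR" using word_no[of R "butlast p" "last p" UR q'] tree_word_fw[OF v(2)] d(1) R q p0(1)
        by (metis append.assoc append_Cons append_Nil append_butlast_last_id)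
      then show ?thesis using False p0(2) by (cases "last p") (auto simp: tail_step_def)
    qed
    then have "adj tail_step R = adj tail_step p + adj tail_step q + (if r = Leaf then 0 else 1)"
      using R q p0 by (auto simp: adj_append)
    moreover have "adj tail_step (p @ y @ q @ [UL]) = adj tail_step p + adj tail_step q + 1"
    proof -
      have "adj tail_step (q @ [UL]) = adj tail_step q" by (simp add: adj_append tail_step_def)
      then show ?thesis using y q p0 by (simp add: adj_append tail_step_def)
    qed
    ultimately show ?thesis using aR True j by auto
  next
    case False
    have fy: "fish_word (y @ [UL])" using bl False tree_word_fw v by metis
    have y1: "y \<noteq> []" "hd y = LL" using word_hd_last[OF fy] by (cases y; auto)+
    obtain t b where y: "y = t @ [UR] @ replicate b UL" using word_shape2[OF fy] by blast
    have ly: "last y = UL \<or> last y = UR" using y by (cases b) auto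
    have "adj tail_step (tree_word l) = adj tail_step y" unfolding bl[OF False] by (simp add: adj_append tail_step_def)
    then have ay: "adj tail_step y = inv_t l + 1" using Node.IH(1)[OF v(1)] False by simp
    have w1: "adj tail_step (p @ y @ q @ [UL]) = adj tail_step p + adj tail_step y + adj tail_step q"
      using ly y1 by (auto simp: adj_append tail_step_def)
    have aR2: "adj tail_step R = adj tail_step p + adj tail_step q + (if tail_step (last p) (hd q) then 1 else 0)"
      using R p0 q0 by (simp add: adj_append)
    have "tail_step (last p) (hd q) \<longleftrightarrow> j = 0 \<and> r \<noteq> Leaf"
    proof (cases "r = Leaf")
      case True
      then show ?thesis using R d(1) p0 q0 by (auto simp: Cons_eq_append_conv tail_step_def)
    next
      case r: False
      have "p = butlast p @ [last p]" "q = hd q # tl q" using p0 q0 by simp_all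
      then have "R = butlast p @ [last p, hd q] @ tl q" using R by (metis append.assoc append_Cons append_Nil)
      moreover have "fish_word R" using tree_word_fw[OF v(2) r] d(1) r by simp
      ultimately have "may_follow (last p) (hd q)" by (rule word_no[rotated])
      then show ?thesis using p0(2) hq r by (cases "last p"; cases "hd q") (auto simp: tail_step_def)
    qed
    moreover have "r = Leaf \<Longrightarrow> j = 0" using v(3) by simp
    ultimately show ?thesis using w1 aR2 aR ay False by (auto split: if_splits)
  qed
  show ?case using A w c cR cy by auto
qed simp

section \<open>Two-stack sortable permutations\<close>

lemma stack_sort_max:
  assumes "\<forall>x\<in>set A. x < m" "\<forall>x\<in>set B. x < m"
  shows "stack_sort (A @ m # B) = stack_sort A @ stack_sort B @ [m]"
proof -
  have mx: "Max (set (A @ m # B)) = m" using assms by (intro Max_eqI) auto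
  have t: "takeWhile (\<lambda>x. x \<noteq> m) (A @ m # B) = A" "tl (dropWhile (\<lambda>x. x \<noteq> m) (A @ m # B)) = B"
    using assms by (auto simp: takeWhile_append dropWhile_append)
  obtain c cs where c: "A @ m # B = c # cs" by (cases A) auto
  have "stack_sort (c # cs) = stack_sort (takeWhile (\<lambda>x. x \<noteq> m) (c # cs)) @
        stack_sort (tl (dropWhile (\<lambda>x. x \<noteq> m) (c # cs))) @ [m]"
    using mx unfolding c by (simp only: stack_sort.simps Let_def)
  then show ?thesis using t unfolding c by simp
qed

lemma max_split:
  fixes xs :: "nat list"
  assumes "xs \<noteq> []" "distinct xs"
  shows "\<exists>A m B. xs = A @ m # B \<and> (\<forall>x\<in>set A. x < m) \<and> (\<forall>x\<in>set B. x < m)"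
proof -
  have "Max (set xs) \<in> set xs" using assms by simp
  then obtain A B where x: "xs = A @ Max (set xs) # B" by (meson split_list)
  have d: "Max (set xs) \<notin> set A" "Max (set xs) \<notin> set B" using assms(2) x
    by (metis distinct_append distinct.simps(2) not_distinct_conv_prefix UnI2 disjoint_iff list.set_intros(1))+
  have "\<forall>y\<in>set xs. y \<le> Max (set xs)" by simp
  then have "\<forall>y\<in>set A \<union> set B. y \<le> Max (set xs)" using x by (metis UnE UnI1 UnI2 list.set_intros(2) set_append)
  then show ?thesis using x d by (metis UnI1 UnI2 le_neq_implies_less)
qed

text \<open>Mirrors the recursion of \<open>stack_sort\<close>, which cuts a list at its
  maximum.\<close>

lemma max_induct[consumes 1, case_names Nil max]:
  fixes xs :: "nat list"
  assumes "distinct xs" "Q []"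
    "\<And>A m B. distinct (A @ m # B) \<Longrightarrow> \<forall>x\<in>set A. x < m \<Longrightarrow> \<forall>x\<in>set B. x < m \<Longrightarrow> Q A \<Longrightarrow> Q B \<Longrightarrow> Q (A @ m # B)"
  shows "Q xs"
  using assms(1)
proof (induction xs rule: length_induct)
  case (1 xs)
  show ?case
  proof (cases "xs = []")
    case False
    then obtain A m B where x: "xs = A @ m # B" "\<forall>x\<in>set A. x < m" "\<forall>x\<in>set B. x < m"
      using max_split 1 by blast
    then have "Q A" "Q B" using 1 by auto
    then show ?thesis using assms(3) x 1(2) by blast
  qed (use assms in simp)
qed

lemma set_stack_sort[simp]: "distinct xs \<Longrightarrow> set (stack_sort xs) = set xs"
  by (induction rule: max_induct) (auto simp: stack_sort_max)

lemma length_stack_sort[simp]: "distinct xs \<Longrightarrow> length (stack_sort xs) = length xs"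
  by (induction rule: max_induct) (auto simp: stack_sort_max)

lemma distinct_stack_sort[simp]: "distinct xs \<Longrightarrow> distinct (stack_sort xs)"
  by (simp add: card_distinct distinct_card)

text \<open>Stack sorting depends on comparisons only. This allows the two sides of the maximum to
  be treated as permutations of their own.\<close>

lemma stack_sort_map:
  assumes "distinct xs" "strict_mono_on (set xs) f"
  shows "stack_sort (map f xs) = map f (stack_sort xs)"
  using assms
proof (induction rule: max_induct)
  case (max A m B)
  then have "strict_mono_on (set A) f" "strict_mono_on (set B) f"
    by (auto simp: strict_mono_on_def)
  moreover have "\<forall>x\<in>set (map f A). x < f m" "\<forall>x\<in>set (map f B). x < f m"
    using max by (auto simp: strict_mono_on_def)
  ultimately show ?case using max by (simp add: stack_sort_max)
qed simp

lemma stack_sort_last: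
  fixes xs :: "nat list"
  assumes "distinct xs" "xs \<noteq> []"
  shows "\<exists>ys m. stack_sort xs = ys @ [m] \<and> (\<forall>y\<in>set ys. y < m)"
proof -
  obtain A m B where "xs = A @ m # B" "\<forall>x\<in>set A. x < m" "\<forall>x\<in>set B. x < m"
    using max_split assms by blast
  then show ?thesis using assms by (intro exI[of _ "stack_sort A @ stack_sort B"] exI[of _ m]) (auto simp: stack_sort_max)
qed

section \<open>Avoidance of 231 and sortability\<close>

text \<open>\<open>splits x ys\<close> holds iff \<open>x\<close> is not the 2 of a pattern 231 in \<open>x # ys\<close>.\<close>

fun splits :: "nat \<Rightarrow> nat list \<Rightarrow> bool" where
  "splits x [] = True"
| "splits x (y # ys) = (if y < x then splits x ys else (\<forall>z\<in>set (y # ys). x < z))"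

fun avoids231 :: "nat list \<Rightarrow> bool" where
  "avoids231 [] = True"
| "avoids231 (x # xs) = (splits x xs \<and> avoids231 xs)"

lemma splits_iff: "splits x ys \<longleftrightarrow> (\<exists>us vs. ys = us @ vs \<and> (\<forall>u\<in>set us. u < x) \<and> (\<forall>v\<in>set vs. x < v))"
proof
  show "splits x ys \<Longrightarrow> \<exists>us vs. ys = us @ vs \<and> (\<forall>u\<in>set us. u < x) \<and> (\<forall>v\<in>set vs. x < v)"
  proof (induction ys)
    case (Cons y ys)
    show ?case
    proof (cases "y < x")
      case True
      then obtain us vs where "ys = us @ vs" "\<forall>u\<in>set us. u < x" "\<forall>v\<in>set vs. x < v" using Cons by auto
      then show ?thesis using True by (intro exI[of _ "y # us"] exI[of _ vs]) auto
    next
      case False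
      then show ?thesis using Cons by (intro exI[of _ "[]"] exI[of _ "y # ys"]) auto
    qed
  qed simp
next
  assume "\<exists>us vs. ys = us @ vs \<and> (\<forall>u\<in>set us. u < x) \<and> (\<forall>v\<in>set vs. x < v)"
  then obtain us vs where "ys = us @ vs" "\<forall>u\<in>set us. u < x" "\<forall>v\<in>set vs. x < v" by blast
  moreover have "\<forall>v\<in>set vs. x < v \<Longrightarrow> splits x vs" by (cases vs) (auto dest: less_asym)
  ultimately show "splits x ys" by (induction us arbitrary: ys) auto
qed

lemma splits_append: "splits x (as @ bs) \<longleftrightarrow>
  splits x as \<and> splits x bs \<and> ((\<exists>a\<in>set as. \<not> a < x) \<longrightarrow> (\<forall>b\<in>set bs. x < b))"
proof (induction as)
  case (Cons a as)
  have "\<forall>b\<in>set bs. x < b \<Longrightarrow> splits x bs" by (cases bs) (auto dest: less_asym)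
  then show ?case using Cons by (auto dest: less_asym)
qed simp

lemma splits_map: "strict_mono_on (insert x (set ys)) f \<Longrightarrow> splits (f x) (map f ys) = splits x ys"
proof (induction ys)
  case (Cons y ys)
  then have *: "a \<in> insert x (set (y # ys)) \<Longrightarrow> b \<in> insert x (set (y # ys)) \<Longrightarrow> (f a < f b) = (a < b)" for a b
    using strict_mono_on_less by blast
  have "strict_mono_on (insert x (set ys)) f" using Cons.prems by (auto simp: strict_mono_on_def)
  then show ?case using Cons.IH * by simp
qed simp

lemma avoids231_map: "strict_mono_on (set ys) f \<Longrightarrow> avoids231 (map f ys) = avoids231 ys"
proof (induction ys)
  case (Cons y ys)
  then have "strict_mono_on (set ys) f" by (auto simp: strict_mono_on_def)
  then show ?case using Cons splits_map[of y ys f] by simp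
qed simp

text \<open>Every \<open>a\<close> in \<open>A\<close> is followed by the larger \<open>m\<close>,
  so all entries after \<open>m\<close> have to exceed \<open>a\<close>. It is applied both to the
  maximum of a whole list and to the last entry of \<open>stack_sort A\<close> inside a longer
  list.\<close>

lemma avoids231_mid: "\<forall>x\<in>set A. x < m \<Longrightarrow>
  avoids231 (A @ m # B) \<longleftrightarrow> avoids231 A \<and> avoids231 B \<and> splits m B \<and> (\<forall>a\<in>set A. \<forall>b\<in>set B. a < b)"
proof (induction A)
  case (Cons a A)
  then have "splits a (A @ m # B) \<longleftrightarrow> splits a A \<and> (\<forall>b\<in>set B. a < b)"
    by (auto simp: splits_append dest: less_asym)
  then show ?case using Cons by auto
qed auto

lemma avoids231_cross: "avoids231 (us @ vs @ ws) \<Longrightarrow> u \<in> set us \<Longrightarrow> v \<in> set vs \<Longrightarrow> u < v \<Longrightarrow> w \<in> set ws \<Longrightarrow> u < w"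
  by (induction us) (auto simp: splits_append dest: less_asym)

text \<open>Knuth's criterion for one pass. As \<open>stack_sort A\<close> precedes
  \<open>stack_sort B\<close>, sortedness requires \<open>A\<close> to lie below \<open>B\<close>,
  which says that the maximum is not the 3 of a pattern.\<close>

lemma sorted_stack_sort:
  assumes "distinct xs"
  shows "sorted (stack_sort xs) \<longleftrightarrow> avoids231 xs"
  using assms
proof (induction rule: max_induct)
  case (max A m B)
  have "splits m B" using max.hyps splits_iff by (metis append_Nil2 empty_iff list.set(1))
  moreover have "(\<forall>a\<in>set A. \<forall>b\<in>set B. a < b) \<longleftrightarrow> (\<forall>a\<in>set A. \<forall>b\<in>set B. a \<le> b)"
  proof -
    have "\<forall>a\<in>set A. \<forall>b\<in>set B. a \<noteq> b" using max.hyps(1) by auto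
    then show ?thesis by (meson le_neq_implies_less less_imp_le)
  qed
  moreover have "\<forall>x\<in>set A. x \<le> m" "\<forall>x\<in>set B. x \<le> m" using max.hyps by auto
  ultimately show ?case using max by (auto simp: stack_sort_max avoids231_mid sorted_append)
qed simp

text \<open>Unlike \<open>two_stack_sortable\<close>, this admits the empty permutation, since a
  side of the maximum may be empty.\<close>

definition sortable :: "nat list \<Rightarrow> bool" where
  "sortable p \<longleftrightarrow> is_perm p \<and> avoids231 (stack_sort p)"

lemma two_stack_sortable_iff: "two_stack_sortable p \<longleftrightarrow> p \<noteq> [] \<and> sortable p"
proof -
  have "(stack_sort (stack_sort p) = [1..<length p + 1]) \<longleftrightarrow> avoids231 (stack_sort p)" if "is_perm p"
  proof -
    have d: "distinct p" "set p = {1..length p}" using that unfolding is_perm_def by auto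
    have "set (stack_sort (stack_sort p)) = set p" using d(1) by simp
    also have "\<dots> = set [1..<length p + 1]" unfolding d(2) by auto
    finally have "set (stack_sort (stack_sort p)) = set [1..<length p + 1]" .
    moreover have "distinct (stack_sort (stack_sort p))" using d by simp
    moreover have "sorted [1..<length p + 1]" "distinct [1..<length p + 1]" by (rule sorted_upt, rule distinct_upt)
    ultimately have "sorted (stack_sort (stack_sort p)) \<longleftrightarrow> stack_sort (stack_sort p) = [1..<length p + 1]"
      using sorted_distinct_set_unique by metis
    then show ?thesis using sorted_stack_sort[of "stack_sort p"] d by simp
  qed
  then show ?thesis unfolding two_stack_sortable_def sortable_def by blast
qed

section \<open>Left-to-right maxima and cuts\<close>

lemma ltr_maxima_Nil[simp]: "ltr_maxima [] = 0" by (simp add: ltr_maxima_def)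

lemma ltr_maxima_snoc: "ltr_maxima (xs @ [x]) = ltr_maxima xs + (if \<forall>y\<in>set xs. y < x then 1 else 0)"
proof -
  let ?A = "{i. i < length xs \<and> (\<forall>j<i. xs ! j < xs ! i)}"
  let ?B = "{i. i < length (xs @ [x]) \<and> (\<forall>j<i. (xs @ [x]) ! j < (xs @ [x]) ! i)}"
  have f: "finite ?A" by simp
  have "?B = ?A \<union> (if \<forall>y\<in>set xs. y < x then {length xs} else {})"
    by (auto simp: nth_append less_Suc_eq all_set_conv_all_nth split: if_splits)
  then show ?thesis using f unfolding ltr_maxima_def by auto
qed

lemma ltr_maxima_append:
  "\<forall>u\<in>set us. \<forall>v\<in>set vs. u < v \<Longrightarrow> ltr_maxima (us @ vs) = ltr_maxima us + ltr_maxima vs"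
proof (induction vs rule: rev_induct)
  case (snoc v vs)
  have "ltr_maxima (us @ vs @ [v]) = ltr_maxima (us @ vs) + (if \<forall>y\<in>set (us @ vs). y < v then 1 else 0)"
    using ltr_maxima_snoc[of "us @ vs"] by simp
  then show ?case using snoc by (auto simp: ltr_maxima_snoc)
qed simp

lemma ltr_maxima_append_small:
  "m \<in> set us \<Longrightarrow> \<forall>v\<in>set vs. v < m \<Longrightarrow> ltr_maxima (us @ vs) = ltr_maxima us"
proof (induction vs rule: rev_induct)
  case (snoc v vs)
  have "ltr_maxima (us @ vs @ [v]) = ltr_maxima (us @ vs) + (if \<forall>y\<in>set (us @ vs). y < v then 1 else 0)"
    using ltr_maxima_snoc[of "us @ vs"] by simp
  moreover have "\<not> (\<forall>y\<in>set (us @ vs). y < v)" using snoc.prems by (auto dest: less_asym)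
  ultimately show ?case using snoc by simp
qed simp

lemma ltr_maxima_pos: "xs \<noteq> [] \<Longrightarrow> ltr_maxima xs > 0"
proof (induction xs rule: rev_induct)
  case (snoc x xs)
  then show ?case by (cases "xs = []") (use ltr_maxima_snoc[of "[]" x] in \<open>auto simp: ltr_maxima_snoc\<close>)
qed simp

lemma ltr_maxima_map: "strict_mono_on (set xs) f \<Longrightarrow> ltr_maxima (map f xs) = ltr_maxima xs"
proof (induction xs rule: rev_induct)
  case (snoc x xs)
  then have "strict_mono_on (set xs) f" by (auto simp: strict_mono_on_def)
  moreover have "y \<in> set xs \<Longrightarrow> (f y < f x) = (y < x)" for y
    using snoc.prems strict_mono_on_less[of "set (xs @ [x])" f y x] by simp
  ultimately show ?case using snoc by (simp add: ltr_maxima_snoc)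
qed simp

text \<open>At position \<open>t\<close> the list splits by value as well as by place, so a
  threshold can be put there. The positions \<open>t\<close> that occur may have gaps, but
  \<open>j\<close> runs through a full interval; this is why trees store \<open>j\<close>.\<close>

definition is_cut :: "nat list \<Rightarrow> nat \<Rightarrow> nat \<Rightarrow> bool" where
  "is_cut xs j t \<longleftrightarrow> t \<le> length xs \<and> ltr_maxima (take t xs) = j \<and>
     (\<forall>u\<in>set (take t xs). \<forall>v\<in>set (drop t xs). u < v)"

text \<open>A cut before the end survives one more entry: some entry after it exceeds those before
  it, so by avoidance of 231 all later ones do as well. When \<open>j\<close> is the total number of
  maxima, the cut is at the end.\<close>

lemma ex_cut:
  "avoids231 xs \<Longrightarrow> distinct xs \<Longrightarrow> j \<le> ltr_maxima xs \<Longrightarrow> \<exists>t. is_cut xs j t"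
proof (induction xs rule: rev_induct)
  case (snoc x xs)
  have avx: "avoids231 xs" using snoc.prems(1)
  proof -
    have "avoids231 (xs @ ys) \<Longrightarrow> avoids231 xs" for xs ys by (induction xs) (auto simp: splits_append)
    then show ?thesis using snoc.prems(1) by blast
  qed
  show ?case
  proof (cases "j = ltr_maxima (xs @ [x])")
    case True
    then show ?thesis by (intro exI[of _ "length (xs @ [x])"]) (simp add: is_cut_def)
  next
    case False
    then have j: "j \<le> ltr_maxima xs" using snoc.prems by (auto simp: ltr_maxima_snoc split: if_splits)
    then obtain t where t: "is_cut xs j t" using snoc avx by auto
    have "\<forall>u\<in>set (take t xs). u < x"
    proof (cases "drop t xs = []")
      case True
      then have "take t xs = xs" by simp
      then show ?thesis using t j False by (auto simp: is_cut_def ltr_maxima_snoc split: if_splits)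
    next
      case F: False
      have "avoids231 (take t xs @ drop t xs @ [x])" using snoc.prems(1) by (metis append.assoc append_take_drop_id)
      then show ?thesis using avoids231_cross[of "take t xs" "drop t xs" "[x]"] t F
        by (metis hd_in_set is_cut_def list.set_intros(1))
    qed
    then have "is_cut (xs @ [x]) j t" using t by (auto simp: is_cut_def)
    then show ?thesis by blast
  qed
qed (auto simp: is_cut_def)

text \<open>The entries between two cuts exceed everything before them, so they would contribute a
  further maximum.\<close>

lemma cut_unique_aux: "is_cut xs j t \<Longrightarrow> is_cut xs j t' \<Longrightarrow> t \<le> t' \<Longrightarrow> t = t'"
proof (rule ccontr)
  assume a: "is_cut xs j t" "is_cut xs j t'" "t \<le> t'" "t \<noteq> t'"
  define d where "d = take (t' - t) (drop t xs)"
  have e: "take t' xs = take t xs @ d" using a(3) unfolding d_def by (metis le_add_diff_inverse take_add)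
  have "d \<noteq> []" using a unfolding d_def is_cut_def by auto
  moreover have "set d \<subseteq> set (drop t xs)" unfolding d_def by (rule set_take_subset)
  then have "ltr_maxima (take t' xs) = ltr_maxima (take t xs) + ltr_maxima d"
    unfolding e using a(1) by (intro ltr_maxima_append) (auto simp: is_cut_def)
  ultimately show False using a ltr_maxima_pos[of d] by (auto simp: is_cut_def)
qed

lemma cut_unique: "is_cut xs j t \<Longrightarrow> is_cut xs j t' \<Longrightarrow> t = t'"
  using cut_unique_aux by (metis nat_le_linear)

definition cut :: "nat list \<Rightarrow> nat \<Rightarrow> nat" where
  "cut xs j = (THE t. is_cut xs j t)"

lemma cutI: "is_cut xs j t \<Longrightarrow> cut xs j = t"
  unfolding cut_def using cut_unique by blast

lemma initial_segment:
  fixes X Y :: "nat set"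
  assumes "X \<union> Y = {1..N}" "\<forall>x\<in>X. \<forall>y\<in>Y. x < y"
    and c: "card X = c"
  shows "X = {1..c}"
proof -
  have f: "finite X" using assms(1) by (metis finite_Un finite_atLeastAtMost)
  have "X \<subseteq> {1..card X}"
  proof
    fix x assume x: "x \<in> X"
    have "{1..x} \<subseteq> X"
    proof
      fix y assume y: "y \<in> {1..x}"
      have "x \<in> {1..N}" using assms(1) x by blast
      then have "y \<in> X \<union> Y" using assms(1) y by auto
      then show "y \<in> X" using assms(2) x y by (metis UnE atLeastAtMost_iff not_le)
    qed
    then have "card {1..x} \<le> card X" using f card_mono by blast
    moreover have "x \<ge> 1" using x assms(1) by auto
    ultimately show "x \<in> {1..card X}" by simp
  qed
  then show ?thesis unfolding c[symmetric] by (intro card_subset_eq) auto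
qed

lemma is_cut_set:
  assumes "is_cut xs j t" "distinct xs" "set xs = {1..length xs}"
  shows "set (take t xs) = {1..t}" "set (drop t xs) = {t<..length xs}"
proof -
  have u: "set (take t xs) \<union> set (drop t xs) = {1..length xs}"
    using assms(3) by (metis append_take_drop_id set_append)
  have "card (set (take t xs)) = t" using assms by (simp add: distinct_card is_cut_def)
  then show t: "set (take t xs) = {1..t}"
    using initial_segment[OF u] assms(1) by (auto simp: is_cut_def)
  have dj: "set (take t xs) \<inter> set (drop t xs) = {}" using assms(2) set_take_disj_set_drop_if_distinct by blast
  then have "set (drop t xs) = (set (take t xs) \<union> set (drop t xs)) - set (take t xs)" by blast
  also have "\<dots> = {1..length xs} - {1..t}" unfolding u unfolding t ..
  also have "{1..length xs} - {1..t} = {t<..length xs}" by auto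
  finally show "set (drop t xs) = {t<..length xs}" .
qed

section \<open>Joining two permutations at a new maximum\<close>

text \<open>\<open>lmap\<close> and \<open>rmap\<close> relabel permutations of \<open>{1..a}\<close> and \<open>{1..b}\<close> so that \<open>{1..<a}\<close> comes first,
  then the \<open>t\<close> smallest values of the second one, then the maximum of the first one, then the rest.
  For \<open>a = 0\<close> they are used with \<open>t = 0\<close> only, which makes the truncated \<open>a - 1\<close> harmless.\<close>

definition lmap :: "nat \<Rightarrow> nat \<Rightarrow> nat \<Rightarrow> nat" where
  "lmap a t x = (if x = a then a + t else x)"

definition rmap :: "nat \<Rightarrow> nat \<Rightarrow> nat \<Rightarrow> nat" where
  "rmap a t x = (if x \<le> t then a - 1 + x else a + x)"

definition join :: "nat list \<Rightarrow> nat list \<Rightarrow> nat \<Rightarrow> nat list" where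
  "join L R t = map (lmap (length L) t) L @ (length L + length R + 1) # map (rmap (length L) t) R"

lemma lmap_mono: "strict_mono_on {1..a} (lmap a t)"
  by (auto simp: strict_mono_on_def lmap_def)

lemma rmap_mono: "a = 0 \<longrightarrow> t = 0 \<Longrightarrow> strict_mono_on {1..b} (rmap a t)"
  by (auto simp: strict_mono_on_def rmap_def)

fun tree_perm :: "tree \<Rightarrow> nat list" where
  "tree_perm Leaf = []"
| "tree_perm (Node l r j) = join (tree_perm l) (tree_perm r) (cut (stack_sort (tree_perm r)) j)"

fun preds :: "nat list \<Rightarrow> nat set" where
  "preds [] = {}"
| "preds (x # xs) = preds xs \<union> (if \<exists>y\<in>set xs. Suc y = x then {x} else {})"

lemma preds_sub: "preds xs \<subseteq> set xs" by (induction xs) auto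

lemma preds_append: "preds (xs @ ys) = preds xs \<union> preds ys \<union> {a \<in> set xs. \<exists>y\<in>set ys. Suc y = a}"
  by (induction xs) auto

lemma preds_map: "\<forall>x\<in>set xs. f x = c + x \<Longrightarrow> preds (map f xs) = (\<lambda>x. c + x) ` preds xs"
proof (induction xs)
  case (Cons x xs)
  then have "(\<exists>y\<in>set (map f xs). Suc y = f x) = (\<exists>y\<in>set xs. Suc y = x)" by force
  then show ?case using Cons by auto
qed simp

lemma preds_iff: "a \<in> preds b \<longleftrightarrow> (\<exists>i j. i < j \<and> j < length b \<and> b ! i = a \<and> b ! j + 1 = a)"
proof (induction b)
  case (Cons x xs)
  have "(\<exists>i j. i < j \<and> j < length (x # xs) \<and> (x # xs) ! i = a \<and> (x # xs) ! j + 1 = a) \<longleftrightarrow>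
    (\<exists>j. j < length xs \<and> x = a \<and> xs ! j + 1 = a) \<or> (\<exists>i j. i < j \<and> j < length xs \<and> xs ! i = a \<and> xs ! j + 1 = a)"
    (is "?L = ?R")
  proof
    assume ?L
    then obtain i j where "i < j" "j < length (x # xs)" "(x # xs) ! i = a" "(x # xs) ! j + 1 = a" by blast
    then show ?R by (cases i; cases j) auto
  next
    assume ?R
    then show ?L
    proof (elim disjE exE conjE)
      fix j assume "j < length xs" "x = a" "xs ! j + 1 = a"
      then show ?L by (intro exI[of _ 0] exI[of _ "Suc j"]) auto
    next
      fix i j assume "i < j" "j < length xs" "xs ! i = a" "xs ! j + 1 = a"
      then show ?L by (intro exI[of _ "Suc i"] exI[of _ "Suc j"]) auto
    qed
  qed
  moreover have "(\<exists>j. j < length xs \<and> x = a \<and> xs ! j + 1 = a) \<longleftrightarrow> x = a \<and> (\<exists>y\<in>set xs. Suc y = a)"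
    by (auto simp: in_set_conv_nth)
  ultimately show ?case using Cons by auto
qed simp

lemma precedes_pred_count_preds: "precedes_pred_count b = card (preds b)"
proof -
  have "{a. \<exists>i j. i < j \<and> j < length b \<and> b ! i = a \<and> b ! j + 1 = a} = preds b"
    using preds_iff by blast
  then show ?thesis by (simp add: precedes_pred_count_def)
qed

lemma finite_preds[simp]: "finite (preds xs)" using preds_sub finite_subset by blast

text \<open>The data of one node: \<open>t\<close> and \<open>j\<close> describe the same cut, by
  position and by number of maxima. If \<open>L\<close> is empty there is no maximum to serve as
  threshold, whence the last assumption.\<close>

locale gluing =
  fixes L R :: "nat list" and t j :: nat
  assumes L: "sortable L" and R: "sortable R" and cut: "is_cut (stack_sort R) j t" and t0: "L = [] \<longrightarrow> t = 0"
begin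

abbreviation "a \<equiv> length L"
abbreviation "b \<equiv> length R"
abbreviation "f \<equiv> lmap a t"
abbreviation "g \<equiv> rmap a t"
abbreviation "fS \<equiv> map f (stack_sort L)"
abbreviation "gS \<equiv> map g (stack_sort R)"
abbreviation "us \<equiv> take t (stack_sort R)"
abbreviation "vs \<equiv> drop t (stack_sort R)"

lemma dL: "distinct L" "set L = {1..a}" and dR: "distinct R" "set R = {1..b}"
  using L R unfolding sortable_def is_perm_def by auto

lemma fmono: "strict_mono_on (set L) f" using lmap_mono dL by metis
lemma gmono: "strict_mono_on (set R) g" using rmap_mono dR t0 by simp

lemma tb: "t \<le> b" using cut dR unfolding is_cut_def by simp

lemma us: "set us = {1..t}" and vs: "set vs = {t<..b}"
  using is_cut_set[OF cut] dR by simp_all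

lemma SR: "stack_sort R = us @ vs" by simp

lemma join_perm: "is_perm (join L R t)"
proof -
  have fl: "set (map f L) \<subseteq> {1..<a} \<union> {a + t}" using dL by (auto simp: lmap_def)
  have gr: "set (map g R) \<subseteq> {a..<a+t} \<union> {a+t<..a+b}" using dR t0 by (cases a) (auto simp: rmap_def)
  have "distinct (map f L)" "distinct (map g R)"
    using dL dR fmono gmono by (simp_all add: distinct_map strict_mono_on_imp_inj_on)
  moreover have "({1..<a} \<union> {a + t}) \<inter> ({a..<a+t} \<union> {a+t<..a+b}) = {}" by auto
  then have "set (map f L) \<inter> set (map g R) = {}" using fl gr by blast
  ultimately have d: "distinct (join L R t)" using fl gr tb unfolding join_def by auto
  have "set (join L R t) \<subseteq> {1..a+b+1}"
  proof
    fix x assume "x \<in> set (join L R t)"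
    then consider "x \<in> set (map f L)" | "x = a + b + 1" | "x \<in> set (map g R)" unfolding join_def by auto
    then show "x \<in> {1..a+b+1}"
    proof cases
      case 1 then show ?thesis using dL tb by (auto simp: lmap_def)
    next
      case 3 then show ?thesis using dR tb by (auto simp: rmap_def)
    qed simp
  qed
  moreover have "card (set (join L R t)) = a + b + 1" using distinct_card[OF d] by (simp add: join_def)
  ultimately have "set (join L R t) = {1..a+b+1}" by (intro card_subset_eq) auto
  then show ?thesis using d unfolding is_perm_def by (simp add: join_def)
qed

lemma f_less: "x \<in> set L \<Longrightarrow> f x < a + b + 1" using dL tb by (auto simp: lmap_def)
lemma g_less: "x \<in> set R \<Longrightarrow> g x < a + b + 1" using dR tb by (auto simp: rmap_def)

lemma join_sort: "stack_sort (join L R t) = fS @ gS @ [a + b + 1]"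
  unfolding join_def using f_less g_less dL dR fmono gmono
  by (subst stack_sort_max) (auto simp: stack_sort_map)

text \<open>Sorting moves the maximum of \<open>L\<close> to the end, and this is the only entry
  changed by the relabelling.\<close>

lemma SL: "L \<noteq> [] \<Longrightarrow> \<exists>ys. stack_sort L = ys @ [a] \<and> set ys = {1..<a} \<and> fS = ys @ [a + t]"
proof -
  assume n: "L \<noteq> []"
  then obtain ys m where ys: "stack_sort L = ys @ [m]" "\<forall>y\<in>set ys. y < m"
    using stack_sort_last dL by blast
  have s: "set ys \<union> {m} = {1..a}" using ys(1) dL by (metis Un_insert_right list.simps(15) list.set(1) set_append set_stack_sort)
  then have "m = a"
  proof -
    have "a \<in> set ys \<union> {m}" "m \<le> a" using s n by (auto simp: Suc_le_eq)
    then show ?thesis using ys(2) by auto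
  qed
  moreover have "set ys = {1..<a}"
    using s ys(2) \<open>m = a\<close> by (metis (no_types, lifting) Diff_insert_absorb Un_insert_right atLeastLessThan_eq_atLeastAtMost_diff less_irrefl sup_bot_right)
  moreover have "map f ys = ys" using \<open>set ys = {1..<a}\<close> by (auto intro!: map_idI simp: lmap_def)
  ultimately show ?thesis using ys by (intro exI[of _ ys]) (auto simp: lmap_def)
qed

lemma gus: "set (map g us) = {a - 1 + x | x. x \<in> {1..t}}" and gvs: "set (map g vs) = {a + x | x. x \<in> {t<..b}}"
proof -
  have "g ` {1..t} = (\<lambda>x. a - 1 + x) ` {1..t}" by (intro image_cong) (auto simp: rmap_def)
  then show "set (map g us) = {a - 1 + x | x. x \<in> {1..t}}" unfolding set_map us by blast
  have "g ` {t<..b} = (\<lambda>x. a + x) ` {t<..b}" by (intro image_cong) (auto simp: rmap_def)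
  then show "set (map g vs) = {a + x | x. x \<in> {t<..b}}" unfolding set_map vs by blast
qed

text \<open>After sorting, the entries of the first part other than \<open>a + t\<close> lie below
  the whole second part, and \<open>a + t\<close> separates the values of the second part exactly at
  the cut.\<close>

lemma join_good: "sortable (join L R t)"
proof -
  have avR: "avoids231 gS" using avoids231_map gmono dR R unfolding sortable_def by simp
  have "avoids231 (fS @ gS)"
  proof (cases "L = []")
    case False
    then obtain ys where ys: "stack_sort L = ys @ [a]" "set ys = {1..<a}" "fS = ys @ [a + t]"
      using SL by blast
    have "avoids231 ys" using L ys avoids231_mid[of ys a "[]"] unfolding sortable_def by simp
    moreover have "splits (a + t) (map g us @ map g vs)"
      unfolding splits_iff using gus gvs False
      by (intro exI[of _ "map g us"] exI[of _ "map g vs"]) (auto simp: Suc_le_eq)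
    moreover have "\<forall>x\<in>set ys. \<forall>y\<in>set gS. x < y" using ys dR by (auto simp: rmap_def)
    ultimately have "avoids231 (ys @ (a + t) # gS)"
      using avR ys by (subst avoids231_mid) (auto simp: map_append[symmetric])
    then show ?thesis using ys by simp
  qed (use avR in simp)
  moreover have "\<forall>x\<in>set (fS @ gS). x < a + b + 1"
    using f_less g_less dL dR by auto
  ultimately have "avoids231 ((fS @ gS) @ [a + b + 1])"
    by (subst avoids231_mid) auto
  then show ?thesis using join_perm join_sort unfolding sortable_def by simp
qed

lemma ltr_R: "ltr_maxima (stack_sort R) = j + ltr_maxima vs"
  using ltr_maxima_append[of us vs] cut unfolding is_cut_def by simp

text \<open>The \<open>j\<close> maxima of the second part before the cut are hidden by the entry
  \<open>a + t\<close>; those after the cut survive, and the final maximum adds one.\<close>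

lemma join_ltr: "ltr_maxima (stack_sort (join L R t)) = ltr_maxima (stack_sort L) + ltr_maxima (stack_sort R) + 1 - j"
proof -
  have "\<forall>x\<in>set (fS @ gS). x < a + b + 1"
    using f_less g_less dL dR by auto
  then have 1: "ltr_maxima (stack_sort (join L R t)) = ltr_maxima (fS @ gS) + 1"
    unfolding join_sort using ltr_maxima_snoc[of "fS @ gS"] by simp
  have 2: "ltr_maxima fS = ltr_maxima (stack_sort L)"
    "ltr_maxima (map g vs) = ltr_maxima vs"
  proof -
    show "ltr_maxima fS = ltr_maxima (stack_sort L)" using ltr_maxima_map fmono dL by simp
    have "set vs \<subseteq> set R" using set_drop_subset[of t "stack_sort R"] dR by simp
    then have "strict_mono_on (set vs) g" using gmono by (auto simp: strict_mono_on_def)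
    then show "ltr_maxima (map g vs) = ltr_maxima vs" by (rule ltr_maxima_map)
  qed
  show ?thesis
  proof (cases "L = []")
    case True
    then have "j = 0" using t0 cut unfolding is_cut_def by simp
    then show ?thesis using 1 True ltr_maxima_map[of "stack_sort R" g] gmono dR by simp
  next
    case False
    then obtain ys where ys: "stack_sort L = ys @ [a]" "set ys = {1..<a}" "fS = ys @ [a + t]"
      using SL by blast
    have "fS @ gS = (fS @ map g us) @ map g vs"
      using SR by (metis append.assoc map_append)
    moreover have "ltr_maxima ((fS @ map g us) @ map g vs)
       = ltr_maxima (fS @ map g us) + ltr_maxima (map g vs)"
      using ys(2,3) gus gvs by (intro ltr_maxima_append) auto
    moreover have "ltr_maxima (fS @ map g us) = ltr_maxima fS"
      using ys(3) gus False by (intro ltr_maxima_append_small[of "a + t"]) (auto simp: Suc_le_eq)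
    ultimately show ?thesis using 1 2 ltr_R by simp
  qed
qed

text \<open>Each part keeps its own pairs, and the only possible new one starts at
  \<open>a + t\<close>: the value \<open>a + t - 1\<close> comes after it exactly when
  \<open>t > 0\<close>. For \<open>t = 0\<close> that value, if positive, is in the first part and
  comes earlier.\<close>

lemma join_preds: "precedes_pred_count (stack_sort (join L R t)) =
   precedes_pred_count (stack_sort L) + precedes_pred_count (stack_sort R) + (if j = 0 then 0 else 1)"
proof -
  have "length us = t" using tb dR by simp
  then have jt: "j = 0 \<longleftrightarrow> t = 0" using cut ltr_maxima_pos[of us] unfolding is_cut_def by (cases "t = 0") fastforce+
  have n: "preds (xs @ [a + b + 1]) = preds xs" if "\<forall>x\<in>set xs. x < a + b + 1" for xs
    using that by (auto simp: preds_append)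
  have "\<forall>x\<in>set (fS @ gS). x < a + b + 1"
    using f_less g_less dL dR by auto
  then have 1: "preds (stack_sort (join L R t)) = preds (fS @ gS)"
    unfolding join_sort using n[of "fS @ gS"] by simp
  have e: "{x \<in> set us. \<exists>y\<in>set vs. Suc y = x} = {}" using us vs by auto
  have pR: "preds (stack_sort R) = preds us \<union> preds vs" using preds_append[of us vs] e by simp
  have e': "{x \<in> set (map g us). \<exists>y\<in>set (map g vs). Suc y = x} = {}" using gus gvs by auto
  have gR: "gS = map g us @ map g vs" using SR by (metis map_append)
  have p1: "preds (map g us) = (\<lambda>x. a - 1 + x) ` preds us"
    using us by (intro preds_map) (auto simp: rmap_def)
  have p2: "preds (map g vs) = (\<lambda>x. a + x) ` preds vs"
    using vs by (intro preds_map) (auto simp: rmap_def)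
  have pgR: "preds gS = (\<lambda>x. a - 1 + x) ` preds us \<union> (\<lambda>x. a + x) ` preds vs"
    unfolding gR preds_append e' p1 p2 by simp
  have du: "preds us \<subseteq> {1..t}" "preds vs \<subseteq> {t<..b}" using us vs preds_sub by blast+
  have cR: "card (preds (stack_sort R)) = card (preds us) + card (preds vs)"
  proof -
    have "{1..t} \<inter> {t<..b} = {}" by auto
    then have "preds us \<inter> preds vs = {}" using du by blast
    then show ?thesis unfolding pR by (simp add: card_Un_disjoint)
  qed
  have cgR: "card (preds gS) = card (preds us) + card (preds vs)"
  proof -
    have "card ((\<lambda>x. a - 1 + x) ` preds us \<union> (\<lambda>x. a + x) ` preds vs) =
       card ((\<lambda>x. a - 1 + x) ` preds us) + card ((\<lambda>x. a + x) ` preds vs)"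
      using du by (intro card_Un_disjoint) fastforce+
    then show ?thesis unfolding pgR by (simp add: card_image)
  qed
  show ?thesis
  proof (cases "L = []")
    case True
    then show ?thesis using 1 cR cgR jt t0 by (simp add: precedes_pred_count_preds)
  next
    case False
    then obtain ys where ys: "stack_sort L = ys @ [a]" "set ys = {1..<a}" "fS = ys @ [a + t]"
      using SL by blast
    have pL: "preds (stack_sort L) = preds ys" "preds fS = preds ys"
    proof -
      have "preds (ys @ [c]) = preds ys" if "a \<le> c" for c using that ys(2) by (auto simp: preds_append)
      from this[of a] this[of "a + t"]
      show "preds (stack_sort L) = preds ys" "preds fS = preds ys"
        by (simp_all only: ys(1) ys(3)[unfolded ys(1)] le_add1 order_refl)
    qed
    have gR2: "set gS \<subseteq> {a..<a+t} \<union> {a+t<..}" using dR False by (cases a) (auto simp: rmap_def)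
    have cross: "{x \<in> set fS. \<exists>y\<in>set gS. Suc y = x} = (if t = 0 then {} else {a + t})"
    proof -
      have "t > 0 \<Longrightarrow> g t \<in> set gS \<and> Suc (g t) = a + t"
        using dR tb False by (auto simp: rmap_def)
      then have B: "(\<exists>y\<in>set gS. Suc y = a + t) \<longleftrightarrow> t \<noteq> 0"
        using gR2 by (cases "t = 0") (fastforce, blast)
      have "\<forall>x\<in>set ys. \<forall>y\<in>set gS. Suc y \<noteq> x"
      proof (intro ballI)
        fix x y assume "x \<in> set ys" "y \<in> set gS"
        then have "x < a" "a \<le> y" using ys(2) gR2 by fastforce+
        then show "Suc y \<noteq> x" by simp
      qed
      then have "{x \<in> set (ys @ [a + t]). \<exists>y\<in>set gS. Suc y = x}
        = (if \<exists>y\<in>set gS. Suc y = a + t then {a + t} else {})" by auto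
      then show ?thesis unfolding ys(3) B by simp
    qed
    have all: "preds (stack_sort (join L R t)) = (preds ys \<union> preds gS) \<union> (if t = 0 then {} else {a + t})"
      unfolding 1 preds_append cross pL(2) ..
    have py: "preds ys \<subseteq> {1..<a}" using ys preds_sub by blast
    have pg: "preds gS \<subseteq> {a..<a+t} \<union> {a+t<..}" using gR2 preds_sub by blast
    have "card (preds ys \<union> preds gS) = card (preds ys) + card (preds gS)"
    proof -
      have "{1..<a} \<inter> ({a..<a+t} \<union> {a+t<..}) = {}" by auto
      then have "preds ys \<inter> preds gS = {}" using py pg by blast
      then show ?thesis by (simp add: card_Un_disjoint)
    qed
    moreover have "a + t \<notin> {1..<a}" "a + t \<notin> {a..<a+t} \<union> {a+t<..}" by auto
    then have "a + t \<notin> preds ys \<union> preds gS" using py pg by blast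
    ultimately have "card (preds (stack_sort (join L R t))) = card (preds ys) + card (preds gS) + (if t = 0 then 0 else 1)"
      unfolding all by (cases "t = 0") simp_all
    then show ?thesis using pL cR cgR jt by (simp add: precedes_pred_count_preds)
  qed
qed

end


lemma adj_map: "strict_mono_on (set xs) f \<Longrightarrow>
   adj (<) (map f xs) = adj (<) xs \<and> adj (>) (map f xs) = adj (>) (xs :: nat list)"
  for f :: "nat \<Rightarrow> nat"
proof (induction xs)
  case (Cons x xs)
  show ?case
  proof (cases xs)
    case xs: (Cons y ys)
    have "strict_mono_on (set xs) f" using Cons.prems by (auto simp: strict_mono_on_def)
    moreover have "(f x < f y) = (x < y)" "(f y < f x) = (y < x)"
      using Cons.prems xs strict_mono_on_less[of "set (x # xs)" f] by auto
    ultimately show ?thesis using Cons.IH xs by simp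
  qed simp
qed simp

lemma adj_count: "adj P xs = card {i. Suc i < length xs \<and> P (xs ! i) (xs ! Suc i)}"
proof (induction P xs rule: adj.induct)
  case (1 P x y xs)
  let ?A = "{i. Suc i < length (y # xs) \<and> P ((y # xs) ! i) ((y # xs) ! Suc i)}"
  have "{i. Suc i < length (x # y # xs) \<and> P ((x # y # xs) ! i) ((x # y # xs) ! Suc i)} = (if P x y then {0} else {}) \<union> Suc ` ?A"
    (is "?B = _")
  proof (intro equalityI subsetI)
    fix i assume "i \<in> ?B"
    then show "i \<in> (if P x y then {0} else {}) \<union> Suc ` ?A" by (cases i) auto
  qed (auto split: if_splits)
  moreover have "finite ?A" by simp
  ultimately show ?case using 1 by (auto simp: card_image)
qed auto

lemma ascents_adj: "ascents p = adj (<) p" and descents_adj: "descents p = adj (>) p"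
  by (simp_all add: ascents_def descents_def adj_count)

context gluing begin

lemma join_ascents: "ascents (join L R t) = ascents L + ascents R + (if L = [] then 0 else 1)"
  and join_descents: "descents (join L R t) = descents L + descents R + (if R = [] then 0 else 1)"
proof -
  have 1: "L \<noteq> [] \<Longrightarrow> f (last L) < a + b + 1" "R \<noteq> [] \<Longrightarrow> g (hd R) < a + b + 1"
    using f_less g_less by simp_all
  have 2: "adj (<) (map f L) = adj (<) L" "adj (>) (map f L) = adj (>) L"
    "adj (<) (map g R) = adj (<) R" "adj (>) (map g R) = adj (>) R"
    using adj_map fmono gmono by blast+
  have 3: "adj P (x # map g R) = adj P (map g R) + (if R \<noteq> [] \<and> P x (g (hd R)) then 1 else 0)" for P x
    by (cases R) auto
  show "ascents (join L R t) = ascents L + ascents R + (if L = [] then 0 else 1)"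
    unfolding ascents_adj join_def adj_append 3 2 using 1
    by (cases "L = []"; cases "R = []") (simp_all add: last_map)
  show "descents (join L R t) = descents L + descents R + (if R = [] then 0 else 1)"
    unfolding descents_adj join_def adj_append 3 2 using 1
    by (cases "L = []"; cases "R = []") (simp_all add: last_map)
qed

end

section \<open>Permutations coded by trees\<close>

lemma sortable_Nil: "sortable []" by (simp add: sortable_def is_perm_def)

lemma sortable_distinct: "sortable p \<Longrightarrow> distinct p \<and> set p = {1..length p}"
  by (simp add: sortable_def is_perm_def)

lemma tree_perm_eq_Nil: "tree_perm T = [] \<longleftrightarrow> T = Leaf"
  by (cases T) (auto simp: join_def)

lemma gluing_cut:
  assumes "sortable L" "sortable R" "j \<le> ltr_maxima (stack_sort R)" "L = [] \<longrightarrow> j = 0"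
  shows "gluing L R (cut (stack_sort R) j) j"
proof -
  have "avoids231 (stack_sort R)" "distinct (stack_sort R)" using assms(2) sortable_distinct by (auto simp: sortable_def)
  then obtain t where t: "is_cut (stack_sort R) j t" using ex_cut assms(3) by blast
  then have c: "cut (stack_sort R) j = t" by (rule cutI)
  \<comment> \<open>Without any maximum before it, the cut is at the very beginning; this is what an
    empty \<open>L\<close> requires.\<close>
  have "j = 0 \<Longrightarrow> t = 0"
  proof -
    assume "j = 0"
    then have "is_cut (stack_sort R) j 0" by (simp add: is_cut_def)
    then show "t = 0" using t cut_unique by blast
  qed
  then show ?thesis unfolding c using assms t by unfold_locales auto
qed

lemma tree_perm_good: "valid T \<Longrightarrow> sortable (tree_perm T) \<and> ltr_maxima (stack_sort (tree_perm T)) = ltr_t T"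
proof (induction T)
  case Leaf
  then show ?case by (simp add: sortable_Nil)
next
  case (Node l r j)
  then have "gluing (tree_perm l) (tree_perm r) (cut (stack_sort (tree_perm r)) j) j"
    by (intro gluing_cut) (auto simp: tree_perm_eq_Nil)
  then show ?case using Node gluing.join_good gluing.join_ltr by simp
qed

lemma tree_perm_gluing: "valid (Node l r j) \<Longrightarrow> gluing (tree_perm l) (tree_perm r) (cut (stack_sort (tree_perm r)) j) j"
  using tree_perm_good[of r] tree_perm_good[of l] by (intro gluing_cut) (auto simp: tree_perm_eq_Nil)

lemma tree_perm_stats: "valid T \<Longrightarrow> ascents (tree_perm T) = asc_t T \<and> descents (tree_perm T) = des_t T \<and>
    precedes_pred_count (stack_sort (tree_perm T)) = inv_t T"
proof (induction T)
  case Leaf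
  then show ?case by (simp add: ascents_def descents_def precedes_pred_count_def)
next
  case (Node l r j)
  note G = tree_perm_gluing[OF Node.prems]
  show ?case using Node gluing.join_ascents[OF G] gluing.join_descents[OF G] gluing.join_preds[OF G]
    by (simp add: tree_perm_eq_Nil)
qed

text \<open>The maximum separates the two relabelled parts. The first part contains the value
  \<open>a + t\<close>, which gives back \<open>t\<close>, and for a known \<open>t\<close> both
  relabellings are injective.\<close>

lemma join_inj:
  assumes G: "gluing L R t j" and G': "gluing L' R' t' j'" and e: "join L R t = join L' R' t'"
  shows "L = L' \<and> R = R' \<and> t = t' \<and> j = j'"
proof -
  interpret A: gluing L R t j by (rule G)
  interpret B: gluing L' R' t' j' by (rule G')
  have len: "length L + length R = length L' + length R'"
    using arg_cong[OF e, of length] by (simp add: join_def)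
  have "A.a + A.b + 1 \<notin> set (map A.f L)" "A.a + A.b + 1 \<notin> set (map A.g R)"
    using A.f_less A.g_less by fastforce+
  from append_Cons_eq_iff[OF this, of "map B.f L'" "map B.g R'"]
  have m: "map A.f L = map B.f L'" "map A.g R = map B.g R'"
    using e len by (auto simp: join_def)
  have la: "A.a = B.a" "A.b = B.b" using arg_cong[OF m(1), of length] arg_cong[OF m(2), of length] by auto
  have t: "t = t'"
  proof (cases "A.a = 0")
    case True then show ?thesis using A.t0 B.t0 la by simp
  next
    case False
    then have "A.a \<in> set L" "set L' = {1..A.a}" using A.dL B.dL la by auto
    then have "A.a + t \<in> set (map B.f L')" using m(1) by (metis imageI lmap_def set_map)
    then show ?thesis using \<open>set L' = {1..A.a}\<close> la by (auto simp: lmap_def split: if_splits)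
  qed
  have "inj_on A.f {1..A.a}" using lmap_mono strict_mono_on_imp_inj_on by blast
  then have L: "L = L'" using m(1) A.dL B.dL la t
    by (metis inj_on_map_eq_map inf_sup_absorb sup.idem)
  have "A.a = 0 \<longrightarrow> t = 0" using A.t0 by simp
  then have "inj_on A.g {1..A.b}" by (rule strict_mono_on_imp_inj_on[OF rmap_mono])
  then have R: "R = R'" using m(2) A.dR B.dR la t
    by (metis inj_on_map_eq_map inf_sup_absorb sup.idem)
  show ?thesis using L R t A.cut B.cut by (simp add: is_cut_def)
qed

lemma tree_perm_inj: "valid T \<Longrightarrow> valid T' \<Longrightarrow> tree_perm T = tree_perm T' \<Longrightarrow> T = T'"
proof (induction T arbitrary: T')
  case Leaf
  then show ?case using tree_perm_eq_Nil by metis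
next
  case (Node l r j)
  have "T' \<noteq> Leaf" using Node.prems tree_perm_eq_Nil by (metis tree.distinct(1))
  then obtain l' r' j' where T': "T' = Node l' r' j'" by (cases T') auto
  have "tree_perm l = tree_perm l' \<and> tree_perm r = tree_perm r' \<and> cut (stack_sort (tree_perm r)) j = cut (stack_sort (tree_perm r')) j' \<and> j = j'"
    using join_inj[OF tree_perm_gluing[OF Node.prems(1)] tree_perm_gluing[OF Node.prems(2)[unfolded T']]] Node.prems(3) T' by simp
  then show ?case using Node T' by auto
qed

text \<open>One pass turns the list into \<open>ys\<close>, \<open>n\<close>, \<open>us\<close>,
  \<open>vs\<close> and the maximum, with \<open>n\<close> the maximum of \<open>A\<close>.
  Avoidance of 231 puts \<open>ys\<close> below \<open>B\<close>, and \<open>n\<close> between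
  \<open>us\<close> and \<open>vs\<close>. So the values of \<open>ys\<close>, \<open>us\<close>,
  \<open>n\<close>, \<open>vs\<close> fill consecutive intervals in this order, known from
  \<open>a\<close>, \<open>b\<close> and the length \<open>t\<close> of \<open>us\<close>.\<close>

lemma join_surj:
  assumes p: "sortable p" "p \<noteq> []"
  shows "\<exists>L R t j. gluing L R t j \<and> p = join L R t"
proof -
  have dp: "distinct p" "set p = {1..length p}" using p sortable_distinct by auto
  obtain A m B where pe: "p = A @ m # B" "\<forall>x\<in>set A. x < m" "\<forall>x\<in>set B. x < m"
    using max_split p dp by blast
  define a b where ab: "a = length A" "b = length B"
  have "m = Max (set p)" using pe by (intro Max_eqI[symmetric]) auto
  moreover have "Max {1..length p} = length p" using p by (intro Max_eqI) (auto simp: Suc_le_eq)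
  ultimately have m: "m = a + b + 1" using dp pe ab by simp
  have d: "distinct A" "distinct B" "set A \<inter> set B = {}" using dp pe by auto
  have AB: "set A \<union> set B = {1..a+b}"
  proof -
    have "set A \<union> set B = set p - {m}" using pe by auto
    also have "\<dots> = {1..a+b}" unfolding dp(2) using pe m ab by auto
    finally show ?thesis .
  qed
  have "avoids231 ((stack_sort A @ stack_sort B) @ m # [])"
    using p pe by (simp add: sortable_def stack_sort_max)
  then have avoids231: "avoids231 (stack_sort A @ stack_sort B)" using pe d by (subst (asm) avoids231_mid) auto
  show ?thesis
  proof (cases "A = []")
    case True
    have "sortable B" using True AB d avoids231 ab by (simp add: sortable_def is_perm_def)
    then have "gluing [] B 0 0" using sortable_Nil by unfold_locales (auto simp: is_cut_def)
    moreover have "p = join [] B 0"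
    proof -
      have "map (rmap 0 0) B = B" using AB True by (auto intro!: map_idI simp: rmap_def)
      then show ?thesis using pe True m ab by (simp add: join_def)
    qed
    ultimately show ?thesis by blast
  next
    case False
    obtain ys n where ys: "stack_sort A = ys @ [n]" "\<forall>y\<in>set ys. y < n" using stack_sort_last d False by blast
    have A: "set A = insert n (set ys)" using ys(1) d(1) by (metis Un_insert_right list.simps(15) list.set(1) set_append set_stack_sort sup_bot_right)
    have "avoids231 (ys @ n # stack_sort B)" using avoids231 ys by simp
    then have c: "avoids231 ys" "avoids231 (stack_sort B)" "splits n (stack_sort B)" "\<forall>x\<in>set ys. \<forall>y\<in>set B. x < y"
      using avoids231_mid[of ys n "stack_sort B"] ys d by auto
    obtain us vs where uv: "stack_sort B = us @ vs" "\<forall>u\<in>set us. u < n" "\<forall>v\<in>set vs. n < v"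
      using c(3) splits_iff by blast
    have B: "set B = set us \<union> set vs" using uv(1) d(2) by (metis set_append set_stack_sort)
    have dys: "distinct ys" "n \<notin> set ys" "length ys = a - 1" using ys d ab
      by (metis distinct_append distinct_stack_sort, fastforce, metis butlast_snoc length_butlast length_stack_sort)
    have duv: "distinct us" "distinct vs" using uv d(2) by (metis distinct_append distinct_stack_sort)+
    define t where "t = length us"
    have a0: "a > 0" using False ab by simp
    have i: "{1..a - 1 + c} = {1..<a + c}" for c
      using a0 by (cases a) (simp_all add: atLeastLessThanSuc_atLeastAtMost)
    have sys: "set ys = {1..<a}"
    proof -
      have "card (set ys) = a - 1" using dys distinct_card by metis
      moreover have "set ys \<union> insert n (set B) = {1..a+b}" using AB unfolding A by blast
      moreover have "\<forall>x\<in>set ys. \<forall>y\<in>insert n (set B). x < y" using c(4) ys(2) by auto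
      ultimately have "set ys = {1..a - 1}" by (rule initial_segment[rotated 2])
      then show ?thesis using i[of 0] by simp
    qed
    have su: "set ys \<union> set us = {1..<a+t}"
    proof -
      have "set ys \<inter> set us = {}" using A B d(3) by auto
      then have "card (set ys \<union> set us) = a - 1 + t"
        using dys duv by (simp add: card_Un_disjoint distinct_card t_def)
      moreover have "(set ys \<union> set us) \<union> insert n (set vs) = {1..a+b}" using AB unfolding A B by blast
      moreover have "\<forall>x\<in>set ys \<union> set us. \<forall>y\<in>insert n (set vs). x < y"
        using c(4) ys(2) uv unfolding B by (auto intro: less_trans)
      ultimately have "set ys \<union> set us = {1..a - 1 + t}" by (rule initial_segment[rotated 2])
      then show ?thesis unfolding i .
    qed
    have sun: "insert n (set ys \<union> set us) = {1..a+t}"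
    proof -
      have "n \<notin> set ys \<union> set us" using ys(2) uv by auto
      then have "card (insert n (set ys \<union> set us)) = Suc (card (set ys \<union> set us))" by simp
      then have "card (insert n (set ys \<union> set us)) = a + t" using a0 unfolding su by simp
      moreover have "insert n (set ys \<union> set us) \<union> set vs = {1..a+b}" using AB unfolding A B by blast
      moreover have "\<forall>x\<in>insert n (set ys \<union> set us). \<forall>y\<in>set vs. x < y"
        using c(4) ys(2) uv unfolding B by (auto intro: less_trans)
      ultimately show ?thesis by (rule initial_segment[rotated 2])
    qed
    have n: "n = a + t" 
    proof -
      have "a + t \<in> insert n (set ys \<union> set us)" unfolding sun using a0 by simp
      then show ?thesis unfolding su by auto
    qed
    have us: "set us = {a..<a+t}"
    proof -
      have "set us = (set ys \<union> set us) - set ys" using A B d(3) by auto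
      also have "\<dots> = {a..<a+t}" unfolding su unfolding sys using a0 by auto
      finally show ?thesis .
    qed
    have vs: "set vs = {a+t<..a+b}"
    proof -
      have "set us \<inter> set vs = {}" "set A \<inter> set vs = {}" using uv d B by fastforce+
      then have "set vs = (set A \<union> set B) - insert n (set ys \<union> set us)" using A B by auto
      also have "\<dots> = {a+t<..a+b}" unfolding AB sun by auto
      finally show ?thesis .
    qed
    have tb: "t \<le> b" using uv(1) d(2) ab unfolding t_def by (metis le_add1 length_append length_stack_sort)
    \<comment> \<open>\<open>h\<close> and \<open>k\<close> invert \<open>lmap a t\<close> and
      \<open>rmap a t\<close> on the values occurring in \<open>A\<close> and
      \<open>B\<close>.\<close>
    define h where "h x = (if x = a + t then a else x)" for x
    define k where "k x = (if x < a + t then x - (a - 1) else x - a)" for x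
    have sA: "set A = insert (a + t) {1..<a}" using A sys n by simp
    have sB: "set B = {a..<a+t} \<union> {a+t<..a+b}" using B us vs by simp
    have hm: "strict_mono_on (set A) h" unfolding sA by (auto simp: strict_mono_on_def h_def)
    have km: "strict_mono_on (set B) k" unfolding sB using a0 by (auto simp: strict_mono_on_def k_def)
    define L R where LR: "L = map h A" "R = map k B"
    have lL: "length L = a" and lR: "length R = b" using LR ab by auto
    have SL: "stack_sort L = map h (stack_sort A)" and SR: "stack_sort R = map k (stack_sort B)"
      using LR stack_sort_map d hm km by auto
    have "set L = {1..a}" unfolding LR set_map sA using a0 by (auto simp: h_def)
    moreover have "distinct L" using LR hm d by (simp add: distinct_map strict_mono_on_imp_inj_on)
    moreover have "avoids231 (stack_sort A)" using ys c avoids231_mid[of ys n "[]"] by simp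
    then have "avoids231 (stack_sort L)" using SL avoids231_map hm d by simp
    ultimately have gL: "sortable L" using lL by (simp add: sortable_def is_perm_def)
    have ku: "k ` {a..<a+t} = {1..t}"
    proof -
      have "k ` {a..<a+t} = (\<lambda>x. x - (a - 1)) ` {a..<a+t}" by (intro image_cong) (auto simp: k_def)
      also have "\<dots> = {1..t}"
      proof (intro equalityI subsetI)
        fix x assume "x \<in> {1..t}"
        then have "x = (x + (a - 1)) - (a - 1)" "x + (a - 1) \<in> {a..<a+t}" using a0 by auto
        then show "x \<in> (\<lambda>x. x - (a - 1)) ` {a..<a+t}" by blast
      qed (use a0 in auto)
      finally show ?thesis .
    qed
    have kv: "k ` {a+t<..a+b} = {t<..b}"
    proof -
      have "k ` {a+t<..a+b} = (\<lambda>x. x - a) ` {a+t<..a+b}" by (intro image_cong) (auto simp: k_def)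
      also have "\<dots> = {t<..b}"
      proof (intro equalityI subsetI)
        fix x assume "x \<in> {t<..b}"
        then have "x = (x + a) - a" "x + a \<in> {a+t<..a+b}" by auto
        then show "x \<in> (\<lambda>x. x - a) ` {a+t<..a+b}" by blast
      qed auto
      finally show ?thesis .
    qed
    have "set R = {1..t} \<union> {t<..b}" unfolding LR set_map sB image_Un ku kv ..
    then have "set R = {1..b}" using tb by auto
    moreover have "distinct R" using LR km d by (simp add: distinct_map strict_mono_on_imp_inj_on)
    moreover have "avoids231 (stack_sort R)" using SR avoids231_map km d c(2) by simp
    ultimately have gR: "sortable R" using lR by (simp add: sortable_def is_perm_def)
    have td: "take t (stack_sort R) = map k us" "drop t (stack_sort R) = map k vs"
      using SR uv(1) t_def by simp_all
    have cut: "is_cut (stack_sort R) (ltr_maxima (map k us)) t"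
      unfolding is_cut_def td set_map us vs ku kv using gR lR tb sortable_distinct by auto
    have "gluing L R t (ltr_maxima (map k us))"
      using gL gR cut lL a0 by unfold_locales auto
    moreover have "p = join L R t"
    proof -
      have "map (lmap a t) L = A"
        using sA unfolding LR map_map by (intro map_idI) (auto simp: lmap_def h_def)
      moreover have "map (rmap a t) R = B"
        using sB a0 unfolding LR map_map by (intro map_idI) (auto simp: rmap_def k_def)
      ultimately show ?thesis using pe m lL lR by (simp add: join_def)
    qed
    ultimately show ?thesis by blast
  qed
qed

lemma tree_perm_surj: "sortable p \<Longrightarrow> \<exists>T. valid T \<and> tree_perm T = p"
proof (induction p rule: length_induct)
  case (1 p)
  show ?case
  proof (cases "p = []")
    case True
    then show ?thesis by (intro exI[of _ Leaf]) simp
  next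
    case False
    obtain L R t j where G: "gluing L R t j" and p: "p = join L R t" using join_surj 1 False by blast
    interpret gluing L R t j by (rule G)
    have "length L < length p" "length R < length p" using p by (auto simp: join_def)
    then obtain l r where l: "valid l" "tree_perm l = L" and r: "valid r" "tree_perm r = R" using 1 L R by blast
    have "j \<le> ltr_t r" using ltr_R tree_perm_good[OF r(1)] r by simp
    moreover have "l = Leaf \<longrightarrow> j = 0" using l t0 cut by (auto simp: is_cut_def)
    ultimately have "valid (Node l r j)" using l r by simp
    moreover have "tree_perm (Node l r j) = p" using l r p cutI[OF cut] by simp
    ultimately show ?thesis by blast
  qed
qed

section \<open>Fish and their boundaries\<close>

fun adjacent :: "'a list \<Rightarrow> ('a \<times> 'a) set" where
  "adjacent (x # y # xs) = insert (x, y) (adjacent (y # xs))"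
| "adjacent _ = {}"

lemma adjacent_append: "adjacent (xs @ ys) = adjacent xs \<union> adjacent ys \<union> (if xs = [] \<or> ys = [] then {} else {(last xs, hd ys)})"
proof (induction xs)
  case (Cons x xs)
  then show ?case by (cases xs; cases ys) auto
qed simp

lemma adjacent_mid: "M \<noteq> [] \<Longrightarrow> adjacent (us @ M @ vs) = adjacent us \<union> adjacent M \<union> adjacent vs \<union>
   (if us = [] then {} else {(last us, hd M)}) \<union> (if vs = [] then {} else {(last M, hd vs)})"
  by (auto simp: adjacent_append)

lemma adjacent_sub: "adjacent xs \<subseteq> set xs \<times> set xs"
  by (induction xs rule: adjacent.induct) auto

lemma adjacent_iff: "(a, b) \<in> adjacent xs \<longleftrightarrow> (\<exists>us vs. xs = us @ [a, b] @ vs)"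
proof
  show "(a, b) \<in> adjacent xs \<Longrightarrow> \<exists>us vs. xs = us @ [a, b] @ vs"
  proof (induction xs rule: adjacent.induct)
    case (1 x y xs)
    show ?case
    proof (cases "(a, b) = (x, y)")
      case True
      then show ?thesis by (intro exI[of _ "[]"] exI[of _ xs]) simp
    next
      case False
      then obtain us vs where "y # xs = us @ [a, b] @ vs" using 1 by auto
      then show ?thesis by (intro exI[of _ "x # us"] exI[of _ vs]) simp
    qed
  qed auto
qed (auto simp: adjacent_append)

lemma adjacent_nth: "Suc i < length xs \<Longrightarrow> (xs ! i, xs ! Suc i) \<in> adjacent xs"
proof (induction xs arbitrary: i rule: adjacent.induct)
  case (1 x y xs)
  then show ?case by (cases i) auto
qed auto

lemma adjacent_fun: "distinct xs \<Longrightarrow> (a, b) \<in> adjacent xs \<Longrightarrow> (a, c) \<in> adjacent xs \<Longrightarrow> b = c"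
  using adjacent_sub by (induction xs rule: adjacent.induct) fastforce+

lemma adjacent_hd: "distinct (x # xs) \<Longrightarrow> (y, x) \<notin> adjacent (x # xs)"
  using adjacent_sub[of xs] by (cases xs) auto

lemma adjacent_inj: "distinct xs \<Longrightarrow> (a, c) \<in> adjacent xs \<Longrightarrow> (b, c) \<in> adjacent xs \<Longrightarrow> a = b"
proof (induction xs rule: adjacent.induct)
  case (1 x y xs)
  then have "(z, y) \<notin> adjacent (y # xs)" for z by (intro adjacent_hd) simp
  then show ?case using 1 by auto
qed auto

lemma adjacent_asym: "distinct xs \<Longrightarrow> (a, b) \<in> adjacent xs \<Longrightarrow> (b, a) \<notin> adjacent xs"
proof (induction xs rule: adjacent.induct)
  case (1 x y xs)
  then show ?case using adjacent_sub[of "y # xs"] by auto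
qed auto

lemma adj_nb: "distinct xs \<Longrightarrow> adj P xs = card {(a, b) \<in> adjacent xs. P a b}"
proof (induction P xs rule: adj.induct)
  case (1 P x y xs)
  have "{(a, b) \<in> adjacent (x # y # xs). P a b} = (if P x y then {(x, y)} else {}) \<union> {(a, b) \<in> adjacent (y # xs). P a b}"
    by auto
  moreover have "(x, y) \<notin> adjacent (y # xs)" using 1(2) adjacent_sub[of "y # xs"] by auto
  moreover have "finite {(a, b) \<in> adjacent (y # xs). P a b}"
    using finite_subset[of "{(a, b) \<in> adjacent (y # xs). P a b}" "set (y # xs) \<times> set (y # xs)"] adjacent_sub[of "y # xs"] by auto
  ultimately show ?case using 1 by auto
qed auto

lemma adj_map_snd: "adj P (map h xs) = adj (\<lambda>a b. P (h a) (h b)) xs"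
  by (induction "\<lambda>a b. P (h a) (h b)" xs rule: adj.induct) auto

section \<open>Fish together with their list of free edges\<close>

text \<open>A fish built on an arbitrary set of cell labels, together with the list of its free edges
  in counter-clockwise order from the nose. In the second rule the new cell \<open>n\<close> is glued to the
  upper right edge of \<open>x\<close> if \<open>xo = Some x\<close> and to the lower right edge of \<open>y\<close> if \<open>yo = Some y\<close>.\<close>

definition old_edge :: "side \<Rightarrow> nat option \<Rightarrow> (nat \<times> side) list" where
  "old_edge s xo = (case xo of None \<Rightarrow> [] | Some x \<Rightarrow> [(x, s)])"

definition new_edge :: "side \<Rightarrow> nat \<Rightarrow> nat option \<Rightarrow> (nat \<times> side) list" where
  "new_edge s n xo = (case xo of None \<Rightarrow> [(n, s)] | Some x \<Rightarrow> [])"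

abbreviation "old_edges xo yo \<equiv> old_edge UR xo @ old_edge LR yo"
abbreviation "new_edges n xo yo \<equiv> new_edge LL n xo @ [(n, LR), (n, UR)] @ new_edge UL n yo"

definition upd :: "(nat \<Rightarrow> nat option) \<Rightarrow> nat option \<Rightarrow> nat \<Rightarrow> nat \<Rightarrow> nat option" where
  "upd u xo n = (case xo of None \<Rightarrow> u | Some x \<Rightarrow> u(x := Some n))"

lemmas oe_simps[simp] = old_edge_def[of _ None, simplified] old_edge_def[of _ "Some x" for x, simplified]
  new_edge_def[of _ _ None, simplified] new_edge_def[of _ _ "Some x" for x, simplified]
  upd_def[of _ None, simplified] upd_def[of _ "Some x" for x, simplified]

inductive fish_on :: "nat set \<Rightarrow> (nat \<Rightarrow> nat option) \<Rightarrow> (nat \<Rightarrow> nat option) \<Rightarrow> (nat \<times> side) list \<Rightarrow> bool" where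
  head: "fish_on {0} (\<lambda>_. None) (\<lambda>_. None) [(0, LL), (0, LR), (0, UR), (0, UL)]"
| glue: "fish_on C u l (us @ old_edges xo yo @ vs) \<Longrightarrow> xo \<noteq> None \<or> yo \<noteq> None \<Longrightarrow> n \<notin> C \<Longrightarrow>
    fish_on (insert n C) (upd u xo n) (upd l yo n)
      (us @ new_edges n xo yo @ vs)"

lemma fish_on_fw: "fish_on C u l es \<Longrightarrow> fish_word (map snd es)"
proof (induction rule: fish_on.induct)
  case head
  then show ?case using fish_word.cell by simp
next
  case (glue C u l us xo yo vs n)
  show ?case using glue fish_word.up[of "map snd us" "map snd vs"] fish_word.down[of "map snd us" "map snd vs"]
      fish_word.both[of "map snd us" "map snd vs"] by (cases xo; cases yo) auto
qed

definition edge_inv where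
  "edge_inv C u l es \<longleftrightarrow> finite C \<and> 0 \<in> C \<and> distinct es \<and> (\<exists>es'. es = (0, LL) # es') \<and>
     (\<forall>x y. u x = Some y \<longrightarrow> x \<in> C \<and> y \<in> C) \<and> (\<forall>x y. l x = Some y \<longrightarrow> x \<in> C \<and> y \<in> C) \<and>
     (\<forall>x. (x, UR) \<in> set es \<longleftrightarrow> x \<in> C \<and> u x = None) \<and>
     (\<forall>x. (x, LR) \<in> set es \<longleftrightarrow> x \<in> C \<and> l x = None) \<and>
     (\<forall>y. (y, LL) \<in> set es \<longleftrightarrow> y \<in> C \<and> (\<forall>x. u x \<noteq> Some y)) \<and>
     (\<forall>y. (y, UL) \<in> set es \<longleftrightarrow> y \<in> C \<and> (\<forall>x. l x \<noteq> Some y))"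

lemma edge_inv_cell: "edge_inv C u l es \<Longrightarrow> (x, s) \<in> set es \<Longrightarrow> x \<in> C"
  unfolding edge_inv_def by (cases s) auto

lemma fish_on_edge_inv: "fish_on C u l es \<Longrightarrow> edge_inv C u l es"
proof (induction rule: fish_on.induct)
  case head
  then show ?case by (simp add: edge_inv_def)
next
  case (glue C u l us xo yo vs n)
  let ?es = "us @ old_edges xo yo @ vs"
  let ?es' = "us @ new_edges n xo yo @ vs"
  note I = glue.IH
  have nn: "(n, s) \<notin> set ?es" for s using edge_inv_cell[OF I] glue.hyps by blast
  have un: "u x \<noteq> Some n" "l x \<noteq> Some n" "u n = None" "l n = None" for x
    using I glue.hyps(3) unfolding edge_inv_def by (metis not_None_eq)+
  have hd: "\<exists>es'. ?es' = (0, LL) # es'"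
  proof -
    obtain es' where "?es = (0, LL) # es'" using I unfolding edge_inv_def by blast
    then have "us \<noteq> [] \<and> hd us = (0, LL)"
      using glue.hyps(2) by (cases us; cases xo; cases yo) auto
    then show ?thesis by (cases us) auto
  qed
  have d: "distinct ?es'"
    using I nn unfolding edge_inv_def by (cases xo; cases yo) auto
  have x: "x \<in> C \<and> u x = None \<and> (x, UR) \<notin> set us \<and> (x, UR) \<notin> set vs \<and> x \<noteq> n" if "xo = Some x" for x
    using I that glue.hyps(3) unfolding edge_inv_def by (cases yo) auto
  have y: "y \<in> C \<and> l y = None \<and> (y, LR) \<notin> set us \<and> (y, LR) \<notin> set vs \<and> y \<noteq> n" if "yo = Some y" for y
    using I that glue.hyps(3) unfolding edge_inv_def by (cases xo) auto
  have u': "upd u xo n z = (if xo = Some z then Some n else u z)" for z by (cases xo) auto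
  have l': "upd l yo n z = (if yo = Some z then Some n else l z)" for z by (cases yo) auto
  have se: "set ?es' =
     (set ?es - {e. \<exists>x. xo = Some x \<and> e = (x, UR)} - {e. \<exists>y. yo = Some y \<and> e = (y, LR)}) \<union>
     {(n, LR), (n, UR)} \<union> (if xo = None then {(n, LL)} else {}) \<union> (if yo = None then {(n, UL)} else {})"
    using x y by (cases xo; cases yo) auto
  have A: "finite C" "0 \<in> C" "\<And>x y. u x = Some y \<Longrightarrow> x \<in> C \<and> y \<in> C" "\<And>x y. l x = Some y \<Longrightarrow> x \<in> C \<and> y \<in> C"
    "\<And>x. (x, UR) \<in> set ?es \<longleftrightarrow> x \<in> C \<and> u x = None" "\<And>x. (x, LR) \<in> set ?es \<longleftrightarrow> x \<in> C \<and> l x = None"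
    "\<And>y. (y, LL) \<in> set ?es \<longleftrightarrow> y \<in> C \<and> (\<forall>x. u x \<noteq> Some y)" "\<And>y. (y, UL) \<in> set ?es \<longleftrightarrow> y \<in> C \<and> (\<forall>x. l x \<noteq> Some y)"
    using I unfolding edge_inv_def by blast+
  have LLn: "(\<forall>x. upd u xo n x \<noteq> Some n) \<longleftrightarrow> xo = None" unfolding u' using un by auto
  have ULn: "(\<forall>x. upd l yo n x \<noteq> Some n) \<longleftrightarrow> yo = None" unfolding l' using un by auto
  have LLo: "(\<forall>x. upd u xo n x \<noteq> Some y) \<longleftrightarrow> (\<forall>x. u x \<noteq> Some y)" if "y \<noteq> n" for y
    unfolding u' using x that by (metis option.distinct(1) option.inject)
  have ULo: "(\<forall>x. upd l yo n x \<noteq> Some z) \<longleftrightarrow> (\<forall>x. l x \<noteq> Some z)" if "z \<noteq> n" for z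
    unfolding l' using y that by (metis option.distinct(1) option.inject)
  show ?case unfolding edge_inv_def
  proof (intro conjI allI)
    fix z
    show "(z, UR) \<in> set ?es' \<longleftrightarrow>
       z \<in> insert n C \<and> upd u xo n z = None"
      unfolding se u' using A(5)[of z] nn[of UR] x un(3) by (cases "z = n") auto
    show "(z, LR) \<in> set ?es' \<longleftrightarrow>
       z \<in> insert n C \<and> upd l yo n z = None"
      unfolding se l' using A(6)[of z] nn[of LR] y un(4) by (cases "z = n") auto
    show "(z, LL) \<in> set ?es' \<longleftrightarrow>
       z \<in> insert n C \<and> (\<forall>x. upd u xo n x \<noteq> Some z)"
    proof (cases "z = n")
      case True
      then show ?thesis unfolding se using LLn nn[of LL] by auto
    next
      case False
      then show ?thesis unfolding se using LLo[OF False] A(7)[of z] by auto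
    qed
    show "(z, UL) \<in> set ?es' \<longleftrightarrow>
       z \<in> insert n C \<and> (\<forall>x. upd l yo n x \<noteq> Some z)"
    proof (cases "z = n")
      case True
      then show ?thesis unfolding se using ULn nn[of UL] by auto
    next
      case False
      then show ?thesis unfolding se using ULo[OF False] A(8)[of z] by auto
    qed
  next
    fix z w
    show "upd u xo n z = Some w \<longrightarrow> z \<in> insert n C \<and> w \<in> insert n C"
      unfolding u' using A(3) x by auto
    show "upd l yo n z = Some w \<longrightarrow> z \<in> insert n C \<and> w \<in> insert n C"
      unfolding l' using A(4) y by auto
  qed (use A d hd in auto)
qed

text \<open>The free edges just before and just after the right vertex of the cell \<open>a\<close> (if they are free).\<close>

definition edge_before :: "(nat \<Rightarrow> nat option) \<Rightarrow> nat \<Rightarrow> nat \<times> side" where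
  "edge_before l a = (case l a of None \<Rightarrow> (a, LR) | Some c \<Rightarrow> (c, UR))"
definition edge_after :: "(nat \<Rightarrow> nat option) \<Rightarrow> nat \<Rightarrow> nat \<times> side" where
  "edge_after u a = (case u a of None \<Rightarrow> (a, UR) | Some b \<Rightarrow> (b, LR))"

text \<open>Translates factors of the boundary into gluings around one cell. A factor
  \<open>LR UR\<close> consists of the two right edges of a tail cell; a factor \<open>UR LR\<close>
  comes from the two cells glued to the right of some \<open>a\<close>, so it is a place where
  \<open>add_c\<close> applies.\<close>

definition right_vertex_inv where
  "right_vertex_inv C u l es \<longleftrightarrow> (\<forall>e e'. (e, e') \<in> adjacent es \<and> snd e \<in> {LR, UR} \<and> snd e' \<in> {LR, UR} \<longleftrightarrow>
     (\<exists>a\<in>C. e = edge_before l a \<and> e' = edge_after u a \<and> e \<in> set es \<and> e' \<in> set es))"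

lemma fish_on_right_vertex_inv: "fish_on C u l es \<Longrightarrow> right_vertex_inv C u l es"
proof (induction rule: fish_on.induct)
  case head
  then show ?case unfolding right_vertex_inv_def by (auto simp: edge_before_def edge_after_def)
next
  case (glue C u l us xo yo vs n)
  let ?M = "old_edges xo yo"
  let ?N = "new_edges n xo yo"
  let ?u = "upd u xo n" let ?l = "upd l yo n"
  note I = fish_on_edge_inv[OF glue.hyps(1)]
  have J: "\<And>e e'. (e, e') \<in> adjacent (us @ ?M @ vs) \<Longrightarrow> snd e \<in> {LR, UR} \<Longrightarrow> snd e' \<in> {LR, UR} \<Longrightarrow>
     \<exists>a\<in>C. e = edge_before l a \<and> e' = edge_after u a"
    and J': "\<And>a. a \<in> C \<Longrightarrow> edge_before l a \<in> set (us @ ?M @ vs) \<Longrightarrow> edge_after u a \<in> set (us @ ?M @ vs) \<Longrightarrow> (edge_before l a, edge_after u a) \<in> adjacent (us @ ?M @ vs)"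
    using glue.IH unfolding right_vertex_inv_def by blast+
  have ds: "distinct (us @ ?M @ vs)" using I unfolding edge_inv_def by blast
  have nC: "n \<notin> C" by (rule glue.hyps)
  have M0: "?M \<noteq> []" using glue.hyps(2) by (cases xo; cases yo) auto
  have x: "u x = None" "(x, UR) \<in> set ?M" "x \<in> C" if "xo = Some x" for x
    using I that unfolding edge_inv_def by auto
  have y: "l y = None" "(y, LR) \<in> set ?M" "y \<in> C" if "yo = Some y" for y
    using I that unfolding edge_inv_def by auto
  have dM: "e \<in> set us \<union> set vs \<Longrightarrow> e \<notin> set ?M" for e using ds by auto
  have u': "?u z = (if xo = Some z then Some n else u z)" for z by (cases xo) auto
  have l': "?l z = (if yo = Some z then Some n else l z)" for z by (cases yo) auto
  have pr: "edge_before ?l a = edge_before l a" if "edge_before l a \<in> set us \<union> set vs" for a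
    using that dM y[of a] unfolding edge_before_def l' by (cases "yo = Some a") auto
  have nx: "edge_after ?u a = edge_after u a" if "edge_after u a \<in> set us \<union> set vs" for a
    using that dM x[of a] unfolding edge_after_def u' by (cases "xo = Some a") auto
  have un: "?u n = None" "?l n = None"
  proof -
    have "u n = None" "l n = None" using I nC unfolding edge_inv_def by (metis not_None_eq)+
    moreover have "xo \<noteq> Some n" "yo \<noteq> Some n" using x y nC by auto
    ultimately show "?u n = None" "?l n = None" unfolding u' l' by simp_all
  qed
  have nbM: "adjacent (us @ ?M @ vs) = adjacent us \<union> adjacent ?M \<union> adjacent vs \<union> (if us = [] then {} else {(last us, hd ?M)})
     \<union> (if vs = [] then {} else {(last ?M, hd vs)})"
    by (rule adjacent_mid[OF M0])
  have N0: "?N \<noteq> []" by simp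
  have nbN: "adjacent (us @ ?N @ vs) = adjacent us \<union> adjacent ?N \<union> adjacent vs \<union> (if us = [] then {} else {(last us, hd ?N)})
     \<union> (if vs = [] then {} else {(last ?N, hd vs)})"
    by (rule adjacent_mid[OF N0])
  have hdM: "hd ?M = (x, UR)" "hd ?N = (n, LR)" if "xo = Some x" for x using that by auto
  have lastM: "last ?M = (y, LR)" "last ?N = (n, UR)" if "yo = Some y" for y using that by (cases xo; auto)+
  have nxN: "edge_after u a \<noteq> (x, UR)" if "a \<noteq> x" for a x using that unfolding edge_after_def by (auto split: option.splits)
  have prN: "edge_before l a \<noteq> (y, LR)" if "a \<noteq> y" for a y using that unfolding edge_before_def by (auto split: option.splits)
  have P1: "\<exists>a\<in>insert n C. e = edge_before ?l a \<and> e' = edge_after ?u a"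
    if e: "(e, e') \<in> adjacent (us @ ?N @ vs)" "snd e \<in> {LR, UR}" "snd e' \<in> {LR, UR}" for e e'
  proof -
    from e(1) nbN consider "(e, e') \<in> adjacent us \<union> adjacent vs" | "(e, e') \<in> adjacent ?N" | "us \<noteq> []" "e = last us" "e' = hd ?N"
      | "vs \<noteq> []" "e = last ?N" "e' = hd vs" by (auto split: if_splits)
    then show ?thesis
    proof cases
      case 1
      then have "(e, e') \<in> adjacent (us @ ?M @ vs)" unfolding nbM by auto
      then obtain a where a: "a \<in> C" "e = edge_before l a" "e' = edge_after u a" using J e by blast
      have "e \<in> set us \<union> set vs" "e' \<in> set us \<union> set vs" using 1 adjacent_sub by fastforce+
      then have "e = edge_before ?l a" "e' = edge_after ?u a" using a pr[of a] nx[of a] by simp_all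
      then show ?thesis using a(1) by blast
    next
      case 2
      then have "e = (n, LR) \<and> e' = (n, UR)" using e by (cases xo; cases yo) auto
      then show ?thesis using un by (auto simp: edge_before_def edge_after_def)
    next
      case 3
      then obtain x where xx: "xo = Some x" using e by (cases xo) auto
      then have "(e, (x, UR)) \<in> adjacent (us @ ?M @ vs)" using 3 unfolding nbM by (auto simp: hdM)
      then obtain a where a: "a \<in> C" "e = edge_before l a" "(x, UR) = edge_after u a" using J e by fastforce
      then have "a = x" using nxN by metis
      moreover have "e \<in> set us" using 3 by simp
      ultimately show ?thesis using a 3 pr[of x] hdM[OF xx] xx by (intro bexI[of _ x]) (auto simp: edge_after_def)
    next
      case 4
      then obtain y where yy: "yo = Some y" using e by (cases yo) auto
      then have "((y, LR), e') \<in> adjacent (us @ ?M @ vs)" using 4 unfolding nbM by (auto simp: lastM)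
      then obtain a where a: "a \<in> C" "(y, LR) = edge_before l a" "e' = edge_after u a" using J e by fastforce
      then have "a = y" using prN by metis
      moreover have "e' \<in> set vs" using 4 by simp
      ultimately show ?thesis using a 4 nx[of y] lastM[OF yy] yy by (intro bexI[of _ y]) (auto simp: edge_before_def)
    qed
  qed
  have cell: "fst (edge_before l a) \<in> C" "fst (edge_after u a) \<in> C" if "a \<in> C" for a
    using I that unfolding edge_inv_def edge_before_def edge_after_def by (auto split: option.splits)
  have old: "e \<in> set (us @ ?N @ vs) \<Longrightarrow> fst e \<in> C \<Longrightarrow> e \<in> set us \<union> set vs" for e
    using nC by (cases xo; cases yo) auto
  have P2: "(edge_before ?l a, edge_after ?u a) \<in> adjacent (us @ ?N @ vs)"
    if a: "a \<in> insert n C" "edge_before ?l a \<in> set (us @ ?N @ vs)" "edge_after ?u a \<in> set (us @ ?N @ vs)" for a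
  proof (cases "a = n")
    case True
    then show ?thesis using un unfolding nbN by (cases xo; cases yo) (auto simp: edge_before_def edge_after_def)
  next
    case False
    then have aC: "a \<in> C" using a by blast
    consider "xo = Some a" "yo = Some a" | "xo = Some a" "yo \<noteq> Some a" | "xo \<noteq> Some a" "yo = Some a"
      | "xo \<noteq> Some a" "yo \<noteq> Some a" by blast
    then show ?thesis
    proof cases
      case 1
      \<comment> \<open>If both right edges of a cell are free, they are consecutive with
        \<open>LR\<close> first, whereas the edges covered by \<open>n\<close> come with
        \<open>UR\<close> first. So \<open>n\<close> is never glued to both right edges of one
        cell.\<close>
      then have "edge_before l a = (a, LR)" "edge_after u a = (a, UR)" using x y by (auto simp: edge_before_def edge_after_def)
      then have "((a, LR), (a, UR)) \<in> adjacent (us @ ?M @ vs)" using J'[OF aC] 1 by simp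
      moreover have "((a, UR), (a, LR)) \<in> adjacent (us @ ?M @ vs)" unfolding nbM using 1 by auto
      ultimately show ?thesis using adjacent_asym ds by metis
    next
      case 2
      then have p: "edge_before ?l a = edge_before l a" "edge_after u a = (a, UR)" "edge_after ?u a = (n, LR)" using x by (auto simp: edge_before_def edge_after_def l')
      then have pa: "edge_before l a \<in> set us \<union> set vs" using old a(2) cell(1)[OF aC] by simp
      then have "(edge_before l a, (a, UR)) \<in> adjacent (us @ ?M @ vs)" using J'[OF aC] p 2 by auto
      moreover have "us \<noteq> []"
      proof
        assume "us = []"
        then have "hd (us @ ?M @ vs) = (a, UR)" using 2 by simp
        then show False using I unfolding edge_inv_def by auto
      qed
      then have "(last us, (a, UR)) \<in> adjacent (us @ ?M @ vs)" unfolding nbM using hdM[OF 2(1)] by simp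
      ultimately have "edge_before l a = last us" using adjacent_inj ds by metis
      then show ?thesis unfolding nbN p using \<open>us \<noteq> []\<close> hdM[OF 2(1)] by simp
    next
      case 3
      then have p: "edge_after ?u a = edge_after u a" "edge_before l a = (a, LR)" "edge_before ?l a = (n, UR)" using y by (auto simp: edge_before_def edge_after_def u')
      then have pa: "edge_after u a \<in> set us \<union> set vs" using old a(3) cell(2)[OF aC] by simp
      then have "((a, LR), edge_after u a) \<in> adjacent (us @ ?M @ vs)" using J'[OF aC] p 3 by auto
      moreover have "vs \<noteq> []"
      proof
        assume "vs = []"
        then have "last (us @ ?M @ vs) = (a, LR)" using lastM[OF 3(2)] M0 by simp
        then have "last (map snd (us @ ?M @ vs)) = LR" using M0 by (subst last_map) auto
        then show False using word_hd_last[OF fish_on_fw[OF glue.hyps(1)]] by simp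
      qed
      then have "((a, LR), hd vs) \<in> adjacent (us @ ?M @ vs)" unfolding nbM using lastM[OF 3(2)] by simp
      ultimately have "edge_after u a = hd vs" using adjacent_fun ds by metis
      then show ?thesis unfolding nbN p using \<open>vs \<noteq> []\<close> lastM[OF 3(2)] by simp
    next
      case 4
      then have p: "edge_after ?u a = edge_after u a" "edge_before ?l a = edge_before l a" by (auto simp: edge_before_def edge_after_def u' l')
      then have pa: "edge_after u a \<in> set us \<union> set vs" "edge_before l a \<in> set us \<union> set vs" using old a cell[OF aC] by simp_all
      then have "(edge_before l a, edge_after u a) \<in> adjacent (us @ ?M @ vs)" using J'[OF aC] by auto
      moreover have "(edge_before l a, edge_after u a) \<notin> adjacent ?M" using adjacent_sub[of ?M] dM pa by blast
      moreover have "hd ?M \<in> set ?M" "last ?M \<in> set ?M" using M0 by (rule hd_in_set, rule last_in_set)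
      then have "edge_after u a \<noteq> hd ?M" "edge_before l a \<noteq> last ?M" using dM pa by metis+
      ultimately have "(edge_before l a, edge_after u a) \<in> adjacent us \<union> adjacent vs" unfolding nbM by (auto split: if_splits)
      then show ?thesis unfolding nbN p by auto
    qed
  qed
  show ?case unfolding right_vertex_inv_def
  proof (intro allI iffI)
    fix e e' assume "(e, e') \<in> adjacent (us @ ?N @ vs) \<and> snd e \<in> {LR, UR} \<and> snd e' \<in> {LR, UR}"
    then show "\<exists>a\<in>insert n C. e = edge_before ?l a \<and> e' = edge_after ?u a \<and> e \<in> set (us @ ?N @ vs) \<and> e' \<in> set (us @ ?N @ vs)"
      using P1[of e e'] adjacent_sub[of "us @ ?N @ vs"] by blast
  next
    fix e e' assume "\<exists>a\<in>insert n C. e = edge_before ?l a \<and> e' = edge_after ?u a \<and> e \<in> set (us @ ?N @ vs) \<and> e' \<in> set (us @ ?N @ vs)"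
    then obtain a where a: "a \<in> insert n C" "e = edge_before ?l a" "e' = edge_after ?u a" "e \<in> set (us @ ?N @ vs)" "e' \<in> set (us @ ?N @ vs)" by blast
    then have "(e, e') \<in> adjacent (us @ ?N @ vs)" using P2[of a] by simp
    moreover have "snd e \<in> {LR, UR}" "snd e' \<in> {LR, UR}"
      using a unfolding edge_before_def edge_after_def by (auto split: option.splits)
    ultimately show "(e, e') \<in> adjacent (us @ ?N @ vs) \<and> snd e \<in> {LR, UR} \<and> snd e' \<in> {LR, UR}" by blast
  qed
qed

section \<open>Vertices of the glued surface\<close>

definition corner_glue :: "(nat \<Rightarrow> nat option) \<Rightarrow> (nat \<Rightarrow> nat option) \<Rightarrow> nat \<times> corner \<Rightarrow> nat \<times> corner \<Rightarrow> bool" where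
  "corner_glue u l p q \<longleftrightarrow> (\<exists>x y. u x = Some y \<and> (p = (x, CR) \<and> q = (y, CB) \<or> p = (x, CT) \<and> q = (y, CL))) \<or>
     (\<exists>x y. l x = Some y \<and> (p = (x, CB) \<and> q = (y, CL) \<or> p = (x, CR) \<and> q = (y, CT)))"

definition same_vert :: "(nat \<Rightarrow> nat option) \<Rightarrow> (nat \<Rightarrow> nat option) \<Rightarrow> nat \<times> corner \<Rightarrow> nat \<times> corner \<Rightarrow> bool" where
  "same_vert u l = (\<lambda>p q. corner_glue u l p q \<or> corner_glue u l q p)\<^sup>*\<^sup>*"

text \<open>\<open>vt\<close> chooses one corner in each class, so that two corners can be shown to
  be different vertices. The distinctness condition says that a vertex of the boundary starts only
  one free edge, which makes the walk along the boundary deterministic.\<close>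

definition vertex_map where
  "vertex_map C u l es vt \<longleftrightarrow> (\<forall>x\<in>C. \<forall>c. fst (vt (x, c)) \<in> C \<and> same_vert u l (x, c) (vt (x, c))) \<and>
     (\<forall>p q. corner_glue u l p q \<longrightarrow> vt p = vt q) \<and>
     distinct (map (vt \<circ> edge_start) es) \<and>
     (\<forall>(e, e') \<in> adjacent es. vt (edge_end e) = vt (edge_start e'))"

lemma same_vert_mono: "same_vert u l p q \<Longrightarrow> (\<And>p q. corner_glue u l p q \<Longrightarrow> corner_glue u' l' p q) \<Longrightarrow> same_vert u' l' p q"
proof -
  assume a: "same_vert u l p q" and m: "\<And>p q. corner_glue u l p q \<Longrightarrow> corner_glue u' l' p q"
  have "(\<lambda>p q. corner_glue u l p q \<or> corner_glue u l q p) \<le> (\<lambda>p q. corner_glue u' l' p q \<or> corner_glue u' l' q p)"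
    using m by blast
  then show ?thesis using a rtranclp_mono unfolding same_vert_def by blast
qed

lemma same_vert_step: "corner_glue u l p q \<or> corner_glue u l q p \<Longrightarrow> same_vert u l q r \<Longrightarrow> same_vert u l p r"
  unfolding same_vert_def by (rule converse_rtranclp_into_rtranclp)

lemma same_vert_refl: "same_vert u l p p"
  unfolding same_vert_def by simp

lemma edge_fst[simp]: "fst (edge_start e) = fst e" "fst (edge_end e) = fst e"
  by (cases e rule: edge_start.cases; simp)+

lemma fish_on_vmap: "fish_on C u l es \<Longrightarrow> \<exists>vt. vertex_map C u l es vt"
proof (induction rule: fish_on.induct)
  case head
  show ?case by (intro exI[of _ id]) (auto simp: vertex_map_def corner_glue_def same_vert_refl)
next
  case (glue C u l us xo yo vs n)
  let ?M = "old_edges xo yo"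
  let ?N = "new_edges n xo yo"
  let ?u = "upd u xo n" let ?l = "upd l yo n"
  obtain vt where V: "vertex_map C u l (us @ ?M @ vs) vt" using glue.IH by blast
  note I = fish_on_edge_inv[OF glue.hyps(1)]
  have nC: "n \<notin> C" by (rule glue.hyps)
  have M0: "?M \<noteq> []" using glue.hyps(2) by (cases xo; cases yo) auto
  have x: "u x = None" "x \<in> C" "x \<noteq> n" if "xo = Some x" for x
    using I that nC unfolding edge_inv_def by auto
  have y: "l y = None" "y \<in> C" "y \<noteq> n" if "yo = Some y" for y
    using I that nC unfolding edge_inv_def by auto
  have ulC: "\<And>x y. u x = Some y \<Longrightarrow> x \<noteq> n \<and> y \<noteq> n" "\<And>x y. l x = Some y \<Longrightarrow> x \<noteq> n \<and> y \<noteq> n"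
    using I nC unfolding edge_inv_def by blast+
  have u': "?u z = (if xo = Some z then Some n else u z)" for z by (cases xo) auto
  have l': "?l z = (if yo = Some z then Some n else l z)" for z by (cases yo) auto
  \<comment> \<open>A corner of \<open>n\<close> on a glued edge takes over the vertex of the
    neighbouring cell; the other corners, always including the right one, are new vertices.\<close>
  define nv where "nv c = (case c of CR \<Rightarrow> (n, CR)
      | CB \<Rightarrow> (case xo of Some x \<Rightarrow> vt (x, CR) | None \<Rightarrow> (n, CB))
      | CT \<Rightarrow> (case yo of Some y \<Rightarrow> vt (y, CR) | None \<Rightarrow> (n, CT))
      | CL \<Rightarrow> (case xo of Some x \<Rightarrow> vt (x, CT) | None \<Rightarrow> (case yo of Some y \<Rightarrow> vt (y, CB) | None \<Rightarrow> (n, CL))))" for c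
  define vt' where "vt' p = (if fst p = n then nv (snd p) else vt p)" for p
  have V1: "\<And>x c. x \<in> C \<Longrightarrow> fst (vt (x, c)) \<in> C \<and> same_vert u l (x, c) (vt (x, c))"
    and V2: "\<And>p q. corner_glue u l p q \<Longrightarrow> vt p = vt q"
    and V3: "distinct (map (vt \<circ> edge_start) (us @ ?M @ vs))"
    and V4: "\<And>e e'. (e, e') \<in> adjacent (us @ ?M @ vs) \<Longrightarrow> vt (edge_end e) = vt (edge_start e')"
    using V unfolding vertex_map_def by blast+
  have ci: "corner_glue u l p q \<Longrightarrow> corner_glue ?u ?l p q" for p q
  proof -
    have "u a = Some b \<Longrightarrow> ?u a = Some b" "l a = Some b \<Longrightarrow> ?l a = Some b" for a b
      unfolding u' l' using x y by auto
    then show "corner_glue u l p q \<Longrightarrow> corner_glue ?u ?l p q" unfolding corner_glue_def by blast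
  qed
  \<comment> \<open>With two neighbours, the left corner of \<open>n\<close> inherits a vertex from
    each of them. They agree because the two covered edges are consecutive on the boundary.\<close>
  have cb: "vt (x, CT) = vt (y, CB)" if "xo = Some x" "yo = Some y" for x y
    using V4[of "(x, UR)" "(y, LR)"] that by (auto simp: adjacent_append)
  have sv: "x \<in> C \<Longrightarrow> same_vert ?u ?l (x, c) (vt (x, c))" for x c
    using V1 same_vert_mono[OF _ ci] by blast
  have W1: "fst (vt' (z, c)) \<in> insert n C \<and> same_vert ?u ?l (z, c) (vt' (z, c))" if "z \<in> insert n C" for z c
  proof (cases "z = n")
    case False
    then show ?thesis using that V1 sv by (auto simp: vt'_def)
  next
    case True
    have s1: "same_vert ?u ?l (n, CB) (vt (x, CR))" "same_vert ?u ?l (n, CL) (vt (x, CT))" if "xo = Some x" for x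
    proof -
      have "corner_glue ?u ?l (x, CR) (n, CB)" "corner_glue ?u ?l (x, CT) (n, CL)" using that unfolding corner_glue_def by auto
      then show "same_vert ?u ?l (n, CB) (vt (x, CR))" "same_vert ?u ?l (n, CL) (vt (x, CT))"
        using same_vert_step sv x that by blast+
    qed
    have s2: "same_vert ?u ?l (n, CL) (vt (y, CB))" "same_vert ?u ?l (n, CT) (vt (y, CR))" if "yo = Some y" for y
    proof -
      have "corner_glue ?u ?l (y, CB) (n, CL)" "corner_glue ?u ?l (y, CR) (n, CT)" using that unfolding corner_glue_def by auto
      then show "same_vert ?u ?l (n, CL) (vt (y, CB))" "same_vert ?u ?l (n, CT) (vt (y, CR))"
        using same_vert_step sv y that by blast+
    qed
    show ?thesis using True s1 s2 x y V1
      by (cases c; cases xo; cases yo) (simp_all add: vt'_def nv_def same_vert_refl)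
  qed
  have W2: "vt' p = vt' q" if "corner_glue ?u ?l p q" for p q
  proof (cases "corner_glue u l p q")
    case True
    then have "fst p \<noteq> n \<and> fst q \<noteq> n" unfolding corner_glue_def using ulC by fastforce
    then show ?thesis using V2 True by (simp add: vt'_def)
  next
    case False
    from that[unfolded corner_glue_def]
    consider x z where "?u x = Some z" "p = (x, CR) \<and> q = (z, CB) \<or> p = (x, CT) \<and> q = (z, CL)"
      | y z where "?l y = Some z" "p = (y, CB) \<and> q = (z, CL) \<or> p = (y, CR) \<and> q = (z, CT)" by blast
    then show ?thesis
    proof cases
      case 1
      have "u x \<noteq> Some z" using False 1(2) unfolding corner_glue_def by blast
      then have "xo = Some x" "z = n" using 1(1) unfolding u' by (auto split: if_splits)
      then show ?thesis using x[of x] 1(2) by (auto simp: vt'_def nv_def)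
    next
      case 2
      have "l y \<noteq> Some z" using False 2(2) unfolding corner_glue_def by blast
      then have "yo = Some y" "z = n" using 2(1) unfolding l' by (auto split: if_splits)
      then show ?thesis using y[of y] cb 2(2) by (cases xo) (auto simp: vt'_def nv_def)
    qed
  qed
  have old: "fst e \<noteq> n" "fst e \<in> C" if "e \<in> set us \<union> set ?M \<union> set vs" for e
    using that edge_inv_cell[OF I, of "fst e" "snd e"] nC by auto
  have eq: "vt' (edge_start e) = vt (edge_start e)" "vt' (edge_end e) = vt (edge_end e)" if "e \<in> set us \<union> set vs" for e
    using old[of e] that by (auto simp: vt'_def)
  have stC: "fst (vt (edge_start e)) \<in> C" if "e \<in> set us \<union> set ?M \<union> set vs" for e
    using V1[of "fst e" "snd (edge_start e)"] old(2)[OF that] by (metis edge_fst(1) prod.collapse)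
  have stn: "vt (edge_start e) \<noteq> (n, c)" if "e \<in> set us \<union> set vs" for e c
    using stC[of e] that nC by (metis UnE UnI1 UnI2 fst_conv)
  have stn2: "(n, c) \<notin> (\<lambda>x. vt (edge_start x)) ` set us" "(n, c) \<notin> (\<lambda>x. vt (edge_start x)) ` set vs" for c
    using stn by (metis UnI1 imageE, metis UnI2 imageE)
  have mp: "map (vt' \<circ> edge_start) us = map (vt \<circ> edge_start) us" "map (vt' \<circ> edge_start) vs = map (vt \<circ> edge_start) vs"
    using eq by auto
  have W3: "distinct (map (vt' \<circ> edge_start) (us @ ?N @ vs))"
  proof -
    have "distinct (map (vt \<circ> edge_start) us @ map (vt' \<circ> edge_start) ?N @ map (vt \<circ> edge_start) vs)"
    proof (cases xo)
      case None
      then obtain y where yy: "yo = Some y" using glue.hyps(2) by (cases yo) auto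
      have "vt (y, CB) \<noteq> (n, c)" for c using stC[of "(y, LR)"] yy nC by auto
      then show ?thesis using V3 None yy stn2 by (auto simp: vt'_def nv_def)
    next
      case (Some x)
      have "vt (x, CR) \<noteq> (n, c)" for c using stC[of "(x, UR)"] Some nC by auto
      then show ?thesis using V3 Some stn2 by (cases yo) (auto simp: vt'_def nv_def)
    qed
    then show ?thesis by (simp only: map_append mp)
  qed
  have nbM: "adjacent (us @ ?M @ vs) = adjacent us \<union> adjacent ?M \<union> adjacent vs \<union> (if us = [] then {} else {(last us, hd ?M)})
     \<union> (if vs = [] then {} else {(last ?M, hd vs)})"
    by (rule adjacent_mid[OF M0])
  have N0: "?N \<noteq> []" by simp
  have nbN: "adjacent (us @ ?N @ vs) = adjacent us \<union> adjacent ?N \<union> adjacent vs \<union> (if us = [] then {} else {(last us, hd ?N)})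
     \<union> (if vs = [] then {} else {(last ?N, hd vs)})"
    by (rule adjacent_mid[OF N0])
  have st: "vt' (edge_start (hd ?N)) = vt (edge_start (hd ?M))"
    using glue.hyps(2) by (cases xo; cases yo) (auto simp: vt'_def nv_def)
  have en: "vt' (edge_end (last ?N)) = vt (edge_end (last ?M))"
    using glue.hyps(2) by (cases xo; cases yo) (auto simp: vt'_def nv_def)
  have W4: "vt' (edge_end e) = vt' (edge_start e')" if e: "(e, e') \<in> adjacent (us @ ?N @ vs)" for e e'
  proof -
    from e nbN consider "(e, e') \<in> adjacent us \<union> adjacent vs" | "(e, e') \<in> adjacent ?N" | "us \<noteq> []" "e = last us" "e' = hd ?N"
      | "vs \<noteq> []" "e = last ?N" "e' = hd vs" by (auto split: if_splits)
    then show ?thesis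
    proof cases
      case 1
      then have "(e, e') \<in> adjacent (us @ ?M @ vs)" unfolding nbM by auto
      moreover have "e \<in> set us \<union> set vs" "e' \<in> set us \<union> set vs" using 1 adjacent_sub by fastforce+
      ultimately show ?thesis using V4 eq by simp
    next
      case 2
      then show ?thesis by (cases xo; cases yo) auto
    next
      case 3
      then have "(e, hd ?M) \<in> adjacent (us @ ?M @ vs)" unfolding nbM by simp
      then show ?thesis using V4 eq(2)[of e] 3 st by simp
    next
      case 4
      then have "(last ?M, e') \<in> adjacent (us @ ?M @ vs)" unfolding nbM by simp
      then show ?thesis using V4 eq(1)[of e'] 4 en by simp
    qed
  qed
  show ?case unfolding vertex_map_def using W1 W2 W3 W4 by (intro exI[of _ vt']) blast
qed

section \<open>Fish with equal boundary words are isomorphic\<close>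

lemma fish_on_length: "fish_on C u l es \<Longrightarrow> C = {0} \<and> length es = 4 \<or> length es \<ge> 6"
proof (induction rule: fish_on.induct)
  case (glue C u l us xo yo vs n)
  show ?case
  proof (cases "length (us @ old_edges xo yo @ vs) = 4")
    case True
    \<comment> \<open>The other two gluings add two free edges each, so only \<open>both\<close>
      could keep the length 4. It would need the word \<open>LL UR LR UL\<close>, which contains the
      forbidden factor \<open>LL UR\<close>.\<close>
    have "\<exists>xs ys. fish_word (xs @ [UR, LR] @ ys) \<and> length (xs @ [UR, LR] @ ys) = 4" if "xo \<noteq> None" "yo \<noteq> None"
      using fish_on_fw[OF glue.hyps(1)] True that
      by (intro exI[of _ "map snd us"] exI[of _ "map snd vs"]) auto
    moreover have "\<not> (fish_word (xs @ [UR, LR] @ ys) \<and> length (xs @ [UR, LR] @ ys) = 4)" for xs ys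
    proof
      assume a: "fish_word (xs @ [UR, LR] @ ys) \<and> length (xs @ [UR, LR] @ ys) = 4"
      have n: "xs \<noteq> []" "ys \<noteq> []" "hd xs = LL" "last ys = UL"
        using word_hd_last[of "xs @ [UR, LR] @ ys"] a by (cases xs; cases ys rule: rev_cases; auto)+
      then have "length xs = 1" "length ys = 1" using a by (cases xs; cases ys; auto)+
      then have "xs = [LL]" using n by (cases xs) auto
      then show False using word_no[of "[LL, UR, LR] @ ys" "[]" LL UR "LR # ys"] a by simp
    qed
    ultimately show ?thesis using glue True by (cases xo; cases yo) auto
  next
    case False
    then show ?thesis using glue.IH by (cases xo; cases yo) auto
  qed
qed simp

text \<open>Nothing is glued to a tail cell, so its gluing commutes with all later ones.\<close>

lemma fish_on_tail:
  assumes "fish_on C u l es" "es = us @ [(t, LR), (t, UR)] @ vs" "C \<noteq> {0}"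
  shows "\<exists>C0 u0 l0 us0 vs0 xo yo. fish_on C0 u0 l0 (us0 @ old_edges xo yo @ vs0) \<and>
    (xo \<noteq> None \<or> yo \<noteq> None) \<and> t \<notin> C0 \<and> C = insert t C0 \<and> u = upd u0 xo t \<and> l = upd l0 yo t \<and>
    us = us0 @ new_edge LL t xo \<and> vs = new_edge UL t yo @ vs0"
  using assms
proof (induction arbitrary: us vs rule: fish_on.induct)
  case (glue C u l us1 xo yo vs1 n)
  let ?M = "old_edges xo yo"
  let ?N = "new_edges n xo yo"
  note I = fish_on_edge_inv[OF glue.hyps(1)]
  note I' = fish_on_edge_inv[OF fish_on.glue[OF glue.hyps]]
  have dN: "distinct (us1 @ ?N @ vs1)" and dM: "distinct (us1 @ ?M @ vs1)" using I I' unfolding edge_inv_def by blast+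
  have nC: "n \<notin> C" by (rule glue.hyps)
  have M0: "?M \<noteq> []" using glue.hyps(2) by (cases xo; cases yo) auto
  have Msd: "(z, s) \<in> set ?M \<Longrightarrow> s = UR \<or> s = LR" for z s by (cases xo; cases yo) auto
  show ?case
  proof (cases "t = n")
    case True
    let ?A = "us1 @ new_edge LL n xo" let ?B = "new_edge UL n yo @ vs1"
    have e: "?A @ (n, LR) # ((n, UR) # ?B) = us @ (n, LR) # ((n, UR) # vs)" using glue.prems(1) True by simp
    have "(n, LR) \<notin> set ?A" "(n, LR) \<notin> set ((n, UR) # ?B)" using dN by auto
    from append_Cons_eq_iff[OF this, THEN iffD1, OF e] have AB: "?A = us" "?B = vs" by simp_all
    show ?thesis
      by (intro exI[of _ C] exI[of _ u] exI[of _ l] exI[of _ us1] exI[of _ vs1] exI[of _ xo] exI[of _ yo] conjI)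
        (use glue.hyps True AB in simp_all)
  next
    case False
    have nt: "(t, s) \<notin> set ?N" for s using False by (cases xo; cases yo) auto
    have eq: "us1 @ ?N @ vs1 = us @ (t, LR) # (t, UR) # vs" using glue.prems(1) by simp
    \<comment> \<open>A right edge of some cell is being covered, and this cell is not
      \<open>t\<close>, whose right edges both stay free.\<close>
    have C_ne: "C \<noteq> {0}" if "(t, LR) \<in> set us1 \<union> set vs1" "(t, UR) \<in> set us1 \<union> set vs1"
    proof
      assume C: "C = {0}"
      obtain x s where "(x, s) \<in> set ?M" "s = UR \<or> s = LR" using M0 Msd by (metis list.set_sel(1) surj_pair)
      moreover have "x \<in> C" "t \<in> C" using edge_inv_cell[OF I, of x s] edge_inv_cell[OF I, of t LR] calculation that by auto
      ultimately show False using dM C that by auto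
    qed
    \<comment> \<open>The two right edges of \<open>t\<close> are neighbours, so the edges of
      \<open>n\<close> lie entirely before or entirely after them.\<close>
    consider d where "us1 = us @ [(t, LR), (t, UR)] @ d" "vs = d @ ?N @ vs1"
      | d where "vs1 = d @ [(t, LR), (t, UR)] @ vs" "us = us1 @ ?N @ d"
    proof -
      have "\<exists>xs s. ?N = xs @ [(n, s)]" "\<exists>xs s. ?N = (n, s) # xs" by (cases xo; cases yo; auto)+
      then obtain xs s xs' s' where N: "?N = xs @ [(n, s)]" "?N = (n, s') # xs'" by blast
      from eq have "(t, LR) \<in> set us1 \<or> (t, LR) \<in> set vs1" using nt[of LR] by (metis UnE in_set_conv_decomp set_append)
      then show ?thesis
      proof
        assume "(t, LR) \<in> set us1"
        then obtain a1 a2 where a: "us1 = a1 @ (t, LR) # a2" by (meson split_list)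
        then have e: "a1 @ (t, LR) # (a2 @ ?N @ vs1) = us @ (t, LR) # (t, UR) # vs" using eq by simp
        have "(t, LR) \<notin> set a1" "(t, LR) \<notin> set (a2 @ ?N @ vs1)" using dN a by auto
        then have a1: "a1 = us" "a2 @ ?N @ vs1 = (t, UR) # vs" using e append_Cons_eq_iff[of "(t, LR)" a1 "a2 @ ?N @ vs1"] by auto
        have "a2 \<noteq> []" using a1(2)[unfolded N(2)] False by auto
        then obtain d where "a2 = (t, UR) # d" using a1(2) by (cases a2) auto
        then show ?thesis using that(1)[of d] a a1 by simp
      next
        assume "(t, LR) \<in> set vs1"
        then obtain b1 b2 where b: "vs1 = b1 @ (t, LR) # b2" by (meson split_list)
        then have e: "(us1 @ ?N @ b1) @ (t, LR) # b2 = us @ (t, LR) # (t, UR) # vs" using eq by simp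
        have "(t, LR) \<notin> set (us1 @ ?N @ b1)" "(t, LR) \<notin> set b2" using dN b by auto
        then have "us1 @ ?N @ b1 = us" "b2 = (t, UR) # vs" using e append_Cons_eq_iff[of "(t, LR)" "us1 @ ?N @ b1" b2] by blast+
        then show ?thesis using that(2)[of b1] b by simp
      qed
    qed
    then show ?thesis
    proof cases
      case 1
      have C0: "C \<noteq> {0}" using C_ne 1 by auto
      have "us1 @ ?M @ vs1 = us @ [(t, LR), (t, UR)] @ (d @ ?M @ vs1)" using 1 by simp
      from glue.IH[OF this C0] obtain C0 u0 l0 us0 vs0 xt yt where G:
        "fish_on C0 u0 l0 (us0 @ old_edges xt yt @ vs0)" "xt \<noteq> None \<or> yt \<noteq> None" "t \<notin> C0"
        "C = insert t C0" "u = upd u0 xt t" "l = upd l0 yt t" "us = us0 @ new_edge LL t xt"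
        "d @ ?M @ vs1 = new_edge UL t yt @ vs0" by blast
      obtain d0 where d0: "d = new_edge UL t yt @ d0"
      proof (cases yt)
        case None
        then have "d \<noteq> []" using G(8) M0 Msd[of t UL] by (cases ?M) auto
        then show ?thesis using that[of "tl d"] None G(8) by (cases d) auto
      qed (use that in simp)
      then have b0: "vs0 = d0 @ ?M @ vs1" using G(8) by simp
      have n0: "n \<notin> C0" using nC G(4) by blast
      have "fish_on C0 u0 l0 ((us0 @ old_edges xt yt @ d0) @ ?M @ vs1)" using G(1) b0 by simp
      from fish_on.glue[OF this glue.hyps(2) n0]
      have g1: "fish_on (insert n C0) (upd u0 xo n) (upd l0 yo n) (us0 @ old_edges xt yt @ (d0 @ ?N @ vs1))" by simp
      have dd: "distinct (us0 @ old_edges xt yt @ d0 @ ?M @ vs1)"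
        using fish_on_edge_inv[OF G(1)] b0 unfolding edge_inv_def by simp
      have ne: "xo \<noteq> xt \<or> xo = None" "yo \<noteq> yt \<or> yo = None" using dd by (cases xo; cases yo; cases xt; cases yt; auto)+
      have un: "upd u xo n = upd (upd u0 xo n) xt t"
        using ne(1) unfolding G(5) by (cases xo; cases xt; auto simp: fun_upd_twist)
      have ln: "upd l yo n = upd (upd l0 yo n) yt t"
        using ne(2) unfolding G(6) by (cases yo; cases yt; auto simp: fun_upd_twist)
      have "t \<notin> insert n C0" using False G(3) by simp
      moreover have "vs = new_edge UL t yt @ (d0 @ ?N @ vs1)" using 1 d0 by simp
      moreover have "insert n C = insert t (insert n C0)" using G(4) by auto
      ultimately show ?thesis using g1 G(2,7) un ln by blast
    next
      case 2
      have C0: "C \<noteq> {0}" using C_ne 2 by auto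
      have "us1 @ ?M @ vs1 = (us1 @ ?M @ d) @ [(t, LR), (t, UR)] @ vs" using 2 by simp
      from glue.IH[OF this C0] obtain C0 u0 l0 us0 vs0 xt yt where G:
        "fish_on C0 u0 l0 (us0 @ old_edges xt yt @ vs0)" "xt \<noteq> None \<or> yt \<noteq> None" "t \<notin> C0"
        "C = insert t C0" "u = upd u0 xt t" "l = upd l0 yt t" "us1 @ ?M @ d = us0 @ new_edge LL t xt"
        "vs = new_edge UL t yt @ vs0" by blast
      obtain d0 where d0: "d = d0 @ new_edge LL t xt"
      proof (cases xt)
        case None
        have "d \<noteq> []"
        proof
          assume "d = []"
          then have "last (us1 @ ?M @ d) = last ?M" using M0 by simp
          moreover have "last (us1 @ ?M @ d) = (t, LL)" using G(7) None by simp
          ultimately have "(t, LL) \<in> set ?M" using M0 last_in_set by metis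
          then show False using Msd[of t LL] by simp
        qed
        then show ?thesis using that[of "butlast d"] None G(7) by (cases d rule: rev_cases) auto
      qed (use that in simp)
      then have a0: "us0 = us1 @ ?M @ d0" using G(7) by simp
      have n0: "n \<notin> C0" using nC G(4) by blast
      have "fish_on C0 u0 l0 (us1 @ ?M @ (d0 @ old_edges xt yt @ vs0))" using G(1) a0 by simp
      from fish_on.glue[OF this glue.hyps(2) n0]
      have g1: "fish_on (insert n C0) (upd u0 xo n) (upd l0 yo n) ((us1 @ ?N @ d0) @ old_edges xt yt @ vs0)" by simp
      have dd: "distinct ((us1 @ ?M @ d0) @ old_edges xt yt @ vs0)"
        using fish_on_edge_inv[OF G(1)] a0 unfolding edge_inv_def by simp
      have ne: "xo \<noteq> xt \<or> xo = None" "yo \<noteq> yt \<or> yo = None" using dd by (cases xo; cases yo; cases xt; cases yt; auto)+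
      have un: "upd u xo n = upd (upd u0 xo n) xt t"
        using ne(1) unfolding G(5) by (cases xo; cases xt; auto simp: fun_upd_twist)
      have ln: "upd l yo n = upd (upd l0 yo n) yt t"
        using ne(2) unfolding G(6) by (cases yo; cases yt; auto simp: fun_upd_twist)
      have "t \<notin> insert n C0" using False G(3) by simp
      moreover have "us = (us1 @ ?N @ d0) @ new_edge LL t xt" using 2 d0 by simp
      moreover have "insert n C = insert t (insert n C0)" using G(4) by auto
      ultimately show ?thesis using g1 G(2,8) un ln by blast
    qed
  qed
qed simp

lemma map_eq_split: "map h xs = a @ b \<Longrightarrow> \<exists>as bs. xs = as @ bs \<and> map h as = a \<and> map h bs = b"
  by (auto simp: map_eq_append_conv)

definition fmap :: "(nat \<Rightarrow> nat) \<Rightarrow> nat \<times> side \<Rightarrow> nat \<times> side" where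
  "fmap f e = (f (fst e), snd e)"

lemma fmap_simp[simp]: "fmap f (x, s) = (f x, s)" by (simp add: fmap_def)

lemma fish_on_iso:
  assumes "fish_on C u l es" "fish_on C' u' l' es'" "map snd es = map snd es'"
  shows "\<exists>f. bij_betw f C C' \<and> f 0 = 0 \<and>
     (\<forall>x\<in>C. u' (f x) = map_option f (u x) \<and> l' (f x) = map_option f (l x)) \<and> es' = map (fmap f) es"
  using assms
proof (induction arbitrary: C' u' l' es' rule: fish_on.induct)
  case head
  have "length (map snd es') = 4" unfolding head.prems(2)[symmetric] by simp
  then have "length es' = 4" by simp
  then have "C' = {0}" using fish_on_length[OF head.prems(1)] by auto
  from head.prems(1) have "u' = (\<lambda>_. None) \<and> l' = (\<lambda>_. None) \<and> es' = [(0, LL), (0, LR), (0, UR), (0, UL)]"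
  proof (cases rule: fish_on.cases)
    case (glue C u l us xo yo vs n)
    then have "0 \<in> C" using fish_on_edge_inv unfolding edge_inv_def by blast
    then show ?thesis using glue \<open>C' = {0}\<close> by auto
  qed auto
  then show ?case using \<open>C' = {0}\<close> by (intro exI[of _ id]) (auto simp: bij_betw_def)
next
  case (glue C u l us xo yo vs n)
  let ?M = "old_edges xo yo"
  let ?N = "new_edges n xo yo"
  note I = fish_on_edge_inv[OF glue.hyps(1)]
  have fwM: "fish_word (map snd (us @ ?M @ vs))" using fish_on_fw[OF glue.hyps(1)] .
  have "map snd es' = map snd (us @ new_edge LL n xo) @ [LR, UR] @ map snd (new_edge UL n yo @ vs)"
    using glue.prems(2) by simp
  then obtain a1 m b1 where es': "es' = a1 @ m @ b1" "map snd a1 = map snd (us @ new_edge LL n xo)"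
    "map snd m = [LR, UR]" "map snd b1 = map snd (new_edge UL n yo @ vs)"
    using map_eq_split by metis
  then obtain t t2 where m: "m = [(t, LR), (t2, UR)]" by auto
  have "((t, LR), (t2, UR)) \<in> adjacent es'" unfolding es'(1) m by (auto simp: adjacent_append)
  \<comment> \<open>The edges of the other boundary at the place of the right edges of
    \<open>n\<close> meet at the right vertex of some cell \<open>a\<close>; being of types
    \<open>LR\<close> and \<open>UR\<close>, both belong to \<open>a\<close> itself. This is the
    tail cell to be matched with \<open>n\<close>.\<close>
  then obtain a where "(t, LR) = edge_before l' a" "(t2, UR) = edge_after u' a"
    using fish_on_right_vertex_inv[OF glue.prems(1)] unfolding right_vertex_inv_def by fastforce
  then have "t2 = t" unfolding edge_before_def edge_after_def by (auto split: option.splits)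
  have es'': "es' = a1 @ [(t, LR), (t, UR)] @ b1" using es' m \<open>t2 = t\<close> by simp
  have "length (us @ ?N @ vs) \<ge> 6"
    using fish_on_length[OF fish_on.glue[OF glue.hyps]] glue.hyps(3) I unfolding edge_inv_def by auto
  then have "length es' \<ge> 6" using glue.prems(2) by (metis length_map)
  have C'0: "C' \<noteq> {0}"
  proof
    assume "C' = {0}"
    have "length es' = 4"
      using glue.prems(1)
    proof (cases rule: fish_on.cases)
      case (glue C u l us xo yo vs n)
      then have "0 \<in> C" using fish_on_edge_inv unfolding edge_inv_def by blast
      then show ?thesis using glue \<open>C' = {0}\<close> by auto
    qed simp
    then show False using \<open>length es' \<ge> 6\<close> by simp
  qed
  from fish_on_tail[OF glue.prems(1) es'' C'0] obtain C0 u0 l0 us0 vs0 xt yt where G: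
    "fish_on C0 u0 l0 (us0 @ old_edges xt yt @ vs0)" "xt \<noteq> None \<or> yt \<noteq> None" "t \<notin> C0"
    "C' = insert t C0" "u' = upd u0 xt t" "l' = upd l0 yt t" "a1 = us0 @ new_edge LL t xt"
    "b1 = new_edge UL t yt @ vs0" by blast
  have fwG: "fish_word (map snd (us0 @ old_edges xt yt @ vs0))" using fish_on_fw[OF G(1)] .
  \<comment> \<open>Were the two tail cells glued on different sides, removing them would leave a
    forbidden factor in one of the smaller boundaries.\<close>
  have noEW: "\<not> fish_word (w @ [LL, UR] @ z)" and noNS: "\<not> fish_word (w @ [LR, UL] @ z)" for w z
    using word_no[of "w @ [LL, UR] @ z" w LL UR z] word_no[of "w @ [LR, UL] @ z" w LR UL z] by auto
  have xx: "xo = None \<longleftrightarrow> xt = None"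
  proof (cases xo; cases xt)
    fix z assume a: "xo = None" "xt = Some z"
    then have "map snd us0 = map snd us @ [LL]" using es'(2) G(7) by simp
    then show ?thesis using fwG a noEW[of "map snd us"] by simp
  next
    fix z assume a: "xo = Some z" "xt = None"
    then have "map snd us = map snd us0 @ [LL]" using es'(2) G(7) by simp
    then show ?thesis using fwM a noEW[of "map snd us0"] by simp
  qed auto
  have yy: "yo = None \<longleftrightarrow> yt = None"
  proof (cases yo; cases yt)
    fix z assume a: "yo = None" "yt = Some z"
    then have "map snd vs0 = UL # map snd vs" using es'(4) G(8) by simp
    then show ?thesis using fwG a noNS[of "map snd (us0 @ old_edge UR xt)"] by simp
  next
    fix z assume a: "yo = Some z" "yt = None"
    then have "map snd vs = UL # map snd vs0" using es'(4) G(8) by simp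
    then show ?thesis using fwM a noNS[of "map snd (us @ old_edge UR xo)"] by simp
  qed auto
  have wus: "map snd us = map snd us0" using es'(2) G(7) xx by (cases xo; cases xt) auto
  have wvs: "map snd vs = map snd vs0" using es'(4) G(8) yy by (cases yo; cases yt) auto
  have wM: "map snd ?M = map snd (old_edges xt yt)" using xx yy by (cases xo; cases yo; cases xt; cases yt) auto
  have "map snd (us @ ?M @ vs) = map snd (us0 @ old_edges xt yt @ vs0)"
    using wus wvs wM by simp
  from glue.IH[OF G(1) this] obtain f where f: "bij_betw f C C0" "f 0 = 0"
    "\<forall>x\<in>C. u0 (f x) = map_option f (u x) \<and> l0 (f x) = map_option f (l x)"
    "us0 @ old_edges xt yt @ vs0 = map (fmap f) (us @ ?M @ vs)" by blast
  have l0: "length us0 = length us" "length (old_edges xt yt) = length ?M"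
    using wus wM by (metis length_map)+
  have "us0 @ (old_edges xt yt @ vs0) = map (fmap f) us @ (map (fmap f) ?M @ map (fmap f) vs)"
    using f(4) by (simp only: map_append append_assoc)
  then have "us0 = map (fmap f) us \<and> old_edges xt yt @ vs0 = map (fmap f) ?M @ map (fmap f) vs"
    using l0(1) append_eq_append_conv by (metis length_map)
  then have fM: "us0 = map (fmap f) us" "old_edges xt yt = map (fmap f) ?M" "vs0 = map (fmap f) vs"
    using l0(2) append_eq_append_conv by (metis length_map)+
  have xf: "xt = map_option f xo" "yt = map_option f yo"
    using fM(2) xx yy by (cases xo; cases yo; cases xt; cases yt; auto)+
  define g where "g = f(n := t)"
  have nC: "n \<notin> C" by (rule glue.hyps)
  have gC: "x \<in> C \<Longrightarrow> g x = f x" for x using nC by (auto simp: g_def)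
  have ulC: "\<And>x y. u x = Some y \<Longrightarrow> x \<in> C \<and> y \<in> C" "\<And>x y. l x = Some y \<Longrightarrow> x \<in> C \<and> y \<in> C"
    using I unfolding edge_inv_def by blast+
  have bij: "bij_betw g (insert n C) C'"
  proof -
    have "bij_betw g C C0" using f(1) gC by (metis bij_betw_cong)
    moreover have "g n = t" by (simp add: g_def)
    ultimately show ?thesis using G(3,4) nC notIn_Un_bij_betw[of n C g C0] by simp
  qed
  have xoC: "xo = Some x \<Longrightarrow> x \<in> C" "yo = Some x \<Longrightarrow> x \<in> C" for x
    using edge_inv_cell[OF I, of x UR] edge_inv_cell[OF I, of x LR] by auto
  have fi: "x \<in> C \<Longrightarrow> y \<in> C \<Longrightarrow> f x = f y \<longleftrightarrow> x = y" for x y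
    using f(1) by (metis bij_betw_inv_into_left)
  have fC: "x \<in> C \<Longrightarrow> f x \<in> C0" for x using f(1) bij_betwE by blast
  have u0t: "u0 t = None" "l0 t = None" using fish_on_edge_inv[OF G(1)] G(3) unfolding edge_inv_def by (metis not_None_eq)+
  have un: "u n = None" "l n = None" using ulC nC by (metis not_None_eq)+
  have mo: "map_option g (u x) = map_option f (u x)" "map_option g (l x) = map_option f (l x)" for x
    using ulC gC by (cases "u x"; cases "l x"; fastforce)+
  have uf: "u' (g x) = map_option g (upd u xo n x) \<and> l' (g x) = map_option g (upd l yo n x)" if "x \<in> insert n C" for x
  proof (cases "x = n")
    case True
    have "upd u xo n n = None" "upd l yo n n = None" using un xoC nC by (cases xo; cases yo; auto)+
    moreover have "u' t = None" "l' t = None" using u0t G(3) xf xoC fC unfolding G(5,6)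
      by (cases xo; cases yo; auto)+
    ultimately show ?thesis using True by (simp add: g_def)
  next
    case False
    then have x: "x \<in> C" using that by blast
    have gn: "g n = t" by (simp add: g_def)
    have "u' (g x) = map_option g (upd u xo n x)"
      using f(3) x gC[OF x] mo xoC(1) fi[OF x] unfolding G(5) xf by (cases xo) (auto simp: gn)
    moreover have "l' (g x) = map_option g (upd l yo n x)"
      using f(3) x gC[OF x] mo xoC(2) fi[OF x] unfolding G(6) xf by (cases yo) (auto simp: gn)
    ultimately show ?thesis by blast
  qed
  have mg: "map (fmap g) xs = map (fmap f) xs" if "set xs \<subseteq> set (us @ ?M @ vs)" for xs
    using that edge_inv_cell[OF I] gC by (force simp: fmap_def)
  have "es' = map (fmap g) (us @ ?N @ vs)"
  proof -
    have "map (fmap g) ?N = new_edges t xt yt"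
      using xx yy by (cases xo; cases yo; cases xt; cases yt) (auto simp: g_def)
    moreover have "map (fmap g) us = us0" "map (fmap g) vs = vs0" using mg fM by auto
    ultimately show ?thesis using es'' G(7,8) by simp
  qed
  moreover have "g 0 = 0" using gC f(2) I unfolding edge_inv_def by metis
  ultimately show ?case using bij uf by blast
qed

section \<open>Every fighting fish has a boundary word and every word a fish\<close>

lemma fish_on_glueE:
  assumes "fish_on C u l es" "es = us @ old_edges xo yo @ vs" "xo \<noteq> None \<or> yo \<noteq> None" "n \<notin> C"
  shows "fish_on (insert n C) (upd u xo n) (upd l yo n)
      (us @ new_edges n xo yo @ vs)"
  using fish_on.glue assms by blast

lemma fish_gfish: "fighting_fish F \<Longrightarrow> \<exists>es. fish_on {..<fst F} (fst (snd F)) (snd (snd F)) es"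
proof (induction rule: fighting_fish.induct)
  case head
  have "{..<1} = {0::nat}" by auto
  then show ?case using fish_on.head by auto
next
  case (add_a n u l x)
  then obtain es where es: "fish_on {..<n} u l es" by auto
  then have "(x, UR) \<in> set es" using fish_on_edge_inv[OF es] add_a unfolding edge_inv_def by simp
  then obtain us vs where "es = us @ (x, UR) # vs" by (meson split_list)
  then have "fish_on {..<Suc n} (u(x := Some n)) l (us @ [(n, LR), (n, UR), (n, UL)] @ vs)"
    using fish_on_glueE[OF es, of us "Some x" None vs n] by (simp add: lessThan_Suc)
  then show ?case unfolding fst_conv snd_conv by blast
next
  case (add_b n u l x)
  then obtain es where es: "fish_on {..<n} u l es" by auto
  then have "(x, LR) \<in> set es" using fish_on_edge_inv[OF es] add_b unfolding edge_inv_def by simp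
  then obtain us vs where "es = us @ (x, LR) # vs" by (meson split_list)
  then have "fish_on {..<Suc n} u (l(x := Some n)) (us @ [(n, LL), (n, LR), (n, UR)] @ vs)"
    using fish_on_glueE[OF es, of us None "Some x" vs n] by (simp add: lessThan_Suc)
  then show ?case unfolding fst_conv snd_conv by blast
next
  case (add_c n u l a b c)
  then obtain es where es: "fish_on {..<n} u l es" by auto
  have "(c, UR) \<in> set es" "(b, LR) \<in> set es" using fish_on_edge_inv[OF es] add_c unfolding edge_inv_def by blast+
  \<comment> \<open>The two edges to be covered meet at the right vertex of \<open>a\<close>, so
    they are consecutive on the boundary.\<close>
  moreover have "edge_before l a = (c, UR)" "edge_after u a = (b, LR)" using add_c by (simp_all add: edge_before_def edge_after_def)
  ultimately have "((c, UR), (b, LR)) \<in> adjacent es"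
    using fish_on_right_vertex_inv[OF es] add_c.hyps(2) unfolding right_vertex_inv_def by (metis lessThan_iff)
  then obtain us vs where "es = us @ [(c, UR), (b, LR)] @ vs" using adjacent_iff by metis
  then have "fish_on {..<Suc n} (u(c := Some n)) (l(b := Some n)) (us @ [(n, LR), (n, UR)] @ vs)"
    using fish_on_glueE[OF es, of us "Some c" "Some b" vs n] by (simp add: lessThan_Suc)
  then show ?case unfolding fst_conv snd_conv by blast
qed

lemma word_fish: "fish_word w \<Longrightarrow> \<exists>n u l es. fighting_fish (n, u, l) \<and> fish_on {..<n} u l es \<and> map snd es = w"
proof (induction rule: fish_word.induct)
  case cell
  have "{..<1} = {0::nat}" by auto
  then have g: "fish_on {..<1} (\<lambda>_. None) (\<lambda>_. None) [(0, LL), (0, LR), (0, UR), (0, UL)]" using fish_on.head by simp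
  show ?case by (intro exI conjI, rule fighting_fish.head, rule g, simp)
next
  case (up us vs)
  then obtain n u l es where e: "fighting_fish (n, u, l)" "fish_on {..<n} u l es" "map snd es = us @ [UR] @ vs" by blast
  then obtain a m b where s: "es = a @ m @ b" "map snd a = us" "map snd m = [UR]" "map snd b = vs"
    using map_eq_split by metis
  then obtain x where m: "m = [(x, UR)]" by auto
  have "(x, UR) \<in> set es" using s m by simp
  then have "x < n" "u x = None" using fish_on_edge_inv[OF e(2)] unfolding edge_inv_def by blast+
  then have "fighting_fish (Suc n, u(x := Some n), l)" using e(1) add_a by blast
  moreover have "fish_on {..<Suc n} (u(x := Some n)) l (a @ [(n, LR), (n, UR), (n, UL)] @ b)"
    using fish_on_glueE[OF e(2), of a "Some x" None b n] s m by (simp add: lessThan_Suc)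
  moreover have "map snd (a @ [(n, LR), (n, UR), (n, UL)] @ b) = us @ [LR, UR, UL] @ vs" using s by simp
  ultimately show ?case by blast
next
  case (down us vs)
  then obtain n u l es where e: "fighting_fish (n, u, l)" "fish_on {..<n} u l es" "map snd es = us @ [LR] @ vs" by blast
  then obtain a m b where s: "es = a @ m @ b" "map snd a = us" "map snd m = [LR]" "map snd b = vs"
    using map_eq_split by metis
  then obtain x where m: "m = [(x, LR)]" by auto
  have "(x, LR) \<in> set es" using s m by simp
  then have "x < n" "l x = None" using fish_on_edge_inv[OF e(2)] unfolding edge_inv_def by blast+
  then have "fighting_fish (Suc n, u, l(x := Some n))" using e(1) add_b by blast
  moreover have "fish_on {..<Suc n} u (l(x := Some n)) (a @ [(n, LL), (n, LR), (n, UR)] @ b)"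
    using fish_on_glueE[OF e(2), of a None "Some x" b n] s m by (simp add: lessThan_Suc)
  moreover have "map snd (a @ [(n, LL), (n, LR), (n, UR)] @ b) = us @ [LL, LR, UR] @ vs" using s by simp
  ultimately show ?case by blast
next
  case (both us vs)
  then obtain n u l es where e: "fighting_fish (n, u, l)" "fish_on {..<n} u l es" "map snd es = us @ [UR, LR] @ vs" by blast
  then obtain ea m eb where s: "es = ea @ m @ eb" "map snd ea = us" "map snd m = [UR, LR]" "map snd eb = vs"
    using map_eq_split by metis
  then obtain c b where m: "m = [(c, UR), (b, LR)]" by auto
  have "((c, UR), (b, LR)) \<in> adjacent es" unfolding s(1) m by (auto simp: adjacent_append)
  \<comment> \<open>Conversely, the cell \<open>a\<close> demanded by \<open>add_c\<close> is
    recovered from two consecutive edges \<open>UR LR\<close>.\<close>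
  then obtain a where a: "a < n" "(c, UR) = edge_before l a" "(b, LR) = edge_after u a"
    using fish_on_right_vertex_inv[OF e(2)] unfolding right_vertex_inv_def by fastforce
  then have "l a = Some c" "u a = Some b" unfolding edge_before_def edge_after_def by (auto split: option.splits)
  moreover have "(c, UR) \<in> set es" "(b, LR) \<in> set es" using s m by simp_all
  then have "u c = None" "l b = None" using fish_on_edge_inv[OF e(2)] unfolding edge_inv_def by blast+
  ultimately have "fighting_fish (Suc n, u(c := Some n), l(b := Some n))" using e(1) a(1) add_c by blast
  moreover have "fish_on {..<Suc n} (u(c := Some n)) (l(b := Some n)) (ea @ [(n, LR), (n, UR)] @ eb)"
    using fish_on_glueE[OF e(2), of ea "Some c" "Some b" eb n] s m by (simp add: lessThan_Suc)
  moreover have "map snd (ea @ [(n, LR), (n, UR)] @ eb) = us @ [LR, UR] @ vs" using s by simp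
  ultimately show ?case by blast
qed

lemma same_vert_sym: "same_vert u l p q \<Longrightarrow> same_vert u l q p"
  unfolding same_vert_def by (induction rule: rtranclp_induct) (auto intro: converse_rtranclp_into_rtranclp)

lemma same_vert_trans: "same_vert u l p q \<Longrightarrow> same_vert u l q r \<Longrightarrow> same_vert u l p r"
  unfolding same_vert_def by simp

section \<open>Statistics of a fish read from its boundary list\<close>

locale fish_boundary =
  fixes n u l es vt
  assumes fish_es: "fish_on {..<n} u l es" and vm: "vertex_map {..<n} u l es vt"
begin

abbreviation "F \<equiv> (n, u, l) :: fish"

lemma fish_sel: "ncells F = n" "ur F = u" "lr F = l"
  by (simp_all add: ncells_def ur_def lr_def)

lemmas I1 = fish_on_edge_inv[OF fish_es]
lemmas I2 = fish_on_right_vertex_inv[OF fish_es]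

lemma distinct_es: "distinct es" using I1 unfolding edge_inv_def by blast

lemma uC: "u x = Some y \<Longrightarrow> x < n \<and> y < n" and lC: "l x = Some y \<Longrightarrow> x < n \<and> y < n"
  using I1 unfolding edge_inv_def by blast+

lemma mem_es:
  "(x, UR) \<in> set es \<longleftrightarrow> x < n \<and> u x = None"
  "(x, LR) \<in> set es \<longleftrightarrow> x < n \<and> l x = None"
  "(x, LL) \<in> set es \<longleftrightarrow> x < n \<and> \<not> (\<exists>z. u z = Some x)"
  "(x, UL) \<in> set es \<longleftrightarrow> x < n \<and> \<not> (\<exists>z. l z = Some x)"
  using I1 unfolding edge_inv_def by (simp_all only: lessThan_iff) blast+

lemma free_iff: "free_edge F e \<longleftrightarrow> e \<in> set es"
proof -
  obtain x s where e: "e = (x, s)" by (cases e)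
  show ?thesis
  proof (cases s)
    case UR
    then show ?thesis unfolding e free_edge_def glued_def fish_sel by (cases "u x") (auto simp: mem_es)
  next
    case LR
    then show ?thesis unfolding e free_edge_def glued_def fish_sel by (cases "l x") (auto simp: mem_es)
  next
    case LL
    then show ?thesis unfolding e free_edge_def glued_def fish_sel using uC by (auto simp: mem_es)
  next
    case UL
    then show ?thesis unfolding e free_edge_def glued_def fish_sel using lC by (auto simp: mem_es)
  qed
qed

lemma same_vert_iff: "same_vertex F p q \<longleftrightarrow> same_vert u l p q"
proof -
  have "\<And>x y. u x = Some y \<Longrightarrow> x < n" "\<And>x y. l x = Some y \<Longrightarrow> x < n" using I1 unfolding edge_inv_def by blast+
  then have "corner_ident F = corner_glue u l" unfolding corner_ident_def corner_glue_def fish_sel by (intro ext) blast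
  then show ?thesis unfolding same_vertex_def same_vert_def by simp
qed

lemma same_vert_vt:
  assumes "same_vert u l p q"
  shows "vt p = vt q"
  using assms unfolding same_vert_def
proof (induction rule: rtranclp_induct)
  case (step q r)
  then show ?case using vm unfolding vertex_map_def by metis
qed simp

lemma vertex_of_eq:
  assumes "fst p < n" "fst q < n"
  shows "vertex_of F p = vertex_of F q \<longleftrightarrow> vt p = vt q"
proof
  assume "vertex_of F p = vertex_of F q"
  moreover have "q \<in> vertex_of F q" by (simp add: vertex_of_def same_vert_iff same_vert_refl)
  ultimately have "q \<in> vertex_of F p" by simp
  then have "same_vert u l p q" by (simp add: vertex_of_def same_vert_iff)
  then show "vt p = vt q" by (rule same_vert_vt)
next
  assume v: "vt p = vt q"
  have "same_vert u l p (vt p)" "same_vert u l q (vt q)"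
    using vm assms unfolding vertex_map_def by (metis lessThan_iff prod.collapse)+
  then have "same_vert u l p q" using v same_vert_sym same_vert_trans by metis
  then show "vertex_of F p = vertex_of F q" unfolding vertex_of_def same_vert_iff
    using same_vert_sym same_vert_trans by blast
qed

lemma cell: "e \<in> set es \<Longrightarrow> fst e < n"
  using edge_inv_cell[OF I1, of "fst e" "snd e"] by simp

lemma start_inj: "e \<in> set es \<Longrightarrow> e' \<in> set es \<Longrightarrow> vt (edge_start e) = vt (edge_start e') \<Longrightarrow> e = e'"
  using vm unfolding vertex_map_def distinct_map inj_on_def by auto

lemma consec: "Suc i < length es \<Longrightarrow> vt (edge_end (es ! i)) = vt (edge_start (es ! Suc i))"
  using adjacent_nth[of i es] vm unfolding vertex_map_def by blast

lemma hd_es: "es \<noteq> []" "es ! 0 = (0, LL)"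
  using I1 unfolding edge_inv_def by auto

text \<open>Each step is forced, since a boundary vertex starts only one free edge. Paths shorter
  than the fin and images of boundaries under isomorphisms are both compared with \<open>es\<close>
  in this way.\<close>

lemma path_unique:
  assumes ne: "es' \<noteq> []" and fr: "\<forall>e\<in>set es'. free_edge F e"
    and st: "vertex_of F (edge_start (hd es')) = nose F"
    and cs: "\<forall>i. Suc i < length es' \<longrightarrow>
        vertex_of F (edge_end (es' ! i)) = vertex_of F (edge_start (es' ! Suc i))"
  shows "i < length es' \<Longrightarrow> i < length es \<Longrightarrow> es' ! i = es ! i"
proof (induction i)
  case 0
  have h: "hd es' \<in> set es" using ne fr free_iff by simp
  moreover have "es ! 0 \<in> set es" using hd_es(1) by (metis length_greater_0_conv nth_mem)
  moreover have "vt (edge_start (hd es')) = vt (edge_start (es ! 0))"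
    using st vertex_of_eq[of "edge_start (hd es')" "(0, CL)"] cell[OF h] hd_es cell[of "es ! 0"]
    unfolding nose_def by simp
  ultimately show ?case using start_inj ne by (metis hd_conv_nth)
next
  case (Suc i)
  have h: "es' ! Suc i \<in> set es" "es' ! i \<in> set es" using Suc.prems fr free_iff by auto
  have "vt (edge_start (es' ! Suc i)) = vt (edge_end (es' ! i))"
    using cs Suc.prems vertex_of_eq[of "edge_end (es' ! i)" "edge_start (es' ! Suc i)"] cell[OF h(1)] cell[OF h(2)] by simp
  also have "\<dots> = vt (edge_start (es ! Suc i))" using Suc consec by simp
  finally show ?case using start_inj h Suc.prems by simp
qed

lemma path_exists:
  assumes "m \<le> length es" "Suc i < m"
  shows "vertex_of F (edge_end (es ! i)) = vertex_of F (edge_start (es ! Suc i))"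
  using assms consec[of i] vertex_of_eq cell by simp

lemma count_edges: "card {e. free_edge F e \<and> snd e = s} = count_list (map snd es) s"
proof -
  have "{e. free_edge F e \<and> snd e = s} = set (filter (\<lambda>e. snd e = s) es)" using free_iff by auto
  then have "card {e. free_edge F e \<and> snd e = s} = length (filter (\<lambda>e. snd e = s) es)"
    using distinct_es by (metis distinct_card distinct_filter)
  also have "\<dots> = count_list (map snd es) s" by (induction es) auto
  finally show ?thesis .
qed

lemma lower_count: "card (lower_free_edges F) = count_list (map snd es) LL + count_list (map snd es) LR"
proof -
  have f: "finite {e. free_edge F e \<and> snd e = s}" for s
    using finite_subset[of "{e. free_edge F e \<and> snd e = s}" "set es"] free_iff by auto
  have "lower_free_edges F = {e. free_edge F e \<and> snd e = LL} \<union> {e. free_edge F e \<and> snd e = LR}"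
    unfolding lower_free_edges_def by auto
  then have "card (lower_free_edges F) = card {e. free_edge F e \<and> snd e = LL} + card {e. free_edge F e \<and> snd e = LR}"
    using f by (simp add: card_Un_disjoint disjoint_iff)
  then show ?thesis by (simp add: count_edges)
qed

definition "tcells = {x. (x, LR) \<in> set es \<and> (x, UR) \<in> set es}"

lemma adjacent_tail: "((x, LR), (y, UR)) \<in> adjacent es \<longleftrightarrow> x = y \<and> x \<in> tcells"
proof
  assume a: "((x, LR), (y, UR)) \<in> adjacent es"
  then obtain c where "(x, LR) = edge_before l c" "(y, UR) = edge_after u c" using I2 unfolding right_vertex_inv_def by fastforce
  then have "x = y" unfolding edge_before_def edge_after_def by (auto split: option.splits)
  then show "x = y \<and> x \<in> tcells" using a adjacent_sub[of es] unfolding tcells_def by auto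
next
  assume a: "x = y \<and> x \<in> tcells"
  then have "(x, LR) \<in> set es" "(x, UR) \<in> set es" unfolding tcells_def by auto
  moreover then have "edge_before l x = (x, LR)" "edge_after u x = (x, UR)" "x \<in> {..<n}"
    using I1 unfolding edge_inv_def by (auto simp: edge_before_def edge_after_def)
  ultimately have "((x, LR), (x, UR)) \<in> adjacent es" using I2 unfolding right_vertex_inv_def by metis
  then show "((x, LR), (y, UR)) \<in> adjacent es" using a by simp
qed

lemma tails_eq: "tails F = (\<lambda>x. vertex_of F (x, CR)) ` tcells"
  unfolding tails_def fish_sel tcells_def free_iff using cell by fastforce

text \<open>Different tail cells have different right vertices, because their free upper right edges
  start there.\<close>

lemma tails_count: "card (tails F) = adj tail_step (map snd es)"
proof -
  have "inj_on (\<lambda>x. vertex_of F (x, CR)) tcells"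
  proof (rule inj_onI)
    fix x y assume a: "x \<in> tcells" "y \<in> tcells" "vertex_of F (x, CR) = vertex_of F (y, CR)"
    then have m: "(x, UR) \<in> set es" "(y, UR) \<in> set es" unfolding tcells_def by auto
    then have "vt (x, CR) = vt (y, CR)" using a(3) vertex_of_eq[of "(x, CR)" "(y, CR)"] cell[OF m(1)] cell[OF m(2)] by simp
    then show "x = y" using start_inj[OF m] by simp
  qed
  then have "card (tails F) = card tcells" unfolding tails_eq by (rule card_image)
  also have "\<dots> = card ((\<lambda>x. ((x, LR), (x, UR))) ` tcells)" by (rule card_image[symmetric]) (auto intro: inj_onI)
  also have "(\<lambda>x. ((x, LR), (x, UR))) ` tcells = {(a, b) \<in> adjacent es. tail_step (snd a) (snd b)}"
    using adjacent_tail by (auto simp: tail_step_def image_iff)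
  also have "card \<dots> = adj tail_step (map snd es)" unfolding adj_map_snd by (rule adj_nb[OF distinct_es, symmetric])
  finally show ?thesis .
qed

text \<open>The maximal lower prefix ends with the \<open>LR\<close> of a tail cell. A shorter path
  to a tail would be continued on the boundary by the \<open>UR\<close> of that tail cell, but all
  edges up to the end of the prefix are lower.\<close>

lemma fin_count: "fin_length F = fin (map snd es)"
proof -
  obtain w q where w: "map snd es = w @ [LR] @ UR # q" "fin (map snd es) = Suc (length w)" "\<forall>s\<in>set w. is_lower s"
    using word_first_UR[OF fish_on_fw[OF fish_es]] by blast
  define m where "m = Suc (length w)"
  have len: "m < length es" using arg_cong[OF w(1), of length] by (simp add: m_def)
  have sn: "snd (es ! i) = (w @ [LR] @ UR # q) ! i" if "i < length es" for i
    using that w(1) by (metis nth_map)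
  have lowi: "is_lower (snd (es ! i))" if "i < m" for i
  proof -
    have "(w @ [LR] @ UR # q) ! i = (w @ [LR]) ! i" using that by (simp add: nth_append m_def)
    moreover have "(w @ [LR]) ! i \<in> set (w @ [LR])" using that by (intro nth_mem) (simp add: m_def)
    ultimately show ?thesis using sn[of i] that len w(3) by auto
  qed
  have "snd (es ! length w) = LR" "snd (es ! m) = UR" using sn len by (simp_all add: nth_append m_def)
  then obtain x y where xy: "es ! length w = (x, LR)" "es ! m = (y, UR)" by (metis prod.collapse)
  then have "((x, LR), (y, UR)) \<in> adjacent es" using adjacent_nth[of "length w" es] len by (simp add: m_def)
  then have t: "x \<in> tcells" using adjacent_tail by blast
  have "nose_to_tail_path F (take m es)"
    unfolding nose_to_tail_path_def
  proof (intro conjI allI ballI impI)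
    show "take m es \<noteq> []" using hd_es m_def by simp
    show "free_edge F e" if "e \<in> set (take m es)" for e using that free_iff in_set_takeD by metis
    have "hd (take m es) = (0, LL)" using hd_es m_def by (metis hd_conv_nth hd_take zero_less_Suc)
    then show "vertex_of F (edge_start (hd (take m es))) = nose F" by (simp add: nose_def)
    show "vertex_of F (edge_end (take m es ! i)) = vertex_of F (edge_start (take m es ! Suc i))" if "Suc i < length (take m es)" for i
      using that path_exists[of m i] len by simp
    have "last (take m es) = (x, LR)" using xy len by (simp add: last_conv_nth m_def hd_es)
    then show "vertex_of F (edge_end (last (take m es))) \<in> tails F" using t unfolding tails_eq by simp
  qed
  moreover have "length (take m es) = m" using len by simp
  ultimately have ex: "\<exists>p. nose_to_tail_path F p \<and> length p = m" by blast
  have "m \<le> m'" if ex': "\<exists>p. nose_to_tail_path F p \<and> length p = m'" for m'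
  proof (rule ccontr)
    assume lt: "\<not> m \<le> m'"
    obtain p where p: "nose_to_tail_path F p" "length p = m'" using ex' by blast
    have p0: "p \<noteq> []" using p(1) unfolding nose_to_tail_path_def by blast
    have "p ! (m' - 1) = es ! (m' - 1)"
      using path_unique[OF p0, of "m' - 1"] p lt len p0 unfolding nose_to_tail_path_def by (cases p) auto
    then have la: "last p = es ! (m' - 1)" using p(2) p0 by (simp add: last_conv_nth)
    have m1: "Suc (m' - 1) = m'" using p p0 by (cases p) auto
    have "vertex_of F (edge_end (last p)) \<in> tails F" using p(1) unfolding nose_to_tail_path_def by blast
    then obtain z where z: "z \<in> tcells" "vertex_of F (edge_end (last p)) = vertex_of F (z, CR)" unfolding tails_eq by auto
    have zm: "(z, UR) \<in> set es" using z(1) unfolding tcells_def by simp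
    have "es ! (m' - 1) \<in> set es" using lt len by simp
    then have "vt (edge_end (es ! (m' - 1))) = vt (z, CR)"
      using z(2) la vertex_of_eq[of "edge_end (last p)" "(z, CR)"] cell[of "es ! (m' - 1)"] cell[OF zm] by simp
    then have "vt (edge_start (es ! m')) = vt (edge_start (z, UR))" using consec[of "m' - 1"] m1 lt len by simp
    then have "es ! m' = (z, UR)" using start_inj[of "es ! m'" "(z, UR)"] zm lt len by simp
    then show False using lowi[of m'] lt by simp
  qed
  then have "fin_length F = m" unfolding fin_length_def using ex by (intro Least_equality) blast+
  then show ?thesis using w(2) m_def by simp
qed

end

lemma fish_boundary_exists:
  assumes "fish_on {..<n} u l es"
  shows "\<exists>vt. fish_boundary n u l es vt"
  using fish_on_vmap[OF assms] assms unfolding fish_boundary_def by blast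

section \<open>Isomorphic fish have equal boundary words\<close>

text \<open>An isomorphism carries the boundary walk of one fish to a walk along the boundary of the
  other one, which is unique.\<close>

lemma iso_same_word:
  assumes F: "fish_on {..<n} u l es" and G: "fish_on {..<n'} u' l' es'" and iso: "fish_iso (n, u, l) (n', u', l')"
  shows "map snd es = map snd es'"
proof -
  obtain vt where vt: "fish_boundary n u l es vt" using fish_boundary_exists[OF F] by blast
  obtain vt' where vt': "fish_boundary n' u' l' es' vt'" using fish_boundary_exists[OF G] by blast
  interpret A: fish_boundary n u l es vt by (rule vt)
  interpret B: fish_boundary n' u' l' es' vt' by (rule vt')
  obtain f where f: "n = n'" "bij_betw f {..<n} {..<n'}" "f 0 = 0"
    "\<And>x. x < n \<Longrightarrow> u' (f x) = map_option f (u x) \<and> l' (f x) = map_option f (l x)"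
    using iso unfolding fish_iso_def A.fish_sel B.fish_sel by blast
  have inj: "x < n \<Longrightarrow> y < n \<Longrightarrow> f x = f y \<longleftrightarrow> x = y" for x y
    using f(2) unfolding bij_betw_def inj_on_def by (metis lessThan_iff)
  have ran: "y < n' \<Longrightarrow> \<exists>x<n. y = f x" for y using f(2) unfolding bij_betw_def by (metis imageE lessThan_iff)
  have fn: "x < n \<Longrightarrow> f x < n'" for x using f(2) bij_betwE by blast
  have uC: "\<And>x y. u x = Some y \<Longrightarrow> x < n \<and> y < n" "\<And>x y. l x = Some y \<Longrightarrow> x < n \<and> y < n"
    using A.I1 unfolding edge_inv_def by blast+
  have uC': "\<And>x y. u' x = Some y \<Longrightarrow> x < n' \<and> y < n'" "\<And>x y. l' x = Some y \<Longrightarrow> x < n' \<and> y < n'"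
    using B.I1 unfolding edge_inv_def by blast+
  have LLu: "(\<exists>z. u' z = Some (f x)) \<longleftrightarrow> (\<exists>z. u z = Some x)" if "x < n" for x
  proof
    assume "\<exists>z. u' z = Some (f x)"
    then obtain z where "u' z = Some (f x)" by blast
    then obtain z0 where "z0 < n" "u' (f z0) = Some (f x)" using uC' ran by metis
    then obtain w where "u z0 = Some w" "f w = f x" using f(4)[of z0] by auto
    then show "\<exists>z. u z = Some x" using inj uC that by metis
  next
    assume "\<exists>z. u z = Some x"
    then show "\<exists>z. u' z = Some (f x)" using f(4) uC by (metis option.simps(9))
  qed
  have ULl: "(\<exists>z. l' z = Some (f x)) \<longleftrightarrow> (\<exists>z. l z = Some x)" if "x < n" for x
  proof
    assume "\<exists>z. l' z = Some (f x)"
    then obtain z where "l' z = Some (f x)" by blast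
    then obtain z0 where "z0 < n" "l' (f z0) = Some (f x)" using uC' ran by metis
    then obtain w where "l z0 = Some w" "f w = f x" using f(4)[of z0] by auto
    then show "\<exists>z. l z = Some x" using inj uC that by metis
  next
    assume "\<exists>z. l z = Some x"
    then show "\<exists>z. l' z = Some (f x)" using f(4) uC by (metis option.simps(9))
  qed
  have free: "(x, s) \<in> set es \<longleftrightarrow> (f x, s) \<in> set es'" if "x < n" for x s
  proof (cases s)
    case LL
    then show ?thesis unfolding LL A.mem_es B.mem_es using LLu[OF that] fn[OF that] that by blast
  next
    case UL
    then show ?thesis unfolding UL A.mem_es B.mem_es using ULl[OF that] fn[OF that] that by blast
  next
    case LR
    then show ?thesis using A.mem_es B.mem_es f(4)[OF that] fn[OF that] that by simp
  next
    case UR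
    then show ?thesis using A.mem_es B.mem_es f(4)[OF that] fn[OF that] that by simp
  qed
  have ci: "corner_glue u l p q \<Longrightarrow> corner_glue u' l' (f (fst p), snd p) (f (fst q), snd q)" for p q
  proof -
    have "u x = Some y \<Longrightarrow> u' (f x) = Some (f y)" "l x = Some y \<Longrightarrow> l' (f x) = Some (f y)" for x y
      using f(4) uC by (metis option.simps(9))+
    then show "corner_glue u l p q \<Longrightarrow> corner_glue u' l' (f (fst p), snd p) (f (fst q), snd q)"
      unfolding corner_glue_def by fastforce
  qed
  have sv: "same_vert u l p q \<Longrightarrow> same_vert u' l' (f (fst p), snd p) (f (fst q), snd q)" for p q
    unfolding same_vert_def
  proof (induction rule: rtranclp_induct)
    case (step y z)
    then show ?case using ci by (metis (mono_tags, lifting) rtranclp.rtrancl_into_rtrancl)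
  qed simp
  have fe: "edge_start (fmap f e) = (f (fst (edge_start e)), snd (edge_start e))"
    "edge_end (fmap f e) = (f (fst (edge_end e)), snd (edge_end e))" for e
    by (cases e rule: edge_start.cases; simp)+
  define es2 where "es2 = map (fmap f) es"
  have l2: "length es2 = length es" by (simp add: es2_def)
  have s2: "set es2 = set es'"
  proof (intro equalityI subsetI)
    fix e assume "e \<in> set es2"
    then obtain e0 where "e0 \<in> set es" "e = fmap f e0" unfolding es2_def by auto
    then show "e \<in> set es'" using free[of "fst e0" "snd e0"] A.cell by (simp add: fmap_def)
  next
    fix e assume e: "e \<in> set es'"
    then obtain x where "x < n" "fst e = f x" using ran B.cell by blast
    then have "e = (f x, snd e)" by (metis prod.collapse)
    then have "(x, snd e) \<in> set es" "e = fmap f (x, snd e)" using free[of x "snd e"] e \<open>x < n\<close> by simp_all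
    then show "e \<in> set es2" unfolding es2_def by (metis image_eqI set_map)
  qed
  have "inj_on (fmap f) (set es)"
    using inj A.cell by (auto simp: inj_on_def fmap_def prod_eq_iff)
  then have "distinct es2" using A.distinct_es by (simp add: es2_def distinct_map)
  then have len: "length es2 = length es'" using s2 B.distinct_es by (metis distinct_card)
  have "es2 ! i = es' ! i" if "i < length es'" for i
  proof (rule B.path_unique)
    show "es2 \<noteq> []" using A.hd_es by (simp add: es2_def)
    show "\<forall>e\<in>set es2. free_edge B.F e" using s2 B.free_iff by simp
    have "hd es2 = (0, LL)" using A.hd_es f(3) unfolding es2_def by (cases es) auto
    then show "vertex_of B.F (edge_start (hd es2)) = nose B.F" by (simp add: nose_def)
    show "\<forall>i. Suc i < length es2 \<longrightarrow> vertex_of B.F (edge_end (es2 ! i)) = vertex_of B.F (edge_start (es2 ! Suc i))"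
    proof (intro allI impI)
      fix i assume i: "Suc i < length es2"
      have "vertex_of A.F (edge_end (es ! i)) = vertex_of A.F (edge_start (es ! Suc i))"
        using A.path_exists[of "length es" i] i l2 by simp
      moreover have "edge_start (es ! Suc i) \<in> vertex_of A.F (edge_start (es ! Suc i))"
        by (simp add: vertex_of_def A.same_vert_iff same_vert_refl)
      ultimately have "edge_start (es ! Suc i) \<in> vertex_of A.F (edge_end (es ! i))" by simp
      then have "same_vert u l (edge_end (es ! i)) (edge_start (es ! Suc i))" by (simp add: vertex_of_def A.same_vert_iff)
      from sv[OF this] have "same_vert u' l' (edge_end (es2 ! i)) (edge_start (es2 ! Suc i))"
        using i by (simp add: es2_def fe del: edge_fst)
      then have "vt' (edge_end (es2 ! i)) = vt' (edge_start (es2 ! Suc i))" by (rule B.same_vert_vt)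
      then show "vertex_of B.F (edge_end (es2 ! i)) = vertex_of B.F (edge_start (es2 ! Suc i))"
        using B.vertex_of_eq B.cell i s2 by (metis Suc_lessD edge_fst nth_mem)
    qed
  qed (use that len in auto)
  then have "es2 = es'" using len by (intro nth_equalityI) auto
  then show ?thesis unfolding es2_def by (auto simp: fmap_def)
qed

section \<open>The bijection\<close>

theorem theorem1:
  shows "\<exists>\<phi> :: nat list \<Rightarrow> fish.
    (\<forall>\<pi>. two_stack_sortable \<pi> \<longrightarrow> fighting_fish (\<phi> \<pi>)) \<and>
    (\<forall>\<pi> \<pi>'. two_stack_sortable \<pi> \<longrightarrow> two_stack_sortable \<pi>' \<longrightarrow>
        fish_iso (\<phi> \<pi>) (\<phi> \<pi>') \<longrightarrow> \<pi> = \<pi>') \<and>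
    (\<forall>F. fighting_fish F \<longrightarrow> (\<exists>\<pi>. two_stack_sortable \<pi> \<and> fish_iso (\<phi> \<pi>) F)) \<and>
    (\<forall>\<pi>. two_stack_sortable \<pi> \<longrightarrow>
        card (lower_free_edges (\<phi> \<pi>)) = length \<pi> + 1 \<and>
        card (left_lower_free_edges (\<phi> \<pi>)) = ascents \<pi> + 1 \<and>
        card (right_lower_free_edges (\<phi> \<pi>)) = descents \<pi> + 1 \<and>
        fin_length (\<phi> \<pi>) = ltr_maxima (stack_sort \<pi>) + 1 \<and>
        card (tails (\<phi> \<pi>)) = precedes_pred_count (stack_sort \<pi>) + 1)"
proof -
  \<comment> \<open>A tree is chosen along with the fish, because injectivity and the statistics are
    both compared on trees.\<close>
  have "\<exists>F T. two_stack_sortable \<pi> \<longrightarrow> valid T \<and> T \<noteq> Leaf \<and> tree_perm T = \<pi> \<and> fighting_fish F \<and>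
     (\<exists>n u l es. F = (n, u, l) \<and> fish_on {..<n} u l es \<and> map snd es = tree_word T)" for \<pi>
  proof (cases "two_stack_sortable \<pi>")
    case True
    then obtain T where T: "valid T" "tree_perm T = \<pi>" "T \<noteq> Leaf"
      using tree_perm_surj tree_perm_eq_Nil unfolding two_stack_sortable_iff by metis
    then obtain n u l es where "fighting_fish (n, u, l)" "fish_on {..<n} u l es" "map snd es = tree_word T"
      using word_fish tree_word_fw by blast
    then show ?thesis using T by blast
  qed simp
  then obtain \<phi> \<tau> where \<phi>: "\<And>\<pi>. two_stack_sortable \<pi> \<Longrightarrow> valid (\<tau> \<pi>) \<and> \<tau> \<pi> \<noteq> Leaf \<and> tree_perm (\<tau> \<pi>) = \<pi> \<and> fighting_fish (\<phi> \<pi>) \<and>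
     (\<exists>n u l es. \<phi> \<pi> = (n, u, l) \<and> fish_on {..<n} u l es \<and> map snd es = tree_word (\<tau> \<pi>))" by metis
  show ?thesis
  proof (intro exI[of _ \<phi>] conjI allI impI)
    fix \<pi> assume "two_stack_sortable \<pi>"
    then show "fighting_fish (\<phi> \<pi>)" using \<phi> by blast
  next
    fix \<pi> \<pi>' assume t: "two_stack_sortable \<pi>" "two_stack_sortable \<pi>'" and iso: "fish_iso (\<phi> \<pi>) (\<phi> \<pi>')"
    then have "tree_word (\<tau> \<pi>) = tree_word (\<tau> \<pi>')" using \<phi>[OF t(1)] \<phi>[OF t(2)] iso_same_word by metis
    then have "\<tau> \<pi> = \<tau> \<pi>'" using tree_word_inj \<phi>[OF t(1)] \<phi>[OF t(2)] by blast
    then show "\<pi> = \<pi>'" using \<phi>[OF t(1)] \<phi>[OF t(2)] by metis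
  next
    fix F assume F: "fighting_fish F"
    obtain n u l where Fe: "F = (n, u, l)" by (cases F) auto
    then obtain es where es: "fish_on {..<n} u l es" using fish_gfish[OF F] by auto
    then obtain T where T: "valid T" "T \<noteq> Leaf" "tree_word T = map snd es" using tree_word_surj fish_on_fw by blast
    have t: "two_stack_sortable (tree_perm T)" using tree_perm_good T tree_perm_eq_Nil unfolding two_stack_sortable_iff by blast
    have "\<tau> (tree_perm T) = T" using \<phi>[OF t] tree_perm_inj T by blast
    then obtain n' u' l' es' where G: "\<phi> (tree_perm T) = (n', u', l')" "fish_on {..<n'} u' l' es'" "map snd es' = map snd es"
      using \<phi>[OF t] T by metis
    obtain f where f: "bij_betw f {..<n'} {..<n}" "f 0 = 0"
      "\<forall>x\<in>{..<n'}. u (f x) = map_option f (u' x) \<and> l (f x) = map_option f (l' x)"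
      using fish_on_iso[OF G(2) es G(3)] by blast
    have "n' = n" using bij_betw_same_card[OF f(1)] by simp
    then have "fish_iso (\<phi> (tree_perm T)) F"
      unfolding fish_iso_def G(1) Fe ncells_def ur_def lr_def using f by auto
    then show "\<exists>\<pi>. two_stack_sortable \<pi> \<and> fish_iso (\<phi> \<pi>) F" using t by blast
  next
    fix \<pi> assume t: "two_stack_sortable \<pi>"
    define T where "T = \<tau> \<pi>"
    have T: "valid T" "T \<noteq> Leaf" "tree_perm T = \<pi>" using \<phi>[OF t] T_def by auto
    obtain n u l es where G: "\<phi> \<pi> = (n, u, l)" "fish_on {..<n} u l es" "map snd es = tree_word T"
      using \<phi>[OF t] T_def by blast
    obtain vt where vt: "fish_boundary n u l es vt" using fish_boundary_exists[OF G(2)] by blast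
    interpret fish_boundary n u l es vt by (rule vt)
    note W = tree_word_stats[OF T(1,2)] tree_word_fw[OF T(1,2)] tree_perm_stats[OF T(1)] tree_perm_good[OF T(1)]
    \<comment> \<open>Every index but the last is an ascent or a descent; the count is made on the
      tree.\<close>
    have len: "ascents \<pi> + descents \<pi> + 1 = length \<pi>"
    proof -
      have "length (tree_perm T) = asc_t T + des_t T + 1" if "valid T" "T \<noteq> Leaf" for T
        using that
      proof (induction T)
        case (Node l r j)
        then show ?case by (cases "l = Leaf"; cases "r = Leaf") (auto simp: join_def)
      qed simp
      from this[OF T(1,2)] show ?thesis using T(3) W by simp
    qed
    show "card (left_lower_free_edges (\<phi> \<pi>)) = ascents \<pi> + 1"
      using W T(3) count_edges[of LL] G(3) unfolding left_lower_free_edges_def G(1) by simp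
    show "card (right_lower_free_edges (\<phi> \<pi>)) = descents \<pi> + 1"
      using W T(3) count_edges[of LR] G(3) unfolding right_lower_free_edges_def G(1) by simp
    show "card (lower_free_edges (\<phi> \<pi>)) = length \<pi> + 1"
      using W T(3) lower_count G(3) len unfolding G(1) by simp
    show "fin_length (\<phi> \<pi>) = ltr_maxima (stack_sort \<pi>) + 1"
      using W T(3) fin_count G(3) unfolding G(1) by simp
    show "card (tails (\<phi> \<pi>)) = precedes_pred_count (stack_sort \<pi>) + 1"
      using W T(3) tails_count G(3) unfolding G(1) by simp
  qed
qed

end
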